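(* Let $G$ be a finite group and let $\mathcal{G}$ be a Green ring on the category $\mathcal{D}(G)$ of finite left $G$-sets. A finite $G$-set $X$ is a Dress generating set for $\mathcal{G}$ if and only if it is a Dress generating set for the Burnside quotient Green ring $\mathcal{A}_{\mathcal{G}}$.
   Context: $G$ is a finite group, $\mathcal{D}(G)$ is the category of finite left $G$-sets and $G$-maps, $\bullet$ is the one-point $G$-set, $\mathcal{A}b$ is the category of abelian groups. Mackey functors. A Mackey functor is a pair $\mathcal{M}=(\mathcal{M}_*,\mathcal{M}^* )$ of a covariant functor $\mathcal{M}_*$ and a contravariant functor $\mathcal{M}^*$ from $\mathcal{D}(G)$ to $\mathcal{A}b$ with the same value $\mathcal{M}(S)$ on each object $S$; for a $G$-map $\varphi\colon S\to T$ write $\varphi_{\mathcal{M}}=\mathcal{M}_*(\varphi)\colon\mathcal{M}(S)\to\mathcal{M}(T)$ and $\varphi^{\mathcal{M}}=\mathcal{M}^*(\varphi)\colon\mathcal{M}(T)\to\mathcal{M}(S)$. It must satisfy: (M1) for every pullback square of finite $G$-sets with maps $\Psi\colon S\to S_1$, $\Phi\colon S\to S_2$, $\varphi\colon S_1\to T$, $\psi\colon S_2\to T$, one has $\varphi^{\mathcal{M}}\circ\psi_{\mathcal{M}}=\Psi_{\mathcal{M}}\circ\Phi^{\mathcal{M}}$; (M2) the inclusions of $S_1,S_2$ in $S_1\sqcup S_2$ induce an isomorphism $\mathcal{M}^*(S_1\sqcup S_2)\to\mathcal{M}^*(S_1)\oplus\mathcal{M}^*(S_2)$, and $\mathcal{M}(\emptyset)=0$.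 Green rings. A pairing $\mathcal{M}\times\mathcal{N}\to\mathcal{L}$ of Mackey functors is a family of bilinear maps $\mathcal{M}(S)\times\mathcal{N}(S)\to\mathcal{L}(S)$ such that for all $\varphi\colon S\to T$: $\varphi^{\mathcal{L}}(x\cdot y)=\varphi^{\mathcal{M}}(x)\cdot\varphi^{\mathcal{N}}(y)$; $x\cdot\varphi_{\mathcal{N}}(y)=\varphi_{\mathcal{L}}(\varphi^{\mathcal{M}}(x)\cdot y)$; $\varphi_{\mathcal{M}}(x)\cdot y=\varphi_{\mathcal{L}}(x\cdot\varphi^{\mathcal{N}}(y))$. A Green ring is a Mackey functor $\mathcal{G}$ with a pairing $\mathcal{G}\times\mathcal{G}\to\mathcal{G}$ and elements $1_S\in\mathcal{G}(S)$ making each $\mathcal{G}(S)$ an associative ring with unit $1_S$, such that $\varphi^{\mathcal{G}}(1_T)=1_S$ for every $\varphi\colon S\to T$. Burnside ring. $\mathcal{A}(S)$ is the Grothendieck group (under disjoint union) of isomorphism classes of finite $G$-sets $(X,f\colon X\to S)$ over $S$; for $\varphi\colon S\to T$, $\varphi_{\mathcal{A}}$ is composition with $\varphi$ and $\varphi^{\mathcal{A}}$ is pullback along $\varphi$; the product is fibre product over $S$. This is a Green ring. It acts on any Mackey functor $\mathcal{M}$ by the pairing $[X,f]\cdot x=f_{\mathcal{M}}(f^{\mathcal{M}}(x))$ for $x\in\mathcal{M}(S)$. Burnside quotient Green ring. For a Mackey functor $\mathcal{M}$, let $I_{\mathcal{M}}(S)$ be the set of $a\in\mathcal{A}(S)$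 such that $\varphi_{\mathcal{A}}(a)\cdot y=0$ and $\psi^{\mathcal{A}}(a)\cdot z=0$ for all $G$-maps $\varphi\colon S\to T$, $\psi\colon U\to S$ and all $y\in\mathcal{M}(T)$, $z\in\mathcal{M}(U)$. Then $I_{\mathcal{M}}$ is a sub-bifunctor of $\mathcal{A}$ consisting of two-sided ideals, and $\mathcal{A}_{\mathcal{M}}:=\mathcal{A}/I_{\mathcal{M}}$ is a Green ring. Dress generating sets. A family of subgroups of $G$ is a set of subgroups closed under conjugation and taking subgroups. For a finite $G$-set $X$, $\mathcal{F}(X)$ is the family generated by the isotropy subgroups of $X$. For a family $\mathcal{F}$, $X(\mathcal{F})$ is the disjoint union of the $G$-sets $G/H$, one for each conjugacy class of maximal elements $H$ of $\mathcal{F}$. For a prime $p$ and a finite group $H$, $O^p(H)$ is the intersection of all normal subgroups of $H$ with quotient a $p$-group. $hyper_p\text{-}\mathcal{F}$ is the family of all subgroups $H\le G$ with $O^p(H)\in\mathcal{F}$, and $hyper_p\text{-}X:=X(hyper_p\text{-}\mathcal{F}(X))$. A finite $G$-set $X$ is a Dress generating set for a Green ring $\mathcal{G}$ if for every prime $p$ the map $\mathcal{G}(hyper_p\text{-}X)\otimes\mathbf{Z}_{(p)}\to\mathcal{G}(\bullet)\otimes\mathbf{Z}_{(p)}$ induced covariantly by the projection $hyper_p\text{-}X\to\bullet$ is surjective. *)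

theory Defs
  imports
    "HOL-Algebra.Group_Action" "HOL-Algebra.Left_Coset" "HOL-Algebra.QuotRing"
    "HOL-Algebra.Generated_Groups" "HOL-Algebra.Free_Abelian_Groups"
    "HOL-Computational_Algebra.Primes"
begin

section \<open>Finite $G$-sets\<close>

record ('g, 'a) gset =
  pts :: "'a set"
  act :: "'g \<Rightarrow> 'a \<Rightarrow> 'a"

definition fin_gset :: "('g, 'b) monoid_scheme \<Rightarrow> ('g, 'a) gset \<Rightarrow> bool" where
  "fin_gset G X \<longleftrightarrow> finite (pts X) \<and> group_action G (pts X) (act X)"

text \<open>Morphisms are extensional functions, so that two maps agreeing on the points of their
  source are equal. Source and target may have points in different types; this is used to compare
  the explicit constructions below with \<open>G\<close>-sets whose points lie in a fixed type.\<close>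

definition gmaps ::
    "('g, 'b) monoid_scheme \<Rightarrow> ('g, 'a) gset \<Rightarrow> ('g, 'c) gset \<Rightarrow> ('a \<Rightarrow> 'c) set" where
  "gmaps G X Y =
     {f \<in> pts X \<rightarrow>\<^sub>E pts Y. \<forall>g \<in> carrier G. \<forall>x \<in> pts X. f (act X g x) = act Y g (f x)}"

definition gisos ::
    "('g, 'b) monoid_scheme \<Rightarrow> ('g, 'a) gset \<Rightarrow> ('g, 'c) gset \<Rightarrow> ('a \<Rightarrow> 'c) set" where
  "gisos G X Y = {f \<in> gmaps G X Y. bij_betw f (pts X) (pts Y)}"

definition disj_union :: "('g, 'a) gset \<Rightarrow> ('g, 'c) gset \<Rightarrow> ('g, 'a + 'c) gset" where
  "disj_union X Y =
     \<lparr>pts = pts X <+> pts Y,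
      act = (\<lambda>g. \<lambda>z \<in> pts X <+> pts Y. map_sum (act X g) (act Y g) z)\<rparr>"

definition fibre_points :: "('a \<Rightarrow> 't) \<Rightarrow> ('c \<Rightarrow> 't) \<Rightarrow> 'a set \<Rightarrow> 'c set \<Rightarrow> ('a \<times> 'c) set" where
  "fibre_points f g A B = {(x, y) \<in> A \<times> B. f x = g y}"

definition fibre_prod ::
    "('a \<Rightarrow> 't) \<Rightarrow> ('c \<Rightarrow> 't) \<Rightarrow> ('g, 'a) gset \<Rightarrow> ('g, 'c) gset \<Rightarrow> ('g, 'a \<times> 'c) gset" where
  "fibre_prod f g X Y =
     \<lparr>pts = fibre_points f g (pts X) (pts Y),
      act = (\<lambda>k. \<lambda>z \<in> fibre_points f g (pts X) (pts Y). map_prod (act X k) (act Y k) z)\<rparr>"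

text \<open>The point itself is irrelevant; \<open>undefined\<close> is just an element available in every type.\<close>

definition one_point :: "('g, 'a) gset" where
  "one_point = \<lparr>pts = {undefined}, act = (\<lambda>g. \<lambda>x \<in> {undefined}. x)\<rparr>"

definition to_point :: "('g, 'a) gset \<Rightarrow> 'a \<Rightarrow> 'a" where
  "to_point X = (\<lambda>x \<in> pts X. undefined)"

text \<open>\<open>S\<close> with \<open>\<Psi> : S \<rightarrow> S\<^sub>1\<close> and \<open>\<Phi> : S \<rightarrow> S\<^sub>2\<close> is a pullback of \<open>\<phi> : S\<^sub>1 \<rightarrow> T\<close> and \<open>\<psi> : S\<^sub>2 \<rightarrow> T\<close>.\<close>

definition pullback_square ::
    "('g, 'b) monoid_scheme \<Rightarrow> ('g, 'a) gset \<Rightarrow> ('g, 'a) gset \<Rightarrow> ('g, 'a) gset \<Rightarrow> ('g, 'a) gset \<Rightarrow>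
     ('a \<Rightarrow> 'a) \<Rightarrow> ('a \<Rightarrow> 'a) \<Rightarrow> ('a \<Rightarrow> 'a) \<Rightarrow> ('a \<Rightarrow> 'a) \<Rightarrow> bool" where
  "pullback_square G S S1 S2 T \<Psi> \<Phi> \<phi> \<psi> \<longleftrightarrow>
     \<Psi> \<in> gmaps G S S1 \<and> \<Phi> \<in> gmaps G S S2 \<and> \<phi> \<in> gmaps G S1 T \<and> \<psi> \<in> gmaps G S2 T \<and>
     (\<lambda>s \<in> pts S. (\<Psi> s, \<Phi> s)) \<in> gisos G S (fibre_prod \<phi> \<psi> S1 S2)"

definition coproduct_diagram ::
    "('g, 'b) monoid_scheme \<Rightarrow> ('g, 'a) gset \<Rightarrow> ('g, 'a) gset \<Rightarrow> ('g, 'a) gset \<Rightarrow>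
     ('a \<Rightarrow> 'a) \<Rightarrow> ('a \<Rightarrow> 'a) \<Rightarrow> bool" where
  "coproduct_diagram G S1 S2 S \<iota>1 \<iota>2 \<longleftrightarrow>
     \<iota>1 \<in> gmaps G S1 S \<and> \<iota>2 \<in> gmaps G S2 S \<and>
     (\<lambda>z \<in> pts S1 <+> pts S2. case_sum \<iota>1 \<iota>2 z) \<in> gisos G (disj_union S1 S2) S"


section \<open>Mackey functors and Green rings\<close>

text \<open>The objects of the category of finite \<open>G\<close>-sets are taken with points in a type \<open>'u\<close>, which the
  theorem assumes to be infinite, so that every finite \<open>G\<close>-set has an isomorphic copy among them.
  Values are ring records: for a Mackey functor only the additive structure is used, and a Green
  ring is a Mackey functor whose multiplicative structure satisfies further conditions.
  \<open>mcov M S T \<phi>\<close> and \<open>mcon M S T \<phi>\<close> are the covariant and contravariant maps induced by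
  \<open>\<phi> : S \<rightarrow> T\<close>.\<close>

record ('g, 'u, 'm) mackey =
  mval :: "('g, 'u) gset \<Rightarrow> 'm ring"
  mcov :: "('g, 'u) gset \<Rightarrow> ('g, 'u) gset \<Rightarrow> ('u \<Rightarrow> 'u) \<Rightarrow> 'm \<Rightarrow> 'm"
  mcon :: "('g, 'u) gset \<Rightarrow> ('g, 'u) gset \<Rightarrow> ('u \<Rightarrow> 'u) \<Rightarrow> 'm \<Rightarrow> 'm"

locale mackey_functor =
  fixes G :: "('g, 'b) monoid_scheme" and M :: "('g, 'u, 'm) mackey"
  assumes val_abelian: "fin_gset G S \<Longrightarrow> abelian_group (mval M S)"
    and cov_hom: "\<lbrakk>fin_gset G S; fin_gset G T; \<phi> \<in> gmaps G S T\<rbrakk>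
      \<Longrightarrow> mcov M S T \<phi> \<in> hom (add_monoid (mval M S)) (add_monoid (mval M T))"
    and con_hom: "\<lbrakk>fin_gset G S; fin_gset G T; \<phi> \<in> gmaps G S T\<rbrakk>
      \<Longrightarrow> mcon M S T \<phi> \<in> hom (add_monoid (mval M T)) (add_monoid (mval M S))"
    and cov_id: "\<lbrakk>fin_gset G S; x \<in> carrier (mval M S)\<rbrakk>
      \<Longrightarrow> mcov M S S (\<lambda>s \<in> pts S. s) x = x"
    and con_id: "\<lbrakk>fin_gset G S; x \<in> carrier (mval M S)\<rbrakk>
      \<Longrightarrow> mcon M S S (\<lambda>s \<in> pts S. s) x = x"
    and cov_compose: "\<lbrakk>fin_gset G S; fin_gset G T; fin_gset G U;
        \<phi> \<in> gmaps G S T; \<psi> \<in> gmaps G T U; x \<in> carrier (mval M S)\<rbrakk>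
      \<Longrightarrow> mcov M S U (compose (pts S) \<psi> \<phi>) x = mcov M T U \<psi> (mcov M S T \<phi> x)"
    and con_compose: "\<lbrakk>fin_gset G S; fin_gset G T; fin_gset G U;
        \<phi> \<in> gmaps G S T; \<psi> \<in> gmaps G T U; x \<in> carrier (mval M U)\<rbrakk>
      \<Longrightarrow> mcon M S U (compose (pts S) \<psi> \<phi>) x = mcon M S T \<phi> (mcon M T U \<psi> x)"
    and pullback: "\<lbrakk>fin_gset G S; fin_gset G S1; fin_gset G S2; fin_gset G T;
        pullback_square G S S1 S2 T \<Psi> \<Phi> \<phi> \<psi>; x \<in> carrier (mval M S2)\<rbrakk>
      \<Longrightarrow> mcon M S1 T \<phi> (mcov M S2 T \<psi> x) = mcov M S S1 \<Psi> (mcon M S S2 \<Phi> x)"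
    and coproduct: "\<lbrakk>fin_gset G S1; fin_gset G S2; fin_gset G S;
        coproduct_diagram G S1 S2 S \<iota>1 \<iota>2\<rbrakk>
      \<Longrightarrow> (\<lambda>x. (mcon M S1 S \<iota>1 x, mcon M S2 S \<iota>2 x))
            \<in> iso (add_monoid (mval M S)) (add_monoid (mval M S1) \<times>\<times> add_monoid (mval M S2))"
    and empty: "\<lbrakk>fin_gset G S; pts S = {}\<rbrakk> \<Longrightarrow> carrier (mval M S) = {\<zero>\<^bsub>mval M S\<^esub>}"

locale mackey_pairing =
  M: mackey_functor G M + N: mackey_functor G N + L: mackey_functor G L
  for G :: "('g, 'b) monoid_scheme" and M :: "('g, 'u, 'm) mackey" and N :: "('g, 'u, 'n) mackey"
    and L :: "('g, 'u, 'l) mackey" +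
  fixes P :: "('g, 'u) gset \<Rightarrow> 'm \<Rightarrow> 'n \<Rightarrow> 'l"
  assumes closed: "\<lbrakk>fin_gset G S; x \<in> carrier (mval M S); y \<in> carrier (mval N S)\<rbrakk>
      \<Longrightarrow> P S x y \<in> carrier (mval L S)"
    and add_left: "\<lbrakk>fin_gset G S; x \<in> carrier (mval M S); x' \<in> carrier (mval M S);
        y \<in> carrier (mval N S)\<rbrakk>
      \<Longrightarrow> P S (x \<oplus>\<^bsub>mval M S\<^esub> x') y = P S x y \<oplus>\<^bsub>mval L S\<^esub> P S x' y"
    and add_right: "\<lbrakk>fin_gset G S; x \<in> carrier (mval M S); y \<in> carrier (mval N S);
        y' \<in> carrier (mval N S)\<rbrakk>
      \<Longrightarrow> P S x (y \<oplus>\<^bsub>mval N S\<^esub> y') = P S x y \<oplus>\<^bsub>mval L S\<^esub> P S x y'"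
    and con_pairing: "\<lbrakk>fin_gset G S; fin_gset G T; \<phi> \<in> gmaps G S T;
        x \<in> carrier (mval M T); y \<in> carrier (mval N T)\<rbrakk>
      \<Longrightarrow> mcon L S T \<phi> (P T x y) = P S (mcon M S T \<phi> x) (mcon N S T \<phi> y)"
    and frobenius_left: "\<lbrakk>fin_gset G S; fin_gset G T; \<phi> \<in> gmaps G S T;
        x \<in> carrier (mval M T); y \<in> carrier (mval N S)\<rbrakk>
      \<Longrightarrow> P T x (mcov N S T \<phi> y) = mcov L S T \<phi> (P S (mcon M S T \<phi> x) y)"
    and frobenius_right: "\<lbrakk>fin_gset G S; fin_gset G T; \<phi> \<in> gmaps G S T;
        x \<in> carrier (mval M S); y \<in> carrier (mval N T)\<rbrakk>
      \<Longrightarrow> P T (mcov M S T \<phi> x) y = mcov L S T \<phi> (P S x (mcon N S T \<phi> y))"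

locale green_ring =
  mackey_pairing G R R R "\<lambda>S x y. x \<otimes>\<^bsub>mval R S\<^esub> y"
  for G :: "('g, 'b) monoid_scheme" and R :: "('g, 'u, 'm) mackey" +
  assumes val_ring: "fin_gset G S \<Longrightarrow> ring (mval R S)"
    and con_one: "\<lbrakk>fin_gset G S; fin_gset G T; \<phi> \<in> gmaps G S T\<rbrakk>
      \<Longrightarrow> mcon R S T \<phi> \<one>\<^bsub>mval R T\<^esub> = \<one>\<^bsub>mval R S\<^esub>"


section \<open>The Burnside ring\<close>

subsection \<open>Grothendieck ring of a semiring\<close>

definition groth_rel :: "'a ring \<Rightarrow> (('a \<times> 'a) \<times> ('a \<times> 'a)) set" where
  "groth_rel R = {((a, b), (c, d)). a \<in> carrier R \<and> b \<in> carrier R \<and> c \<in> carrier R \<and> d \<in> carrier R \<and>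
     (\<exists>e \<in> carrier R. a \<oplus>\<^bsub>R\<^esub> d \<oplus>\<^bsub>R\<^esub> e = c \<oplus>\<^bsub>R\<^esub> b \<oplus>\<^bsub>R\<^esub> e)}"

text \<open>The formal difference \<open>a - b\<close>.\<close>

definition groth_diff :: "'a ring \<Rightarrow> 'a \<Rightarrow> 'a \<Rightarrow> ('a \<times> 'a) set" where
  "groth_diff R a b = groth_rel R `` {(a, b)}"

definition groth_ring :: "'a ring \<Rightarrow> ('a \<times> 'a) set ring" where
  "groth_ring R =
     \<lparr>carrier = (carrier R \<times> carrier R) // groth_rel R,
      monoid.mult = (\<lambda>x y. \<Union>(a, b) \<in> x. \<Union>(c, d) \<in> y.
        groth_diff R (a \<otimes>\<^bsub>R\<^esub> c \<oplus>\<^bsub>R\<^esub> b \<otimes>\<^bsub>R\<^esub> d) (a \<otimes>\<^bsub>R\<^esub> d \<oplus>\<^bsub>R\<^esub> b \<otimes>\<^bsub>R\<^esub> c)),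
      one = groth_diff R \<one>\<^bsub>R\<^esub> \<zero>\<^bsub>R\<^esub>,
      ring.zero = groth_diff R \<zero>\<^bsub>R\<^esub> \<zero>\<^bsub>R\<^esub>,
      ring.add = (\<lambda>x y. \<Union>(a, b) \<in> x. \<Union>(c, d) \<in> y. groth_diff R (a \<oplus>\<^bsub>R\<^esub> c) (b \<oplus>\<^bsub>R\<^esub> d))\<rparr>"

definition groth_map :: "'c ring \<Rightarrow> ('a \<Rightarrow> 'c) \<Rightarrow> ('a \<times> 'a) set \<Rightarrow> ('c \<times> 'c) set" where
  "groth_map R' h x = (\<Union>(a, b) \<in> x. groth_diff R' (h a) (h b))"

subsection \<open>Isomorphism classes of finite $G$-sets over a finite $G$-set\<close>

type_synonym ('g, 'u) over = "('g, 'u) gset \<times> ('u \<Rightarrow> 'u)"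

text \<open>The isomorphism class of \<open>(X, f : X \<rightarrow> S)\<close> consists of all isomorphic objects over \<open>S\<close> with points
  in \<open>'u\<close>, where the points of \<open>X\<close> itself may lie in another type (a sum or product type, below).
  All operations on classes are unions, over all representatives, of one and the same class.\<close>

definition over_class :: "('g, 'b) monoid_scheme \<Rightarrow> ('g, 'u) gset \<Rightarrow> ('g, 'a) gset \<Rightarrow> ('a \<Rightarrow> 'u) \<Rightarrow>
    ('g, 'u) over set" where
  "over_class G S X f = {(Y, g). fin_gset G Y \<and> g \<in> gmaps G Y S \<and>
     (\<exists>h \<in> gisos G X Y. \<forall>x \<in> pts X. g (h x) = f x)}"

definition over_semiring ::
    "('g, 'b) monoid_scheme \<Rightarrow> ('g, 'u) gset \<Rightarrow> ('g, 'u) over set ring" where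
  "over_semiring G S =
     \<lparr>carrier = {over_class G S X f | (X :: ('g, 'u) gset) f. fin_gset G X \<and> f \<in> gmaps G X S},
      monoid.mult = (\<lambda>C D. \<Union>(X, f) \<in> C. \<Union>(Y, g) \<in> D.
        over_class G S (fibre_prod f g X Y) (\<lambda>(x, y). f x)),
      one = over_class G S S (\<lambda>s \<in> pts S. s),
      ring.zero = over_class G S \<lparr>pts = ({} :: 'u set), act = (\<lambda>g. \<lambda>x \<in> {}. x)\<rparr> (\<lambda>x \<in> {}. x),
      ring.add = (\<lambda>C D. \<Union>(X, f) \<in> C. \<Union>(Y, g) \<in> D. over_class G S (disj_union X Y) (case_sum f g))\<rparr>"

definition over_push :: "('g, 'b) monoid_scheme \<Rightarrow> ('g, 'u) gset \<Rightarrow> ('u \<Rightarrow> 'u) \<Rightarrow>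
    ('g, 'u) over set \<Rightarrow> ('g, 'u) over set" where
  "over_push G T \<phi> C = (\<Union>(X, f) \<in> C. over_class G T X (compose (pts X) \<phi> f))"

definition over_pull :: "('g, 'b) monoid_scheme \<Rightarrow> ('g, 'u) gset \<Rightarrow> ('u \<Rightarrow> 'u) \<Rightarrow>
    ('g, 'u) over set \<Rightarrow> ('g, 'u) over set" where
  "over_pull G S \<phi> C = (\<Union>(X, f) \<in> C. over_class G S (fibre_prod \<phi> f S X) fst)"

type_synonym ('g, 'u) burnside_elt = "(('g, 'u) over set \<times> ('g, 'u) over set) set"

definition burnside :: "('g, 'b) monoid_scheme \<Rightarrow> ('g, 'u, ('g, 'u) burnside_elt) mackey" where
  "burnside G =
     \<lparr>mval = (\<lambda>S. groth_ring (over_semiring G S)),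
      mcov = (\<lambda>S T \<phi>. groth_map (over_semiring G T) (over_push G T \<phi>)),
      mcon = (\<lambda>S T \<phi>. groth_map (over_semiring G S) (over_pull G S \<phi>))\<rparr>"

subsection \<open>Action on a Mackey functor and the quotient Green ring\<close>

definition over_act :: "('g, 'u, 'm) mackey \<Rightarrow> ('g, 'u) gset \<Rightarrow> ('g, 'u) over set \<Rightarrow> 'm \<Rightarrow> 'm" where
  "over_act M S C x = the_elem ((\<lambda>(X, f). mcov M X S f (mcon M X S f x)) ` C)"

definition burnside_act ::
    "('g, 'u, 'm) mackey \<Rightarrow> ('g, 'u) gset \<Rightarrow> ('g, 'u) burnside_elt \<Rightarrow> 'm \<Rightarrow> 'm" where
  "burnside_act M S a x =
     the_elem ((\<lambda>(C, D). over_act M S C x \<ominus>\<^bsub>mval M S\<^esub> over_act M S D x) ` a)"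

definition burnside_annihilator :: "('g, 'b) monoid_scheme \<Rightarrow> ('g, 'u, 'm) mackey \<Rightarrow>
    ('g, 'u) gset \<Rightarrow> ('g, 'u) burnside_elt set" where
  "burnside_annihilator G M S = {a \<in> carrier (mval (burnside G) S).
     (\<forall>T \<phi> y. fin_gset G T \<and> \<phi> \<in> gmaps G S T \<and> y \<in> carrier (mval M T) \<longrightarrow>
        burnside_act M T (mcov (burnside G) S T \<phi> a) y = \<zero>\<^bsub>mval M T\<^esub>) \<and>
     (\<forall>U \<psi> z. fin_gset G U \<and> \<psi> \<in> gmaps G U S \<and> z \<in> carrier (mval M U) \<longrightarrow>
        burnside_act M U (mcon (burnside G) U S \<psi> a) z = \<zero>\<^bsub>mval M U\<^esub>)}"

text \<open>The induced map of quotients sends a coset of \<open>a\<close> to the coset of \<open>h a\<close>.\<close>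

definition quot_map :: "'c ring \<Rightarrow> 'c set \<Rightarrow> ('a \<Rightarrow> 'c) \<Rightarrow> 'a set \<Rightarrow> 'c set" where
  "quot_map R' I' h A = (\<Union>a \<in> A. I' +>\<^bsub>R'\<^esub> h a)"

definition burnside_quotient :: "('g, 'b) monoid_scheme \<Rightarrow> ('g, 'u, 'm) mackey \<Rightarrow>
    ('g, 'u, ('g, 'u) burnside_elt set) mackey" where
  "burnside_quotient G M =
     \<lparr>mval = (\<lambda>S. mval (burnside G) S Quot burnside_annihilator G M S),
      mcov = (\<lambda>S T \<phi>. quot_map (mval (burnside G) T) (burnside_annihilator G M T)
                 (mcov (burnside G) S T \<phi>)),
      mcon = (\<lambda>S T \<phi>. quot_map (mval (burnside G) S) (burnside_annihilator G M S)
                 (mcon (burnside G) S T \<phi>))\<rparr>"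


section \<open>Families of subgroups\<close>

definition conjugate :: "('g, 'b) monoid_scheme \<Rightarrow> 'g \<Rightarrow> 'g set \<Rightarrow> 'g set" where
  "conjugate G g H = g <#\<^bsub>G\<^esub> H #>\<^bsub>G\<^esub> inv\<^bsub>G\<^esub> g"

definition subgroup_family :: "('g, 'b) monoid_scheme \<Rightarrow> 'g set set \<Rightarrow> bool" where
  "subgroup_family G \<F> \<longleftrightarrow>
     (\<forall>H \<in> \<F>. subgroup H G) \<and>
     (\<forall>H \<in> \<F>. \<forall>g \<in> carrier G. conjugate G g H \<in> \<F>) \<and>
     (\<forall>H \<in> \<F>. \<forall>K. subgroup K G \<and> K \<subseteq> H \<longrightarrow> K \<in> \<F>)"

definition isotropy_family :: "('g, 'b) monoid_scheme \<Rightarrow> ('g, 'a) gset \<Rightarrow> 'g set set" where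
  "isotropy_family G X =
     \<Inter> {\<F>. subgroup_family G \<F> \<and> (\<forall>x \<in> pts X. stabilizer G (act X) x \<in> \<F>)}"

definition p_residual :: "('g, 'b) monoid_scheme \<Rightarrow> nat \<Rightarrow> 'g set \<Rightarrow> 'g set" where
  "p_residual G p H =
     \<Inter> {N. N \<lhd> (G\<lparr>carrier := H\<rparr>) \<and> (\<exists>k. order (G\<lparr>carrier := H\<rparr> Mod N) = p ^ k)}"

definition hyper_family :: "('g, 'b) monoid_scheme \<Rightarrow> nat \<Rightarrow> 'g set set \<Rightarrow> 'g set set" where
  "hyper_family G p \<F> = {H. subgroup H G \<and> p_residual G p H \<in> \<F>}"

definition maximal_elements :: "'g set set \<Rightarrow> 'g set set" where
  "maximal_elements \<F> = {H \<in> \<F>. \<forall>K \<in> \<F>. H \<subseteq> K \<longrightarrow> K = H}"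

definition maximal_class_reps :: "('g, 'b) monoid_scheme \<Rightarrow> 'g set set \<Rightarrow> 'g set set" where
  "maximal_class_reps G \<F> =
     (\<lambda>H. SOME K. K \<in> (\<lambda>g. conjugate G g H) ` carrier G) ` maximal_elements \<F>"

text \<open>The disjoint union of the \<open>G/H\<close>, where \<open>H\<close> runs over representatives of the conjugacy classes of
  maximal elements of \<open>\<F>\<close>; the coset \<open>aH\<close> in the summand \<open>G/H\<close> is encoded as \<open>(H, aH)\<close>.\<close>

definition family_points :: "('g, 'b) monoid_scheme \<Rightarrow> 'g set set \<Rightarrow> ('g set \<times> 'g set) set" where
  "family_points G \<F> = (SIGMA H : maximal_class_reps G \<F>. lcosets\<^bsub>G\<^esub> H)"

definition family_gset ::
    "('g, 'b) monoid_scheme \<Rightarrow> 'g set set \<Rightarrow> ('g, 'g set \<times> 'g set) gset" where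
  "family_gset G \<F> =
     \<lparr>pts = family_points G \<F>,
      act = (\<lambda>g. \<lambda>z \<in> family_points G \<F>. map_prod id (\<lambda>C. g <#\<^bsub>G\<^esub> C) z)\<rparr>"

text \<open>A copy with points in \<open>'u\<close>; it exists because \<open>'u\<close> is assumed to be infinite.\<close>

definition hyper :: "('g, 'b) monoid_scheme \<Rightarrow> nat \<Rightarrow> ('g, 'u) gset \<Rightarrow> ('g, 'u) gset" where
  "hyper G p X =
     (SOME Y. fin_gset G Y \<and>
        gisos G (family_gset G (hyper_family G p (isotropy_family G X))) Y \<noteq> {})"


section \<open>Tensor products and Dress generating sets\<close>

definition tensor_relations ::
    "('a, 'b) monoid_scheme \<Rightarrow> ('c, 'd) monoid_scheme \<Rightarrow> (('a \<times> 'c) \<Rightarrow>\<^sub>0 int) set" where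
  "tensor_relations A B =
     {frag_of (a \<otimes>\<^bsub>A\<^esub> a', b) - frag_of (a, b) - frag_of (a', b) | a a' b.
        a \<in> carrier A \<and> a' \<in> carrier A \<and> b \<in> carrier B} \<union>
     {frag_of (a, b \<otimes>\<^bsub>B\<^esub> b') - frag_of (a, b) - frag_of (a, b') | a b b'.
        a \<in> carrier A \<and> b \<in> carrier B \<and> b' \<in> carrier B}"

definition tensor_kernel ::
    "('a, 'b) monoid_scheme \<Rightarrow> ('c, 'd) monoid_scheme \<Rightarrow> (('a \<times> 'c) \<Rightarrow>\<^sub>0 int) set" where
  "tensor_kernel A B =
     generate (free_Abelian_group (carrier A \<times> carrier B)) (tensor_relations A B)"

definition tensor ::
    "('a, 'b) monoid_scheme \<Rightarrow> ('c, 'd) monoid_scheme \<Rightarrow> (('a \<times> 'c) \<Rightarrow>\<^sub>0 int) set monoid" where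
  "tensor A B = free_Abelian_group (carrier A \<times> carrier B) Mod tensor_kernel A B"

text \<open>\<open>f \<otimes> id : A \<otimes> B \<rightarrow> A' \<otimes> B\<close>\<close>

definition tensor_map :: "('c, 'd) monoid_scheme \<Rightarrow> ('e, 'f) monoid_scheme \<Rightarrow> ('a \<Rightarrow> 'c) \<Rightarrow>
    (('a \<times> 'e) \<Rightarrow>\<^sub>0 int) set \<Rightarrow> (('c \<times> 'e) \<Rightarrow>\<^sub>0 int) set" where
  "tensor_map A' B f C =
     (\<Union>c \<in> C. tensor_kernel A' B #>\<^bsub>free_Abelian_group (carrier A' \<times> carrier B)\<^esub>
        frag_extend (\<lambda>(a, b). frag_of (f a, b)) c)"

text \<open>The additive group of the ring $\mathbf{Z}_{(p)}$.\<close>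

definition Z_localized :: "nat \<Rightarrow> rat monoid" where
  "Z_localized p =
     \<lparr>carrier = {of_int a / of_int b | a b. \<not> int p dvd b}, monoid.mult = (+), one = 0\<rparr>"

definition dress_generating_set ::
    "('g, 'b) monoid_scheme \<Rightarrow> ('g, 'u, 'm) mackey \<Rightarrow> ('g, 'u) gset \<Rightarrow> bool" where
  "dress_generating_set G R X \<longleftrightarrow>
     fin_gset G X \<and>
     (\<forall>p. prime p \<longrightarrow>
        tensor_map (add_monoid (mval R one_point)) (Z_localized p)
            (mcov R (hyper G p X) one_point (to_point (hyper G p X)))
          ` carrier (tensor (add_monoid (mval R (hyper G p X))) (Z_localized p))
        = carrier (tensor (add_monoid (mval R one_point)) (Z_localized p)))"

end

theory Submission
  imports Defs "HOL-Algebra.Sylow"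
begin

text \<open>
Fix a prime \<open>p\<close>, let \<open>\<F>\<close> be the family of the subgroups \<open>H\<close> with \<open>O\<^sup>p(H) \<in> \<F>(X)\<close>, let
\<open>Y = hyper\<^sub>p-X\<close>, and let \<open>\<pi>\<close> be the projection from \<open>Y\<close> to the point. Surjectivity after tensoring with
$\mathbf{Z}_{(p)}$ means that every element of the target has a multiple, by an integer prime to \<open>p\<close>, that
is induced from \<open>Y\<close> (\<open>tensor_map_localized_surj_iff\<close>). For \<open>R\<close> this is a statement about \<open>R(\<bullet>)\<close>; for the
Burnside quotient it says that every \<open>b \<in> A(\<bullet>)\<close> has a multiple with \<open>k b - \<pi>\<^sub>*(a) \<in> I\<^sub>R(\<bullet>)\<close>.

From the quotient to \<open>R\<close>: let \<open>k - \<pi>\<^sub>*(a) \<in> I\<^sub>R(\<bullet>)\<close> act on \<open>1 \<in> R(\<bullet>)\<close>. Frobenius reciprocity gives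
\<open>k\<cdot>1 = \<pi>\<^sub>*(a\<cdot>1)\<close>, and then \<open>k m = \<pi>\<^sub>*(\<pi>\<^sup>*(m) (a\<cdot>1))\<close> for every \<open>m\<close>
(\<open>multiple_induced_if_annihilator\<close>).

From \<open>R\<close> to the quotient: let \<open>k\<cdot>1 = \<pi>\<^sub>*(y)\<close> with \<open>k\<close> prime to \<open>p\<close>. The point is to find an integer \<open>n\<close> prime
to \<open>p\<close> and finite \<open>G\<close>-sets \<open>v\<close>, \<open>v'\<close> with maps to \<open>Y\<close> such that \<open>n + |v\<^sup>K| = |v'\<^sup>K|\<close> for all \<open>K \<in> \<F>\<close>.
For every \<open>K \<in> \<F>\<close> there is \<open>L \<in> \<F>\<close> such that \<open>n\<^sub>K = |(G/L)\<^sup>K|\<close> is prime to \<open>p\<close> (\<open>ex_fixed_coset_hyper\<close>): one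
descends from \<open>K\<close> to \<open>O\<^sup>p(K)\<close> and further through normal subgroups of \<open>p\<close>-power index, which preserves
the number of fixed points modulo \<open>p\<close>, to a \<open>p\<close>-perfect group \<open>J\<close>, and takes for \<open>L\<close> the product of \<open>J\<close> and a
Sylow \<open>p\<close>-subgroup of its normalizer. Since \<open>L/J\<close> is a \<open>p\<close>-group, \<open>O\<^sup>p(L) \<subseteq> J \<subseteq> O\<^sup>p(K)\<close>, and \<open>L \<in> \<F>\<close>. The virtual \<open>G\<close>-set \<open>n\<^sub>K - [G/L]\<close> has no virtual point fixed by \<open>K\<close>, and multiplying out
these differences over all \<open>K \<in> \<F>\<close> yields \<open>n + v - v'\<close> (\<open>ex_virtual_unit\<close>).

Now let \<open>b \<in> A(\<bullet>)\<close>. Then \<open>(v' - v) b\<close> is induced from \<open>Y\<close>, and \<open>e = (n + v - v') b\<close> has no virtual points fixed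
by a member of \<open>\<F>\<close>. It remains to see that \<open>k e\<close> annihilates \<open>R\<close>. For \<open>z \<in> R(U)\<close>, pulling back \<open>y\<close> to
\<open>W = U \<times> Y\<close> shows that \<open>k z = q\<^sub>*(w)\<close> for the projection \<open>q : W \<rightarrow> U\<close> and some \<open>w \<in> R(W)\<close>
(\<open>multiple_induced\<close>), so that \<open>e\<cdot>(k z) = q\<^sub>*(e|\<^sub>W\<cdot>w)\<close>. All isotropy groups of \<open>W\<close> lie in \<open>\<F>\<close>, and finite
\<open>G\<close>-sets over \<open>W\<close> are isomorphic if every subgroup has as many fixed points in the fibres of one as of the other
(\<open>over_iso_if_fixed_points\<close>). Hence \<open>e|\<^sub>W = 0\<close>.
\<close>

section \<open>Localized tensor products\<close>

lemma Z_localized_carrierI: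
  "\<not> int p dvd b \<Longrightarrow> of_int a / of_int b \<in> carrier (Z_localized p)"
  by (auto simp: Z_localized_def)

lemma comm_group_Z_localized:
  assumes "prime p"
  shows "comm_group (Z_localized p)"
proof -
  have ip: "prime (int p)" using assms by simp
  have nz: "b \<noteq> 0" if "\<not> int p dvd b" for b :: int using that by auto
  show ?thesis
  proof (rule comm_groupI)
    fix x y assume "x \<in> carrier (Z_localized p)" "y \<in> carrier (Z_localized p)"
    then obtain a b c d where *: "x = of_int a / of_int b" "\<not> int p dvd b"
      "y = of_int c / of_int d" "\<not> int p dvd d" by (auto simp: Z_localized_def)
    have "x + y = of_int (a * d + c * b) / of_int (b * d)"
      using * nz by (simp add: field_simps)
    moreover have "\<not> int p dvd b * d" using * ip by (simp add: prime_dvd_mult_iff)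
    ultimately show "x \<otimes>\<^bsub>Z_localized p\<^esub> y \<in> carrier (Z_localized p)"
      using Z_localized_carrierI by (metis (no_types, lifting) Z_localized_def monoid.select_convs(1))
  next
    have "\<not> int p dvd 1" using ip not_prime_unit by blast
    then show "\<one>\<^bsub>Z_localized p\<^esub> \<in> carrier (Z_localized p)"
      using Z_localized_carrierI[of p 1 0] by (simp add: Z_localized_def)
  next
    fix x assume "x \<in> carrier (Z_localized p)"
    then obtain a b where *: "x = of_int a / of_int b" "\<not> int p dvd b"
      by (auto simp: Z_localized_def)
    then have "of_int (- a) / of_int b \<in> carrier (Z_localized p)"
      using Z_localized_carrierI by blast
    then show "\<exists>y\<in>carrier (Z_localized p). y \<otimes>\<^bsub>Z_localized p\<^esub> x = \<one>\<^bsub>Z_localized p\<^esub>"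
      by (rule bexI[rotated]) (simp add: Z_localized_def *)
  qed (auto simp: Z_localized_def)
qed

context
  fixes A :: "('a, 'm) monoid_scheme" and B :: "('b, 'n) monoid_scheme"
  assumes A: "comm_group A" and B: "comm_group B"
begin

interpretation A: comm_group A by (rule A)
interpretation B: comm_group B by (rule B)

abbreviation (input) "Fr \<equiv> free_Abelian_group (carrier A \<times> carrier B)"

lemma tensor_relations_carrier: "tensor_relations A B \<subseteq> carrier Fr"
proof -
  have *: "frag_of (a, b) \<in> carrier Fr" if "a \<in> carrier A" "b \<in> carrier B" for a b
    using that by (simp add: keys_frag_of)
  have d: "x - y \<in> carrier Fr" if "x \<in> carrier Fr" "y \<in> carrier Fr" for x y :: "('a \<times> 'b) \<Rightarrow>\<^sub>0 int"
    using that keys_diff[of x y] by auto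
  show ?thesis unfolding tensor_relations_def
    by (auto intro!: d * simp del: carrier_free_Abelian_group_iff)
qed

lemma tensor_kernel_subgroup: "subgroup (tensor_kernel A B) Fr"
  unfolding tensor_kernel_def
  by (rule group.generate_is_subgroup[OF group_free_Abelian_group tensor_relations_carrier])

lemma tensor_kernel_add:
  "x \<in> tensor_kernel A B \<Longrightarrow> y \<in> tensor_kernel A B \<Longrightarrow> x + y \<in> tensor_kernel A B"
  using subgroup.m_closed[OF tensor_kernel_subgroup] by simp

lemma tensor_kernel_uminus: "x \<in> tensor_kernel A B \<Longrightarrow> - x \<in> tensor_kernel A B"
  using subgroup.m_inv_closed[OF tensor_kernel_subgroup, of x]
    subgroup.subset[OF tensor_kernel_subgroup]
  by (metis carrier_free_Abelian_group_iff inv_free_Abelian_group subsetD)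

lemma tensor_kernel_diff:
  "x \<in> tensor_kernel A B \<Longrightarrow> y \<in> tensor_kernel A B \<Longrightarrow> x - y \<in> tensor_kernel A B"
  using tensor_kernel_add[of x "- y"] tensor_kernel_uminus[of y] by simp

lemma tensor_kernel_zero: "0 \<in> tensor_kernel A B"
  using subgroup.one_closed[OF tensor_kernel_subgroup] by simp

lemma tensor_kernel_left:
  assumes "a \<in> carrier A" "a' \<in> carrier A" "b \<in> carrier B"
  shows "frag_of (a \<otimes>\<^bsub>A\<^esub> a', b) - frag_of (a, b) - frag_of (a', b) \<in> tensor_kernel A B"
  unfolding tensor_kernel_def
  by (rule generate.incl) (use assms in \<open>auto simp: tensor_relations_def\<close>)

lemma tensor_kernel_right:
  assumes "a \<in> carrier A" "b \<in> carrier B" "b' \<in> carrier B"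
  shows "frag_of (a, b \<otimes>\<^bsub>B\<^esub> b') - frag_of (a, b) - frag_of (a, b') \<in> tensor_kernel A B"
  unfolding tensor_kernel_def
  by (rule generate.incl) (use assms in \<open>auto simp: tensor_relations_def\<close>)

lemma tensor_kernel_pow_left:
  assumes "a \<in> carrier A" "b \<in> carrier B"
  shows "frag_of (a [^]\<^bsub>A\<^esub> (n::nat), b) - frag_cmul (int n) (frag_of (a, b)) \<in> tensor_kernel A B"
proof (induct n)
  case 0
  have "- (frag_of (\<one>\<^bsub>A\<^esub> \<otimes>\<^bsub>A\<^esub> \<one>\<^bsub>A\<^esub>, b) - frag_of (\<one>\<^bsub>A\<^esub>, b) - frag_of (\<one>\<^bsub>A\<^esub>, b)) \<in> tensor_kernel A B"
    by (intro tensor_kernel_uminus tensor_kernel_left) (use assms in auto)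
  then show ?case by simp
next
  case (Suc n)
  have "frag_of (a [^]\<^bsub>A\<^esub> n \<otimes>\<^bsub>A\<^esub> a, b) - frag_of (a [^]\<^bsub>A\<^esub> n, b) - frag_of (a, b) \<in> tensor_kernel A B"
    by (intro tensor_kernel_left) (use assms in auto)
  from tensor_kernel_add[OF this Suc] show ?case
    by (simp add: frag_cmul_distrib algebra_simps)
qed

lemma tensor_kernel_pow_right:
  assumes "a \<in> carrier A" "b \<in> carrier B"
  shows "frag_of (a, b [^]\<^bsub>B\<^esub> (n::nat)) - frag_cmul (int n) (frag_of (a, b)) \<in> tensor_kernel A B"
proof (induct n)
  case 0
  have "- (frag_of (a, \<one>\<^bsub>B\<^esub> \<otimes>\<^bsub>B\<^esub> \<one>\<^bsub>B\<^esub>) - frag_of (a, \<one>\<^bsub>B\<^esub>) - frag_of (a, \<one>\<^bsub>B\<^esub>)) \<in> tensor_kernel A B"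
    by (intro tensor_kernel_uminus tensor_kernel_right) (use assms in auto)
  then show ?case by simp
next
  case (Suc n)
  have "frag_of (a, b [^]\<^bsub>B\<^esub> n \<otimes>\<^bsub>B\<^esub> b) - frag_of (a, b [^]\<^bsub>B\<^esub> n) - frag_of (a, b) \<in> tensor_kernel A B"
    by (intro tensor_kernel_right) (use assms in auto)
  from tensor_kernel_add[OF this Suc] show ?case
    by (simp add: frag_cmul_distrib algebra_simps)
qed

lemma tensor_coset_mem:
  "x \<in> tensor_kernel A B #>\<^bsub>Fr\<^esub> c \<longleftrightarrow> x - c \<in> tensor_kernel A B"
  by (auto simp: r_coset_def intro!: exI[of _ "x - c"] bexI[of _ "x - c"])

lemma tensor_coset_eq:
  assumes "c - d \<in> tensor_kernel A B"
  shows "tensor_kernel A B #>\<^bsub>Fr\<^esub> c = tensor_kernel A B #>\<^bsub>Fr\<^esub> d"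
proof (rule Set.set_eqI)
  fix x
  have "x - c \<in> tensor_kernel A B \<Longrightarrow> x - d \<in> tensor_kernel A B"
    using tensor_kernel_add[OF _ assms, of "x - c"] by simp
  moreover have "x - d \<in> tensor_kernel A B \<Longrightarrow> x - c \<in> tensor_kernel A B"
    using tensor_kernel_diff[OF _ assms, of "x - d"] by simp
  ultimately show "x \<in> tensor_kernel A B #>\<^bsub>Fr\<^esub> c \<longleftrightarrow> x \<in> tensor_kernel A B #>\<^bsub>Fr\<^esub> d"
    unfolding tensor_coset_mem by blast
qed

lemma carrier_tensor:
  "carrier (tensor A B) = (\<lambda>c. tensor_kernel A B #>\<^bsub>Fr\<^esub> c) ` carrier Fr"
  by (auto simp: tensor_def FactGroup_def RCOSETS_def)

end

context
  fixes A :: "('a, 'm) monoid_scheme" and A' :: "('c, 'k) monoid_scheme"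
    and B :: "('b, 'n) monoid_scheme" and f :: "'a \<Rightarrow> 'c"
  assumes A: "comm_group A" and A': "comm_group A'" and B: "comm_group B"
    and f: "f \<in> hom A A'"
begin

interpretation A: comm_group A by (rule A)
interpretation A': comm_group A' by (rule A')
interpretation B: comm_group B by (rule B)

private abbreviation "ext \<equiv> frag_extend (\<lambda>(a, b). frag_of (f a, b) :: ('c \<times> 'b) \<Rightarrow>\<^sub>0 int)"

lemma tensor_map_kernel:
  assumes "c \<in> tensor_kernel A B"
  shows "ext c \<in> tensor_kernel A' B"
  using assms unfolding tensor_kernel_def[of A B]
proof (induct rule: generate.induct)
  case one
  then show ?case using tensor_kernel_zero[OF A' B] by simp
next
  have fm: "f (x \<otimes>\<^bsub>A\<^esub> y) = f x \<otimes>\<^bsub>A'\<^esub> f y" if "x \<in> carrier A" "y \<in> carrier A" for x y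
    using f that by (auto simp: hom_def)
  have fc: "f x \<in> carrier A'" if "x \<in> carrier A" for x using f that by (auto simp: hom_def)
  have incl: "ext h \<in> tensor_kernel A' B" if "h \<in> tensor_relations A B" for h
    using that unfolding tensor_relations_def
    by (auto simp: frag_extend_diff fm fc intro!: tensor_kernel_left[OF A' B] tensor_kernel_right[OF A' B])
  {
    case (incl h)
    then show ?case using \<open>\<And>h. h \<in> tensor_relations A B \<Longrightarrow> _\<close> by blast
  next
    case (inv h)
    then have "h \<in> carrier (free_Abelian_group (carrier A \<times> carrier B))"
      using tensor_relations_carrier[OF A B] by blast
    then have "inv\<^bsub>free_Abelian_group (carrier A \<times> carrier B)\<^esub> h = - h"
      by (simp add: inv_free_Abelian_group)
    then show ?case using incl[OF inv] tensor_kernel_uminus[OF A' B] by (simp add: frag_extend_minus)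
  next
    case (eng h1 h2)
    then show ?case using tensor_kernel_add[OF A' B] by (simp add: frag_extend_add)
  }
qed

lemma tensor_map_coset:
  assumes "c \<in> carrier (free_Abelian_group (carrier A \<times> carrier B))"
  shows "tensor_map A' B f (tensor_kernel A B #>\<^bsub>free_Abelian_group (carrier A \<times> carrier B)\<^esub> c)
     = tensor_kernel A' B #>\<^bsub>free_Abelian_group (carrier A' \<times> carrier B)\<^esub> ext c"
proof -
  let ?C = "tensor_kernel A B #>\<^bsub>free_Abelian_group (carrier A \<times> carrier B)\<^esub> c"
  have "tensor_kernel A' B #>\<^bsub>free_Abelian_group (carrier A' \<times> carrier B)\<^esub> ext d
     = tensor_kernel A' B #>\<^bsub>free_Abelian_group (carrier A' \<times> carrier B)\<^esub> ext c" if "d \<in> ?C" for d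
  proof (rule tensor_coset_eq[OF A' B])
    have "d - c \<in> tensor_kernel A B" using that tensor_coset_mem[OF A B] by blast
    then show "ext d - ext c \<in> tensor_kernel A' B"
      using tensor_map_kernel by (metis frag_extend_diff)
  qed
  moreover have "c \<in> ?C" using tensor_coset_mem[OF A B, of c c] tensor_kernel_zero[OF A B] by simp
  ultimately show ?thesis unfolding tensor_map_def by blast
qed

lemma tensor_ext_carrier:
  assumes "c \<in> carrier (free_Abelian_group (carrier A \<times> carrier B))"
  shows "ext c \<in> carrier (free_Abelian_group (carrier A' \<times> carrier B))"
proof -
  have fc: "f x \<in> carrier A'" if "x \<in> carrier A" for x using f that by (auto simp: hom_def)
  show ?thesis using assms keys_frag_extend[of "\<lambda>(a, b). frag_of (f a, b)" c]
    by (fastforce simp: keys_frag_of fc)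
qed

end

text \<open>If \<open>b\<^sup>k = f a\<close>, then \<open>b \<otimes> r = b\<^sup>k \<otimes> (r/k) = f a \<otimes> (r/k)\<close>, which gives one direction.
  For the other one, multiplication by a common denominator \<open>D\<close> should send \<open>b \<otimes> r\<close> to \<open>b\<close> raised to the
  power \<open>D r\<close>. With \<open>\<lfloor>D r\<rfloor>\<close> as exponent this is defined on the whole free abelian group for every \<open>D\<close>,
  and it respects a given relation as soon as \<open>D\<close> is divisible enough.\<close>

theorem tensor_map_localized_surj_iff:
  fixes A :: "('a, 'm) monoid_scheme" and A' :: "('c, 'k) monoid_scheme" and f :: "'a \<Rightarrow> 'c"
  assumes A: "comm_group A" and A': "comm_group A'" and f: "f \<in> hom A A'" and p: "prime p"
  shows "tensor_map A' (Z_localized p) f ` carrier (tensor A (Z_localized p))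
           = carrier (tensor A' (Z_localized p))
     \<longleftrightarrow> (\<forall>b \<in> carrier A'. \<exists>k::nat. \<not> p dvd k \<and> b [^]\<^bsub>A'\<^esub> k \<in> f ` carrier A)"
    (is "?L \<longleftrightarrow> ?R")
proof
  let ?Z = "Z_localized p"
  note Z = comm_group_Z_localized[OF p]
  interpret A: comm_group A by (rule A)
  interpret A': comm_group A' by (rule A')
  interpret Z: comm_group ?Z by (rule Z)
  interpret f: group_hom A A' f using f by unfold_locales
  let ?K = "tensor_kernel A' ?Z"
  let ?F = "free_Abelian_group (carrier A' \<times> carrier ?Z)"
  let ?ext = "frag_extend (\<lambda>(a, b). frag_of (f a, b) :: ('c \<times> rat) \<Rightarrow>\<^sub>0 int)"
  have ip: "prime (int p)" using p by simp
  {
    assume L: ?L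
    have img: "subgroup (f ` carrier A) A'" by (rule f.img_is_subgroup)
    define g where "g = (\<lambda>D::int. \<lambda>(b, r). b [^]\<^bsub>A'\<^esub> \<lfloor>of_int D * r :: rat\<rfloor>)"
    have "\<exists>h. h \<in> hom ?F A' \<and> (\<forall>x \<in> carrier A' \<times> carrier ?Z. h (frag_of x) = g D x)" for D
    proof -
      have "g D ` (carrier A' \<times> carrier ?Z) \<subseteq> carrier A'" by (auto simp: g_def)
      from A'.free_Abelian_group_universal[OF this] show ?thesis by metis
    qed
    then obtain h where h: "\<And>D. h D \<in> hom ?F A'"
      "\<And>D b r. b \<in> carrier A' \<Longrightarrow> r \<in> carrier ?Z \<Longrightarrow> h D (frag_of (b, r)) = g D (b, r)"
      by (metis SigmaI)
    have h_add: "h D (x + y) = h D x \<otimes>\<^bsub>A'\<^esub> h D y" if "x \<in> carrier ?F" "y \<in> carrier ?F" for D x y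
      using h(1)[of D] that by (simp add: hom_def)
    have h_car: "h D x \<in> carrier A'" if "x \<in> carrier ?F" for D x
      using h(1)[of D] that by (auto simp: hom_def simp del: carrier_free_Abelian_group_iff)
    have h_minus: "h D (- x) = inv\<^bsub>A'\<^esub> h D x" if "x \<in> carrier ?F" for D x
    proof -
      interpret hh: group_hom ?F A' "h D" using h(1)[of D] by (simp add: group_hom_def group_hom_axioms_def)
      show ?thesis using hh.hom_inv[OF that] that by (metis carrier_free_Abelian_group_iff inv_free_Abelian_group)
    qed
    \<comment> \<open>\<open>H\<close> consists of the elements that land in the image of \<open>f\<close> for all sufficiently divisible \<open>D\<close>.
      It contains the relations and the image of \<open>f \<otimes> id\<close>, hence \<open>b \<otimes> 1\<close>; there the exponent is \<open>D\<close>.\<close>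
    define H where "H = {c \<in> carrier ?F. \<exists>D. \<not> int p dvd D \<and>
        (\<forall>D'. D dvd D' \<longrightarrow> h D' c \<in> f ` carrier A)}"
    have H_add: "x + y \<in> H" if "x \<in> H" "y \<in> H" for x y
    proof -
      obtain D where "\<not> int p dvd D" "\<forall>D'. D dvd D' \<longrightarrow> h D' x \<in> f ` carrier A"
        using \<open>x \<in> H\<close> unfolding H_def by blast
      moreover obtain E where "\<not> int p dvd E" "\<forall>D'. E dvd D' \<longrightarrow> h D' y \<in> f ` carrier A"
        using \<open>y \<in> H\<close> unfolding H_def by blast
      moreover have "x \<in> carrier ?F" "y \<in> carrier ?F" using that by (auto simp: H_def)
      moreover have "x + y \<in> carrier ?F"
        using \<open>x \<in> carrier ?F\<close> \<open>y \<in> carrier ?F\<close> keys_add[of x y] by auto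
      moreover have "\<not> int p dvd D * E"
        using \<open>\<not> int p dvd D\<close> \<open>\<not> int p dvd E\<close> ip by (simp add: prime_dvd_mult_iff)
      moreover have "h D' (x + y) \<in> f ` carrier A" if "D * E dvd D'" for D'
      proof -
        have "D dvd D'" "E dvd D'" using that dvd_mult_left dvd_mult_right by blast+
        then show ?thesis
          using calculation h_add[of x y D'] subgroup.m_closed[OF img] by metis
      qed
      ultimately show ?thesis unfolding H_def by blast
    qed
    have H_minus: "- x \<in> H" if "x \<in> H" for x
      using that subgroup.m_inv_closed[OF img] h_minus
      by (simp add: H_def) (metis carrier_free_Abelian_group_iff)
    have H_zero: "0 \<in> H"
    proof -
      have "h D 0 = \<one>\<^bsub>A'\<^esub>" for D
      proof -
        interpret hh: group_hom ?F A' "h D" using h(1)[of D] by (simp add: group_hom_def group_hom_axioms_def)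
        show ?thesis using hh.hom_one by simp
      qed
      moreover have "\<not> int p dvd 1" using ip not_prime_unit by blast
      ultimately show ?thesis using subgroup.one_closed[OF img] unfolding H_def by (intro CollectI conjI exI[of _ 1]) simp_all
    qed
    \<comment> \<open>Every \<open>r\<close> has a denominator \<open>D\<close>, which makes \<open>D r\<close> an integer.\<close>
    have den: "\<exists>D. \<not> int p dvd D \<and> (\<forall>D'. D dvd D' \<longrightarrow> (\<exists>n. of_int D' * r = of_int n))"
      if "r \<in> carrier ?Z" for r
    proof -
      obtain a b where r: "r = of_int a / of_int b" and b: "\<not> int p dvd b"
        using \<open>r \<in> carrier ?Z\<close> by (auto simp: Z_localized_def)
      then have "b \<noteq> 0" by auto
      have "\<exists>n. of_int D' * r = of_int n" if "b dvd D'" for D' :: int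
      proof -
        obtain c where "D' = b * c" using \<open>b dvd D'\<close> by (elim dvdE)
        then have "of_int D' * r = of_int (c * a)" using \<open>b \<noteq> 0\<close> r by simp
        then show ?thesis by blast
      qed
      then show ?thesis using b by blast
    qed
    have F_of: "frag_of (b, r) \<in> carrier ?F" if "b \<in> carrier A'" "r \<in> carrier ?Z" for b r
      using that by (simp add: keys_frag_of)
    have F_diff: "x - y \<in> carrier ?F" if "x \<in> carrier ?F" "y \<in> carrier ?F" for x y
      using that keys_diff[of x y] by auto
    have h_diff: "h D (x - y) = h D x \<otimes>\<^bsub>A'\<^esub> inv\<^bsub>A'\<^esub> h D y" if "x \<in> carrier ?F" "y \<in> carrier ?F" for D x y
      using h_add[of x "- y" D] h_minus[of y D] that by simp
    have rel: "c \<in> H" if "c \<in> tensor_relations A' ?Z" for c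
      using that unfolding tensor_relations_def
    proof (elim UnE CollectE exE conjE)
      fix a a' r
      assume c: "c = frag_of (a \<otimes>\<^bsub>A'\<^esub> a', r) - frag_of (a, r) - frag_of (a', r)"
        and a: "a \<in> carrier A'" "a' \<in> carrier A'" "r \<in> carrier ?Z"
      have "h D c = \<one>\<^bsub>A'\<^esub>" for D
        unfolding c using a
        by (simp add: h_diff F_of F_diff h(2) g_def A'.int_pow_mult_distrib A'.m_comm
            A'.inv_mult A'.m_ac del: carrier_free_Abelian_group_iff)
      moreover have "c \<in> carrier ?F" unfolding c using a by (intro F_diff F_of) auto
      moreover have "\<not> int p dvd 1" using ip not_prime_unit by blast
      ultimately show "c \<in> H"
        using subgroup.one_closed[OF img] unfolding H_def by (intro CollectI conjI exI[of _ 1]) simp_all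
    next
      fix a r s
      assume c: "c = frag_of (a, r \<otimes>\<^bsub>?Z\<^esub> s) - frag_of (a, r) - frag_of (a, s)"
        and a: "a \<in> carrier A'" "r \<in> carrier ?Z" "s \<in> carrier ?Z"
      obtain D where D: "\<not> int p dvd D" "\<And>D'. D dvd D' \<Longrightarrow> \<exists>n. of_int D' * r = of_int n"
        using den[OF a(2)] by blast
      obtain E where E: "\<not> int p dvd E" "\<And>D'. E dvd D' \<Longrightarrow> \<exists>n. of_int D' * s = of_int n"
        using den[OF a(3)] by blast
      have r_s_sum: "r \<otimes>\<^bsub>?Z\<^esub> s = r + s" by (simp add: Z_localized_def)
      have rs: "r + s \<in> carrier ?Z" using Z.m_closed[OF a(2,3)] r_s_sum by simp
      have "h D' c = \<one>\<^bsub>A'\<^esub>" if "D * E dvd D'" for D'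
      proof -
        obtain n m where "of_int D' * r = of_int n" "of_int D' * s = of_int m"
          using D(2)[of D'] E(2)[of D'] \<open>D * E dvd D'\<close> dvd_mult_left dvd_mult_right by metis
        moreover from this have "of_int D' * (r + s) = of_int (n + m)" by (simp add: distrib_left)
        ultimately have "h D' c = a [^]\<^bsub>A'\<^esub> (n + m) \<otimes>\<^bsub>A'\<^esub> inv\<^bsub>A'\<^esub> (a [^]\<^bsub>A'\<^esub> n) \<otimes>\<^bsub>A'\<^esub> inv\<^bsub>A'\<^esub> (a [^]\<^bsub>A'\<^esub> m)"
          unfolding c using a rs
          by (simp add: h_diff F_of F_diff h(2) g_def r_s_sum del: carrier_free_Abelian_group_iff of_int_add)
        also have "\<dots> = \<one>\<^bsub>A'\<^esub>" using a(1)
          by (simp add: A'.int_pow_mult A'.m_ac)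
        finally show ?thesis .
      qed
      moreover have "c \<in> carrier ?F" unfolding c using a by (intro F_diff F_of) auto
      moreover have "\<not> int p dvd D * E" using D E ip by (simp add: prime_dvd_mult_iff)
      ultimately show "c \<in> H"
        using subgroup.one_closed[OF img] unfolding H_def by (intro CollectI conjI exI[of _ "D * E"]) simp_all
    qed
    have K_H: "c \<in> H" if "c \<in> ?K" for c
      using that unfolding tensor_kernel_def
    proof (induct rule: generate.induct)
      case one
      then show ?case using H_zero by simp
    next
      case (incl h)
      then show ?case using rel by blast
    next
      case (inv h)
      then have "h \<in> carrier ?F" using tensor_relations_carrier[OF A' Z] by blast
      then show ?case using H_minus[OF rel[OF inv]] by (simp add: inv_free_Abelian_group)
    next
      case (eng x y)
      then show ?case using H_add by simp
    qed
    have ext_H: "?ext c \<in> H" if "Poly_Mapping.keys c \<subseteq> carrier A \<times> carrier ?Z" for c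
      using that
    proof (induct rule: free_Abelian_group_induct[consumes 1, case_names zero diff gen])
      case zero
      then show ?case using H_zero by simp
    next
      case (diff x y)
      then show ?case using H_add[OF diff(3) H_minus[OF diff(4)]] by (simp add: frag_extend_diff)
    next
      case (gen x)
      obtain a r where x: "x = (a, r)" by force
      have a: "a \<in> carrier A" "r \<in> carrier ?Z" using gen x by auto
      have "h D (frag_of (f a, r)) = f (a [^]\<^bsub>A\<^esub> \<lfloor>of_int D * r\<rfloor>)" for D
        using a by (simp add: h(2) g_def f.hom_int_pow)
      then have "h D (frag_of (f a, r)) \<in> f ` carrier A" for D using a by simp
      moreover have "\<not> int p dvd 1" using ip not_prime_unit by blast
      ultimately show ?case unfolding H_def x using a
        by (intro CollectI conjI exI[of _ 1]) (simp_all add: keys_frag_of)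
    qed
    show ?R
    proof
      fix b assume b: "b \<in> carrier A'"
      have "\<not> int p dvd 1" using ip not_prime_unit by blast
      from Z_localized_carrierI[OF this, of 1] have one: "1 \<in> carrier ?Z" by simp
      have "?K #>\<^bsub>?F\<^esub> frag_of (b, 1) \<in> carrier (tensor A' ?Z)"
        unfolding carrier_tensor[OF A' Z] by (rule imageI[OF F_of[OF b one]])
      then obtain c where c: "c \<in> carrier (free_Abelian_group (carrier A \<times> carrier ?Z))"
        and eq: "?K #>\<^bsub>?F\<^esub> frag_of (b, 1) = ?K #>\<^bsub>?F\<^esub> ?ext c"
        using L carrier_tensor[OF A Z] tensor_map_coset[OF A A' Z f] by (smt (verit) imageE)
      have "frag_of (b, 1) \<in> ?K #>\<^bsub>?F\<^esub> frag_of (b, 1)"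
        using tensor_coset_mem[OF A' Z] tensor_kernel_zero[OF A' Z] by (metis diff_self)
      then have "frag_of (b, 1) - ?ext c \<in> ?K" using eq tensor_coset_mem[OF A' Z] by metis
      then have "frag_of (b, 1) - ?ext c + ?ext c \<in> H"
        by (intro H_add K_H ext_H) (use c in auto)
      then obtain D where D: "\<not> int p dvd D" "\<And>D'. D dvd D' \<Longrightarrow> h D' (frag_of (b, 1)) \<in> f ` carrier A"
        by (auto simp: H_def)
      have "b [^]\<^bsub>A'\<^esub> (nat \<bar>D\<bar>) = h \<bar>D\<bar> (frag_of (b, 1))"
        using h(2)[OF b one, of "\<bar>D\<bar>"] int_pow_int[of A' b "nat \<bar>D\<bar>"]
        by (simp add: g_def del: of_int_abs)
      then have "b [^]\<^bsub>A'\<^esub> (nat \<bar>D\<bar>) \<in> f ` carrier A" using D(2)[of "\<bar>D\<bar>"] by simp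
      moreover have "\<not> p dvd nat \<bar>D\<bar>" using D(1) by (simp add: dvd_nat_abs_iff)
      ultimately show "\<exists>k::nat. \<not> p dvd k \<and> b [^]\<^bsub>A'\<^esub> k \<in> f ` carrier A" by blast
    qed
  next
    assume R: ?R
    show ?L
    proof
      show "tensor_map A' ?Z f ` carrier (tensor A ?Z) \<subseteq> carrier (tensor A' ?Z)"
        using tensor_map_coset[OF A A' Z f] tensor_ext_carrier[OF A A' Z f]
        unfolding carrier_tensor[OF A Z] carrier_tensor[OF A' Z] by blast
    next
      have hit: "\<exists>c. c \<in> carrier (free_Abelian_group (carrier A \<times> carrier ?Z)) \<and> x - ?ext c \<in> ?K"
        if "Poly_Mapping.keys x \<subseteq> carrier A' \<times> carrier ?Z" for x
        using that
      proof (induct rule: free_Abelian_group_induct[consumes 1, case_names zero diff gen])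
        case zero
        then show ?case using tensor_kernel_zero[OF A' Z] by (intro exI[of _ 0]) simp
      next
        case (diff x y)
        then obtain c d where "c \<in> carrier (free_Abelian_group (carrier A \<times> carrier ?Z))"
          "x - ?ext c \<in> ?K" "d \<in> carrier (free_Abelian_group (carrier A \<times> carrier ?Z))"
          "y - ?ext d \<in> ?K" by blast
        then show ?case using tensor_kernel_diff[OF A' Z, of "x - ?ext c" "y - ?ext d"] keys_diff[of c d]
          by (intro exI[of _ "c - d"]) (auto simp: frag_extend_diff algebra_simps)
      next
        case (gen x)
        obtain b r where x: "x = (b, r)" by force
        have b: "b \<in> carrier A'" and r: "r \<in> carrier ?Z" using gen x by auto
        obtain k a where k: "\<not> p dvd k" and a: "a \<in> carrier A" "b [^]\<^bsub>A'\<^esub> k = f a" using R b by blast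
        obtain m n where mn: "r = of_int m / of_int n" "\<not> int p dvd n"
          using r by (auto simp: Z_localized_def)
        have k0: "k \<noteq> 0" using k by (metis dvd_0_right)
        define s where "s = r / of_nat k"
        have "s = of_int m / of_int (n * int k)" using mn k0 by (simp add: s_def)
        moreover have "\<not> int p dvd n * int k" using mn k ip by (simp add: prime_dvd_mult_iff)
        ultimately have s: "s \<in> carrier ?Z" using Z_localized_carrierI by metis
        have "s [^]\<^bsub>?Z\<^esub> j = of_nat j * s" for j :: nat
          by (induct j) (auto simp: Z_localized_def nat_pow_def algebra_simps)
        then have "s [^]\<^bsub>?Z\<^esub> k = r" using k0 by (simp add: s_def)
        then have "frag_of (b, r) - frag_cmul (int k) (frag_of (b, s)) \<in> ?K"
          using tensor_kernel_pow_right[OF A' Z b s, of k] by simp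
        moreover have "frag_of (f a, s) - frag_cmul (int k) (frag_of (b, s)) \<in> ?K"
          using tensor_kernel_pow_left[OF A' Z b s, of k] a by simp
        ultimately have "frag_of (b, r) - frag_of (f a, s) \<in> ?K"
          using tensor_kernel_diff[OF A' Z] by fastforce
        then show ?case unfolding x using a s
          by (intro exI[of _ "frag_of (a, s)"]) (simp add: keys_frag_of)
      qed
      show "carrier (tensor A' ?Z) \<subseteq> tensor_map A' ?Z f ` carrier (tensor A ?Z)"
      proof
        fix y assume "y \<in> carrier (tensor A' ?Z)"
        then obtain x where x: "x \<in> carrier ?F" "y = ?K #>\<^bsub>?F\<^esub> x"
          unfolding carrier_tensor[OF A' Z] by blast
        obtain c where c: "c \<in> carrier (free_Abelian_group (carrier A \<times> carrier ?Z))" "x - ?ext c \<in> ?K"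
          using hit[of x] x(1) by auto
        have "y = ?K #>\<^bsub>?F\<^esub> ?ext c" unfolding x(2) by (rule tensor_coset_eq[OF A' Z c(2)])
        then have "y = tensor_map A' ?Z f (tensor_kernel A ?Z #>\<^bsub>free_Abelian_group (carrier A \<times> carrier ?Z)\<^esub> c)"
          using tensor_map_coset[OF A A' Z f c(1)] by simp
        then show "y \<in> tensor_map A' ?Z f ` carrier (tensor A ?Z)"
          unfolding carrier_tensor[OF A Z] using c(1) by blast
      qed
    qed
  }
qed

section \<open>Finite $G$-sets and their isomorphisms over a base\<close>

text \<open>Maps without the extensionality of \<open>gmaps\<close>, so that they can be composed as plain functions.\<close>

definition equivariant ::
    "('g, 'b) monoid_scheme \<Rightarrow> ('g, 'a) gset \<Rightarrow> ('g, 'c) gset \<Rightarrow> ('a \<Rightarrow> 'c) \<Rightarrow> bool" where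
  "equivariant G X Y f \<longleftrightarrow> f \<in> pts X \<rightarrow> pts Y \<and>
     (\<forall>g \<in> carrier G. \<forall>x \<in> pts X. f (act X g x) = act Y g (f x))"

text \<open>The relation whose classes are formed by \<open>over_class\<close>, for \<open>G\<close>-sets with points in any types.\<close>

definition over_iso ::
    "('g, 'b) monoid_scheme \<Rightarrow> ('g, 'a) gset \<Rightarrow> ('a \<Rightarrow> 't) \<Rightarrow> ('g, 'c) gset \<Rightarrow> ('c \<Rightarrow> 't) \<Rightarrow> bool" where
  "over_iso G X f Y g \<longleftrightarrow> (\<exists>h. equivariant G X Y h \<and> bij_betw h (pts X) (pts Y) \<and>
     (\<forall>x \<in> pts X. g (h x) = f x))"

lemma gmaps_iff: "f \<in> gmaps G X Y \<longleftrightarrow> equivariant G X Y f \<and> f \<in> extensional (pts X)"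
  by (auto simp: gmaps_def equivariant_def PiE_def)

lemma equivariantD:
  assumes "equivariant G X Y f"
  shows "x \<in> pts X \<Longrightarrow> f x \<in> pts Y"
    and "\<lbrakk>g \<in> carrier G; x \<in> pts X\<rbrakk> \<Longrightarrow> f (act X g x) = act Y g (f x)"
  using assms by (auto simp: equivariant_def)

lemma gmapsD:
  assumes "f \<in> gmaps G X Y"
  shows "x \<in> pts X \<Longrightarrow> f x \<in> pts Y"
    and "\<lbrakk>g \<in> carrier G; x \<in> pts X\<rbrakk> \<Longrightarrow> f (act X g x) = act Y g (f x)"
    and "f \<in> extensional (pts X)" and "equivariant G X Y f"
  using assms by (auto simp: gmaps_def equivariant_def PiE_def)

lemma equivariantI:
  assumes "\<And>x. x \<in> pts X \<Longrightarrow> f x \<in> pts Y"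
    and "\<And>g x. \<lbrakk>g \<in> carrier G; x \<in> pts X\<rbrakk> \<Longrightarrow> f (act X g x) = act Y g (f x)"
  shows "equivariant G X Y f"
  using assms by (auto simp: equivariant_def)

context group
begin

lemma fin_gsetI:
  assumes fin: "finite (pts X)"
    and ext: "\<And>g. g \<in> carrier G \<Longrightarrow> act X g \<in> extensional (pts X)"
    and closed: "\<And>g x. \<lbrakk>g \<in> carrier G; x \<in> pts X\<rbrakk> \<Longrightarrow> act X g x \<in> pts X"
    and one: "\<And>x. x \<in> pts X \<Longrightarrow> act X \<one> x = x"
    and mult: "\<And>g h x. \<lbrakk>g \<in> carrier G; h \<in> carrier G; x \<in> pts X\<rbrakk>
      \<Longrightarrow> act X (g \<otimes> h) x = act X g (act X h x)"
  shows "fin_gset G X"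
proof -
  have bij: "act X g \<in> Bij (pts X)" if g: "g \<in> carrier G" for g
  proof -
    have "bij_betw (act X g) (pts X) (pts X)"
    proof (rule bij_betwI)
      show "act X g \<in> pts X \<rightarrow> pts X" "act X (inv g) \<in> pts X \<rightarrow> pts X" using g closed by auto
      fix x assume x: "x \<in> pts X"
      show "act X (inv g) (act X g x) = x" "act X g (act X (inv g) x) = x"
        using mult[of "inv g" g x] mult[of g "inv g" x] g x one by auto
    qed
    then show ?thesis using ext g by (simp add: Bij_def)
  qed
  have "act X (g \<otimes> h) = compose (pts X) (act X g) (act X h)" if "g \<in> carrier G" "h \<in> carrier G" for g h
    using ext[of "g \<otimes> h"] mult that by (fastforce simp: compose_def fun_eq_iff extensional_def)
  then have "act X \<in> hom G (BijGroup (pts X))"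
    using bij by (intro homI) (auto simp: BijGroup_def)
  then have "group_hom G (BijGroup (pts X)) (act X)"
    using group_BijGroup by (simp add: group_hom_def group_hom_axioms_def)
  then show ?thesis using fin by (simp add: fin_gset_def group_action_def)
qed

lemma gset_finite: "fin_gset G X \<Longrightarrow> finite (pts X)" by (simp add: fin_gset_def)

lemma act_closed: "\<lbrakk>fin_gset G X; g \<in> carrier G; x \<in> pts X\<rbrakk> \<Longrightarrow> act X g x \<in> pts X"
  using group_action.element_image[of G "pts X" "act X"] by (auto simp: fin_gset_def)

lemma act_ext: "\<lbrakk>fin_gset G X; g \<in> carrier G\<rbrakk> \<Longrightarrow> act X g \<in> extensional (pts X)"
  using group_action.bij_prop0[of G "pts X" "act X" g] by (auto simp: fin_gset_def Bij_def)

lemma act_one: "\<lbrakk>fin_gset G X; x \<in> pts X\<rbrakk> \<Longrightarrow> act X \<one> x = x"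
  using group_action.id_eq_one[of G "pts X" "act X"] by (metis fin_gset_def restrict_apply')

lemma act_mult: "\<lbrakk>fin_gset G X; g \<in> carrier G; h \<in> carrier G; x \<in> pts X\<rbrakk>
    \<Longrightarrow> act X (g \<otimes> h) x = act X g (act X h x)"
  using group_action.composition_rule[of G "pts X" "act X"] by (auto simp: fin_gset_def)

lemma act_inv: "\<lbrakk>fin_gset G X; g \<in> carrier G; x \<in> pts X\<rbrakk> \<Longrightarrow> act X (inv g) (act X g x) = x"
  using act_mult[of X "inv g" g x] act_one[of X x] by simp

lemma act_inv': "\<lbrakk>fin_gset G X; g \<in> carrier G; x \<in> pts X\<rbrakk> \<Longrightarrow> act X g (act X (inv g) x) = x"
  using act_mult[of X g "inv g" x] act_one[of X x] by simp

lemma equivariant_id: "equivariant G X X (\<lambda>x. x)"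
  by (rule equivariantI) auto

lemma equivariant_comp:
  assumes f: "equivariant G X Y f" and g: "equivariant G Y Z g"
  shows "equivariant G X Z (\<lambda>x. g (f x))"
  by (rule equivariantI) (simp_all add: equivariantD[OF f] equivariantD[OF g])

lemma equivariant_cong:
  assumes "fin_gset G X" and "\<And>x. x \<in> pts X \<Longrightarrow> f x = f' x"
  shows "equivariant G X Y f = equivariant G X Y f'"
  using assms act_closed[OF assms(1)] unfolding equivariant_def by (auto simp: Pi_iff)

lemma equivariant_restrict:
  "fin_gset G X \<Longrightarrow> equivariant G X Y (restrict f (pts X)) = equivariant G X Y f"
  by (rule equivariant_cong) auto

lemma gmaps_restrict: "\<lbrakk>fin_gset G X; equivariant G X Y f\<rbrakk> \<Longrightarrow> restrict f (pts X) \<in> gmaps G X Y"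
  by (simp add: gmaps_iff equivariant_restrict)

lemma gmaps_id: "fin_gset G X \<Longrightarrow> (\<lambda>x \<in> pts X. x) \<in> gmaps G X X"
  using gmaps_restrict equivariant_id by blast

lemma gmaps_compose:
  "\<lbrakk>fin_gset G X; f \<in> gmaps G X Y; g \<in> gmaps G Y Z\<rbrakk> \<Longrightarrow> compose (pts X) g f \<in> gmaps G X Z"
  unfolding compose_def by (rule gmaps_restrict) (blast intro: equivariant_comp gmapsD(4))+

lemma equivariant_inv_into:
  assumes X: "fin_gset G X" and h: "equivariant G X Y h" "bij_betw h (pts X) (pts Y)"
  shows "equivariant G Y X (inv_into (pts X) h)"
proof (rule equivariantI)
  fix y assume y: "y \<in> pts Y"
  then show 1: "inv_into (pts X) h y \<in> pts X" using h(2) by (metis bij_betw_def inv_into_into)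
  fix g assume g: "g \<in> carrier G"
  have "h (act X g (inv_into (pts X) h y)) = act Y g y"
    using equivariantD(2)[OF h(1) g 1] bij_betw_inv_into_right[OF h(2) y] by simp
  then show "inv_into (pts X) h (act Y g y) = act X g (inv_into (pts X) h y)"
    using act_closed[OF X g 1] bij_betw_inv_into_left[OF h(2)] by metis
qed

lemma gisos_iff: "fin_gset G X \<Longrightarrow> h \<in> gisos G X Y \<longleftrightarrow>
    equivariant G X Y h \<and> bij_betw h (pts X) (pts Y) \<and> h \<in> extensional (pts X)"
  by (auto simp: gisos_def gmaps_iff)

lemma over_iso_gisos:
  assumes "fin_gset G X"
  shows "over_iso G X f Y g \<longleftrightarrow> (\<exists>h \<in> gisos G X Y. \<forall>x \<in> pts X. g (h x) = f x)"
proof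
  assume "over_iso G X f Y g"
  then obtain h where "equivariant G X Y h" "bij_betw h (pts X) (pts Y)" "\<forall>x \<in> pts X. g (h x) = f x"
    by (auto simp: over_iso_def)
  then have "restrict h (pts X) \<in> gisos G X Y" "\<forall>x \<in> pts X. g (restrict h (pts X) x) = f x"
    using assms by (auto simp: gisos_iff equivariant_restrict)
  then show "\<exists>h \<in> gisos G X Y. \<forall>x \<in> pts X. g (h x) = f x" by blast
qed (use assms in \<open>auto simp: over_iso_def gisos_iff\<close>)

lemma over_iso_refl: "over_iso G X f X f"
  unfolding over_iso_def by (rule exI[of _ "\<lambda>x. x"]) (auto simp: equivariant_id bij_betw_def)

lemma over_iso_sym: "\<lbrakk>fin_gset G X; over_iso G X f Y g\<rbrakk> \<Longrightarrow> over_iso G Y g X f"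
proof -
  assume X: "fin_gset G X" and "over_iso G X f Y g"
  then obtain h where h: "equivariant G X Y h" "bij_betw h (pts X) (pts Y)" "\<forall>x \<in> pts X. g (h x) = f x"
    by (auto simp: over_iso_def)
  have k: "equivariant G Y X (inv_into (pts X) h)" by (rule equivariant_inv_into[OF X h(1,2)])
  have "f (inv_into (pts X) h y) = g y" if "y \<in> pts Y" for y
    using h(3) bij_betw_inv_into_right[OF h(2) that] equivariantD(1)[OF k that] by metis
  then show ?thesis using k bij_betw_inv_into[OF h(2)] unfolding over_iso_def by blast
qed

lemma over_iso_trans: "\<lbrakk>over_iso G X f Y g; over_iso G Y g Z k\<rbrakk> \<Longrightarrow> over_iso G X f Z k"
proof -
  assume "over_iso G X f Y g" "over_iso G Y g Z k"
  then obtain h h' where *: "equivariant G X Y h" "bij_betw h (pts X) (pts Y)" "\<forall>x \<in> pts X. g (h x) = f x"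
    "equivariant G Y Z h'" "bij_betw h' (pts Y) (pts Z)" "\<forall>x \<in> pts Y. k (h' x) = g x"
    unfolding over_iso_def by blast
  have "bij_betw (\<lambda>x. h' (h x)) (pts X) (pts Z)"
    using bij_betw_trans[OF *(2,5)] by (simp add: comp_def)
  then show "over_iso G X f Z k" unfolding over_iso_def
    using * equivariantD(1)[OF *(1)] by (intro exI[of _ "\<lambda>x. h' (h x)"]) (auto intro: equivariant_comp)
qed

lemma over_isoI:
  assumes "equivariant G X Y h" "inj_on h (pts X)" "\<And>y. y \<in> pts Y \<Longrightarrow> \<exists>x \<in> pts X. y = h x"
    and "\<And>x. x \<in> pts X \<Longrightarrow> g (h x) = f x"
  shows "over_iso G X f Y g"
  unfolding over_iso_def
  using assms equivariantD(1)[OF assms(1)] by (intro exI[of _ h]) (auto simp: bij_betw_def)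

lemma over_iso_comp:
  "over_iso G X f Y g \<Longrightarrow> over_iso G X (\<lambda>x. \<phi> (f x)) Y (\<lambda>y. \<phi> (g y))"
  unfolding over_iso_def by auto

lemma over_iso_equivariant:
  assumes "fin_gset G X" "equivariant G X S f" "over_iso G X f Y g"
  shows "equivariant G Y S g"
proof -
  obtain h where h: "equivariant G X Y h" "bij_betw h (pts X) (pts Y)" "\<forall>x \<in> pts X. g (h x) = f x"
    using assms(3) by (auto simp: over_iso_def)
  let ?k = "inv_into (pts X) h"
  have k: "equivariant G Y X ?k" by (rule equivariant_inv_into[OF assms(1) h(1,2)])
  have g: "g y = f (?k y)" if "y \<in> pts Y" for y
    using h(3) bij_betw_inv_into_right[OF h(2) that] equivariantD(1)[OF k that] by metis
  show ?thesis
  proof (rule equivariantI)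
    fix y assume y: "y \<in> pts Y"
    show "g y \<in> pts S" using g[OF y] equivariantD[OF k] equivariantD[OF assms(2)] y by metis
    fix a assume a: "a \<in> carrier G"
    have "act Y a y = h (act X a (?k y))"
      using equivariantD(2)[OF h(1) a equivariantD(1)[OF k y]] bij_betw_inv_into_right[OF h(2) y] by simp
    moreover have "act X a (?k y) \<in> pts X" using act_closed[OF assms(1) a equivariantD(1)[OF k y]] .
    ultimately show "g (act Y a y) = act S a (g y)"
      using h(3) g[OF y] equivariantD(2)[OF assms(2) a equivariantD(1)[OF k y]] by metis
  qed
qed


lemma one_point_gset: "fin_gset G one_point"
  by (rule fin_gsetI) (auto simp: one_point_def)

lemma empty_gset: "fin_gset G \<lparr>pts = {}, act = (\<lambda>g. \<lambda>x \<in> {}. x)\<rparr>"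
  by (rule fin_gsetI) auto

lemma to_point_gmaps: "fin_gset G X \<Longrightarrow> to_point X \<in> gmaps G X one_point"
  by (auto simp: gmaps_iff to_point_def one_point_def equivariant_def act_closed)

lemma gmaps_to_point: "fin_gset G X \<Longrightarrow> f \<in> gmaps G X one_point \<Longrightarrow> f = to_point X"
  by (auto simp: gmaps_def to_point_def one_point_def PiE_def extensional_def fun_eq_iff)

lemma disj_union_gset:
  assumes X: "fin_gset G X" and Y: "fin_gset G Y"
  shows "fin_gset G (disj_union X Y)"
  by (rule fin_gsetI)
    (auto simp: disj_union_def gset_finite[OF X] gset_finite[OF Y] act_closed[OF X] act_closed[OF Y]
      act_one[OF X] act_one[OF Y] act_mult[OF X] act_mult[OF Y])

lemma disj_union_pts: "pts (disj_union X Y) = pts X <+> pts Y"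
  by (simp add: disj_union_def)

lemma disj_union_act:
  "x \<in> pts X \<Longrightarrow> act (disj_union X Y) g (Inl x) = Inl (act X g x)"
  "y \<in> pts Y \<Longrightarrow> act (disj_union X Y) g (Inr y) = Inr (act Y g y)"
  by (auto simp: disj_union_def)

lemma equivariant_case_sum:
  "\<lbrakk>equivariant G X S f; equivariant G Y S g\<rbrakk> \<Longrightarrow> equivariant G (disj_union X Y) S (case_sum f g)"
  by (auto simp: equivariant_def disj_union_def)

lemma fibre_prod_gset:
  assumes X: "fin_gset G X" and Y: "fin_gset G Y"
    and f: "equivariant G X S f" and g: "equivariant G Y S g"
  shows "fin_gset G (fibre_prod f g X Y)"
proof (rule fin_gsetI)
  have "fibre_points f g (pts X) (pts Y) \<subseteq> pts X \<times> pts Y" by (auto simp: fibre_points_def)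
  then show "finite (pts (fibre_prod f g X Y))"
    using gset_finite[OF X] gset_finite[OF Y] by (simp add: fibre_prod_def finite_subset)
qed (auto simp: fibre_prod_def fibre_points_def act_closed[OF X] act_closed[OF Y] equivariantD[OF f] equivariantD[OF g]
      act_one[OF X] act_one[OF Y] act_mult[OF X] act_mult[OF Y])

lemma fibre_prod_pts: "(x, y) \<in> pts (fibre_prod f g X Y) \<longleftrightarrow> x \<in> pts X \<and> y \<in> pts Y \<and> f x = g y"
  by (auto simp: fibre_prod_def fibre_points_def)

lemma fibre_prod_act:
  "(x, y) \<in> pts (fibre_prod f g X Y) \<Longrightarrow> act (fibre_prod f g X Y) k (x, y) = (act X k x, act Y k y)"
  by (auto simp: fibre_prod_def)

lemma fibre_prod_proj:
  "equivariant G (fibre_prod f g X Y) X fst" "equivariant G (fibre_prod f g X Y) Y snd"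
  by (auto simp: equivariant_def fibre_prod_def fibre_points_def)

text \<open>A finite set embeds into the infinite universe, and the action is transported along the embedding.\<close>

lemma ex_copy:
  fixes X :: "('a, 'x) gset"
  assumes X: "fin_gset G X" and inf: "infinite (UNIV :: 'u set)"
  shows "\<exists>(Y :: ('a, 'u) gset) h. fin_gset G Y \<and> equivariant G X Y h \<and> bij_betw h (pts X) (pts Y)"
proof -
  obtain B :: "'u set" where "card B = card (pts X)" "finite B"
    using infinite_arbitrarily_large[OF inf] by metis
  then obtain h where h: "bij_betw h (pts X) B"
    using finite_same_card_bij gset_finite[OF X] by metis
  let ?k = "inv_into (pts X) h"
  let ?Y = "\<lparr>pts = B, act = (\<lambda>g. \<lambda>y \<in> B. h (act X g (?k y)))\<rparr>"
  have k: "?k y \<in> pts X" "h (?k y) = y" if "y \<in> B" for y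
    using h that by (metis bij_betw_def inv_into_into, metis bij_betw_inv_into_right h)
  have hk: "h x \<in> B" "?k (h x) = x" if "x \<in> pts X" for x
    using h that by (metis bij_betwE, metis bij_betw_inv_into_left h)
  have "fin_gset G ?Y"
    by (rule fin_gsetI) (auto simp: \<open>finite B\<close> k hk act_closed[OF X] act_one[OF X] act_mult[OF X])
  moreover have "equivariant G X ?Y h" by (rule equivariantI) (auto simp: hk)
  ultimately show ?thesis using h by (intro exI[of _ ?Y] exI[of _ h]) auto
qed

end

section \<open>Fixed points in fibres determine a $G$-set over a base\<close>

locale fin_group = group +
  assumes fin_carrier: "finite (carrier G)"

definition fixed_over :: "('g, 'a) gset \<Rightarrow> ('a \<Rightarrow> 't) \<Rightarrow> 't \<Rightarrow> 'g set \<Rightarrow> 'a set" where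
  "fixed_over X f z K = {x \<in> pts X. f x = z \<and> (\<forall>k \<in> K. act X k x = x)}"

definition sub_gset :: "('g, 'a) gset \<Rightarrow> 'a set \<Rightarrow> ('g, 'a) gset" where
  "sub_gset X A = \<lparr>pts = A, act = (\<lambda>g. restrict (act X g) A)\<rparr>"

context group
begin

lemma stabilizer_is_subgroup: "\<lbrakk>fin_gset G X; x \<in> pts X\<rbrakk> \<Longrightarrow> subgroup (stabilizer G (act X) x) G"
  using group_action.stabilizer_subgroup by (auto simp: fin_gset_def)

lemma act_eq_iff:
  assumes X: "fin_gset G X" and x: "x \<in> pts X" and g: "g \<in> carrier G" "h \<in> carrier G"
  shows "act X g x = act X h x \<longleftrightarrow> inv h \<otimes> g \<in> stabilizer G (act X) x"
proof -
  have "act X (inv h \<otimes> g) x = act X (inv h) (act X g x)" using act_mult[OF X _ _ x] g by simp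
  then show ?thesis
    using act_inv[OF X g(2) x] act_inv'[OF X g(2) act_closed[OF X g(1) x]] g
    by (auto simp: stabilizer_def)
qed

lemma sub_gset_gset:
  assumes "fin_gset G X" "A \<subseteq> pts X" "\<And>g a. \<lbrakk>g \<in> carrier G; a \<in> A\<rbrakk> \<Longrightarrow> act X g a \<in> A"
  shows "fin_gset G (sub_gset X A)"
  using assms
  by (intro fin_gsetI)
    (auto simp: sub_gset_def act_one act_mult subsetD intro: finite_subset[OF _ gset_finite])

lemma orbit_act_iff:
  assumes X: "fin_gset G X" and x: "x \<in> pts X" and a: "a \<in> pts X" and g: "g \<in> carrier G"
  shows "act X g a \<in> orbit G (act X) x \<longleftrightarrow> a \<in> orbit G (act X) x"
proof
  assume "act X g a \<in> orbit G (act X) x"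
  then obtain h where h: "h \<in> carrier G" "act X g a = act X h x" by (auto simp: orbit_def)
  have "a = act X (inv g) (act X h x)" using act_inv[OF X g a] h by simp
  then have "a = act X (inv g \<otimes> h) x" using act_mult[OF X _ h(1) x] g by simp
  then show "a \<in> orbit G (act X) x" using g h by (auto simp: orbit_def)
next
  assume "a \<in> orbit G (act X) x"
  then obtain h where h: "h \<in> carrier G" "a = act X h x" by (auto simp: orbit_def)
  then have "act X g a = act X (g \<otimes> h) x" using act_mult[OF X g h(1) x] by simp
  then show "act X g a \<in> orbit G (act X) x" using g h by (auto simp: orbit_def)
qed

lemma orbit_pts: "\<lbrakk>fin_gset G X; x \<in> pts X\<rbrakk> \<Longrightarrow> orbit G (act X) x \<subseteq> pts X"
  by (auto simp: orbit_def act_closed)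

end

context fin_group
begin

text \<open>A point \<open>x\<close> of \<open>X\<close> with stabilizer \<open>H\<close> as large as possible has a partner \<open>y\<close> in \<open>Y\<close> over
  the same point of \<open>S\<close> and fixed by \<open>H\<close>. The stabilizer of \<open>y\<close> fixes some point of \<open>X\<close>, so that it is not
  larger than \<open>H\<close>, and therefore equals \<open>H\<close>. The orbits of \<open>x\<close> and \<open>y\<close> are then isomorphic over \<open>S\<close> and can
  be removed. For \<open>S\<close> a point this is the classical theorem on tables of marks.\<close>

theorem over_iso_if_fixed_points:
  fixes X :: "('a, 'x) gset" and Y :: "('a, 'y) gset" and S :: "('a, 's) gset"
  assumes "fin_gset G X" "fin_gset G Y" "equivariant G X S f" "equivariant G Y S g"
    and "\<And>z K. \<lbrakk>z \<in> pts S; subgroup K G\<rbrakk> \<Longrightarrow> card (fixed_over X f z K) = card (fixed_over Y g z K)"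
  shows "over_iso G X f Y g"
  using assms
proof (induct "card (pts X)" arbitrary: X Y rule: less_induct)
  case less
  note X = less.prems(1) and Y = less.prems(2) and f = less.prems(3) and g = less.prems(4)
    and cnt = less.prems(5)
  have finF: "finite (fixed_over X f z K)" "finite (fixed_over Y g z K)" for z K
    using gset_finite[OF X] gset_finite[OF Y] by (auto simp: fixed_over_def)
  show ?case
  proof (cases "pts X = {}")
    case True
    have "pts Y = {}"
    proof (rule ccontr)
      assume "pts Y \<noteq> {}"
      then obtain y where y: "y \<in> pts Y" by blast
      then have "y \<in> fixed_over Y g (g y) {\<one>}" by (simp add: fixed_over_def act_one[OF Y])
      moreover have "card (fixed_over Y g (g y) {\<one>}) = 0"
        using cnt[of "g y" "{\<one>}"] True equivariantD(1)[OF g y] triv_subgroup by (simp add: fixed_over_def)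
      ultimately show False using finF by auto
    qed
    then show ?thesis using True by (auto simp: over_iso_def equivariant_def bij_betw_def)
  next
    case False
    let ?stX = "stabilizer G (act X)" and ?stY = "stabilizer G (act Y)"
    obtain x where x: "x \<in> pts X" and max: "\<And>x'. x' \<in> pts X \<Longrightarrow> card (?stX x') \<le> card (?stX x)"
    proof -
      let ?c = "(\<lambda>x. card (?stX x)) ` pts X"
      have fin: "finite ?c" "?c \<noteq> {}" using gset_finite[OF X] False by auto
      then obtain x where "x \<in> pts X" "Max ?c = card (?stX x)" using Max_in[OF fin] by blast
      then show ?thesis using Max_ge[OF fin(1)] that by (metis imageI)
    qed
    let ?H = "?stX x"
    have "x \<in> fixed_over X f (f x) ?H" using x by (simp add: fixed_over_def stabilizer_def)
    then have "card (fixed_over Y g (f x) ?H) \<noteq> 0"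
      using cnt[of "f x" ?H] equivariantD(1)[OF f x] stabilizer_is_subgroup[OF X x] finF by (metis card_0_eq empty_iff)
    then have "fixed_over Y g (f x) ?H \<noteq> {}" by auto
    then obtain y where y: "y \<in> pts Y" "g y = f x" "?H \<subseteq> ?stY y"
      unfolding fixed_over_def stabilizer_def by blast
    have "y \<in> fixed_over Y g (f x) (?stY y)" using y by (simp add: fixed_over_def stabilizer_def)
    then have "card (fixed_over X f (f x) (?stY y)) \<noteq> 0"
      using cnt[of "f x" "?stY y"] equivariantD(1)[OF f x] stabilizer_is_subgroup[OF Y y(1)] finF by (metis card_0_eq empty_iff)
    then have "fixed_over X f (f x) (?stY y) \<noteq> {}" by auto
    then obtain x' where x': "x' \<in> pts X" "?stY y \<subseteq> ?stX x'"
      by (fastforce simp: fixed_over_def stabilizer_def)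
    have "card (?stY y) \<le> card ?H"
      using card_mono[OF _ x'(2)] max[OF x'(1)] fin_carrier by (simp add: stabilizer_def)
    then have st: "?stY y = ?H"
      using card_seteq[OF _ y(3)] fin_carrier by (simp add: stabilizer_def)
    have eq_iff: "act X a x = act X b x \<longleftrightarrow> act Y a y = act Y b y" if "a \<in> carrier G" "b \<in> carrier G" for a b
      using act_eq_iff[OF X x that] act_eq_iff[OF Y y(1) that] st by simp
    let ?O = "orbit G (act X) x" and ?O' = "orbit G (act Y) y"
    \<comment> \<open>The isomorphism of orbits sends \<open>a x\<close> to \<open>a y\<close>; by \<open>eq_iff\<close> this does not depend on the choice of \<open>a\<close>.\<close>
    define h0 where "h0 a = act Y (SOME t. t \<in> carrier G \<and> act X t x = a) y" for a
    have h0: "h0 (act X a x) = act Y a y" if a: "a \<in> carrier G" for a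
    proof -
      have "(SOME t. t \<in> carrier G \<and> act X t x = act X a x) \<in> carrier G \<and>
        act X (SOME t. t \<in> carrier G \<and> act X t x = act X a x) x = act X a x"
        by (rule someI[of _ a]) (use a in simp)
      then show ?thesis unfolding h0_def using eq_iff[OF _ a] by metis
    qed
    have bij0: "bij_betw h0 ?O ?O'"
    proof -
      have "inj_on h0 ?O" by (rule inj_onI) (auto simp: orbit_def h0 eq_iff)
      moreover have "h0 ` ?O = ?O'" by (auto simp: orbit_def h0 image_iff) (metis h0)
      ultimately show ?thesis by (simp add: bij_betw_def)
    qed
    have over0: "g (h0 a) = f a" if "a \<in> ?O" for a
    proof -
      obtain b where b: "b \<in> carrier G" "a = act X b x" using \<open>a \<in> ?O\<close> by (auto simp: orbit_def)
      then show ?thesis using equivariantD(2)[OF f b(1) x] equivariantD(2)[OF g b(1) y(1)] y(2) by (simp add: h0)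
    qed
    have equi0: "h0 (act X b a) = act Y b (h0 a)" if "a \<in> ?O" "b \<in> carrier G" for a b
    proof -
      obtain c where c: "c \<in> carrier G" "a = act X c x" using \<open>a \<in> ?O\<close> by (auto simp: orbit_def)
      have "act X b a = act X (b \<otimes> c) x" using c act_mult[OF X that(2) c(1) x] by simp
      then show ?thesis using h0[of "b \<otimes> c"] h0[OF c(1)] c that act_mult[OF Y that(2) c(1) y(1)] by simp
    qed
    define X' where "X' = sub_gset X (pts X - ?O)"
    define Y' where "Y' = sub_gset Y (pts Y - ?O')"
    have X': "fin_gset G X'" unfolding X'_def
      by (rule sub_gset_gset[OF X]) (auto simp: act_closed[OF X] orbit_act_iff[OF X x])
    have Y': "fin_gset G Y'" unfolding Y'_def
      by (rule sub_gset_gset[OF Y]) (auto simp: act_closed[OF Y] orbit_act_iff[OF Y y(1)])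
    have f': "equivariant G X' S f" using f by (auto simp: equivariant_def X'_def sub_gset_def)
    have g': "equivariant G Y' S g" using g by (auto simp: equivariant_def Y'_def sub_gset_def)
    have xO: "x \<in> ?O" using act_one[OF X x] by (force simp: orbit_def)
    have "card (pts X') < card (pts X)"
      unfolding X'_def sub_gset_def using gset_finite[OF X] x xO by (auto intro!: psubset_card_mono)
    moreover have "card (fixed_over X' f z K) = card (fixed_over Y' g z K)"
      if z: "z \<in> pts S" and K: "subgroup K G" for z K
    proof -
      have Kc: "k \<in> carrier G" if "k \<in> K" for k using K that by (rule subgroup.mem_carrier)
      have 1: "fixed_over X' f z K = fixed_over X f z K - fixed_over X f z K \<inter> ?O"
        "fixed_over Y' g z K = fixed_over Y g z K - fixed_over Y g z K \<inter> ?O'"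
        by (auto simp: fixed_over_def X'_def Y'_def sub_gset_def)
      have fix0: "(act X k a = a) = (act Y k (h0 a) = h0 a)" if "k \<in> K" "a \<in> ?O" for k a
        using equi0[OF that(2) Kc[OF that(1)]] bij0 orbit_act_iff[OF X x _ Kc[OF that(1)]] orbit_pts[OF X x] that(2)
        by (metis bij_betw_def inj_on_eq_iff subsetD)
      have "h0 ` (fixed_over X f z K \<inter> ?O) = fixed_over Y g z K \<inter> ?O'"
      proof (intro equalityI subsetI)
        fix b assume "b \<in> h0 ` (fixed_over X f z K \<inter> ?O)"
        then obtain a where "b = h0 a" "a \<in> fixed_over X f z K" "a \<in> ?O" by blast
        moreover have "h0 a \<in> ?O'" using bij0 calculation by (metis bij_betwE)
        ultimately show "b \<in> fixed_over Y g z K \<inter> ?O'"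
          using orbit_pts[OF Y y(1)] by (auto simp: fixed_over_def over0 fix0[symmetric])
      next
        fix b assume b: "b \<in> fixed_over Y g z K \<inter> ?O'"
        then obtain a where a: "a \<in> ?O" "b = h0 a" using bij0 by (auto simp: bij_betw_def)
        then have "a \<in> fixed_over X f z K"
          using b orbit_pts[OF X x] by (auto simp: fixed_over_def over0 fix0)
        then show "b \<in> h0 ` (fixed_over X f z K \<inter> ?O)" using a by blast
      qed
      then have 2: "card (fixed_over X f z K \<inter> ?O) = card (fixed_over Y g z K \<inter> ?O')"
        using bij0 by (metis bij_betw_def card_image inf_le2 inj_on_subset)
      show ?thesis unfolding 1 using 2 cnt[OF z K] finF
        by (simp add: card_Diff_subset)
    qed
    ultimately have "over_iso G X' f Y' g" by (intro less.hyps X' Y' f' g')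
    then obtain h' where h': "equivariant G X' Y' h'" "bij_betw h' (pts X') (pts Y')" "\<forall>a \<in> pts X'. g (h' a) = f a"
      by (auto simp: over_iso_def)
    define h where "h a = (if a \<in> ?O then h0 a else h' a)" for a
    have "bij_betw h (?O \<union> (pts X - ?O)) (?O' \<union> (pts Y - ?O'))"
    proof (rule bij_betw_combine)
      show "bij_betw h ?O ?O'" using bij0 by (rule iffD1[OF bij_betw_cong, rotated]) (simp add: h_def)
      have "bij_betw h' (pts X - ?O) (pts Y - ?O')" using h'(2) by (simp add: X'_def Y'_def sub_gset_def)
      then show "bij_betw h (pts X - ?O) (pts Y - ?O')"
        by (rule iffD1[OF bij_betw_cong, rotated]) (simp add: h_def)
    qed auto
    moreover have "?O \<union> (pts X - ?O) = pts X" "?O' \<union> (pts Y - ?O') = pts Y"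
      using orbit_pts[OF X x] orbit_pts[OF Y y(1)] by auto
    ultimately have hb: "bij_betw h (pts X) (pts Y)" by simp
    moreover have "equivariant G X Y h"
    proof (rule equivariantI)
      fix a assume a: "a \<in> pts X"
      show "h a \<in> pts Y" using hb a by (rule bij_betw_apply)
      fix b assume b: "b \<in> carrier G"
      show "h (act X b a) = act Y b (h a)"
      proof (cases "a \<in> ?O")
        case True
        then show ?thesis using equi0[OF True b] orbit_act_iff[OF X x a b] by (simp add: h_def)
      next
        case False
        then have a': "a \<in> pts X'" using a by (simp add: X'_def sub_gset_def)
        have "h' (act X' b a) = act Y' b (h' a)" using equivariantD(2)[OF h'(1) b a'] .
        moreover have "h' a \<in> pts Y'" using equivariantD(1)[OF h'(1) a'] .
        ultimately show ?thesis using False a' orbit_act_iff[OF X x a b]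
          by (simp add: h_def X'_def Y'_def sub_gset_def)
      qed
    qed
    moreover have "g (h a) = f a" if "a \<in> pts X" for a
      using that over0 h'(3) by (auto simp: h_def X'_def sub_gset_def)
    ultimately show ?thesis unfolding over_iso_def by blast
  qed
qed

end

section \<open>The Grothendieck group of a commutative monoid\<close>

lemma UN_pair_const:
  assumes "p \<in> C" "\<And>a b. (a, b) \<in> C \<Longrightarrow> F a b = K"
  shows "(\<Union>(a, b) \<in> C. F a b) = K"
proof -
  have "(case x of (a, b) \<Rightarrow> F a b) = K" if "x \<in> C" for x using assms(2) that by (cases x) auto
  then show ?thesis using assms(1) by (simp cong: SUP_cong) auto
qed

lemma UN_pair_const2:
  assumes "p \<in> C" "q \<in> D" "\<And>a b c d. \<lbrakk>(a, b) \<in> C; (c, d) \<in> D\<rbrakk> \<Longrightarrow> F a b c d = K"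
  shows "(\<Union>(a, b) \<in> C. \<Union>(c, d) \<in> D. F a b c d) = K"
  by (rule UN_pair_const[OF assms(1)], rule UN_pair_const[OF assms(2)], rule assms(3))

lemma the_elem_const: "c \<in> C \<Longrightarrow> (\<And>x. x \<in> C \<Longrightarrow> F x = F c) \<Longrightarrow> the_elem (F ` C) = F c"
  by (rule the_elem_image_unique) blast+

locale groth = abelian_monoid R for R :: "'a ring" (structure)
begin

lemma groth_rel_iff:
  "((a, b), (c, d)) \<in> groth_rel R \<longleftrightarrow>
     a \<in> carrier R \<and> b \<in> carrier R \<and> c \<in> carrier R \<and> d \<in> carrier R \<and>
     (\<exists>e \<in> carrier R. a \<oplus> d \<oplus> e = c \<oplus> b \<oplus> e)"
  by (auto simp: groth_rel_def)

lemma equiv_groth_rel: "equiv (carrier R \<times> carrier R) (groth_rel R)"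
proof (rule equivI)
  show "groth_rel R \<subseteq> (carrier R \<times> carrier R) \<times> (carrier R \<times> carrier R)"
    by (auto simp: groth_rel_def)
  show "refl_on (carrier R \<times> carrier R) (groth_rel R)"
    by (auto simp: refl_on_def groth_rel_iff)
  show "sym (groth_rel R)" 
  proof (rule symI)
    fix x y assume "(x, y) \<in> groth_rel R"
    then show "(y, x) \<in> groth_rel R" by (cases x; cases y) (auto simp: groth_rel_iff intro: sym)
  qed
  show "trans (groth_rel R)"
  proof (rule transI)
    fix x y z assume "(x, y) \<in> groth_rel R" "(y, z) \<in> groth_rel R"
    then obtain a b c d f g e e' where x: "x = (a, b)" "y = (c, d)" "z = (g, f)" and
      car: "a \<in> carrier R" "b \<in> carrier R" "c \<in> carrier R" "d \<in> carrier R" "f \<in> carrier R" "g \<in> carrier R"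
        "e \<in> carrier R" "e' \<in> carrier R" and
      eq: "a \<oplus> d \<oplus> e = c \<oplus> b \<oplus> e" "c \<oplus> f \<oplus> e' = g \<oplus> d \<oplus> e'"
      by (cases x; cases y; cases z) (auto simp: groth_rel_iff)
    have "a \<oplus> f \<oplus> (d \<oplus> c \<oplus> (e \<oplus> e')) = (a \<oplus> d \<oplus> e) \<oplus> (c \<oplus> f \<oplus> e')"
      using car by (simp add: a_ac)
    also have "\<dots> = g \<oplus> b \<oplus> (d \<oplus> c \<oplus> (e \<oplus> e'))"
      unfolding eq using car by (simp add: a_ac)
    finally show "(x, z) \<in> groth_rel R" unfolding x using car
      by (auto simp: groth_rel_iff intro!: bexI[of _ "d \<oplus> c \<oplus> (e \<oplus> e')"])
  qed
qed

lemma groth_diff_mem: "(c, d) \<in> groth_diff R a b \<longleftrightarrow> ((a, b), (c, d)) \<in> groth_rel R"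
  by (simp add: groth_diff_def)

lemma groth_diff_self: "\<lbrakk>a \<in> carrier R; b \<in> carrier R\<rbrakk> \<Longrightarrow> (a, b) \<in> groth_diff R a b"
  by (auto simp: groth_diff_mem groth_rel_iff)

lemma groth_diff_eqI:
  assumes "((a, b), (c, d)) \<in> groth_rel R"
  shows "groth_diff R a b = groth_diff R c d"
  unfolding groth_diff_def by (rule equiv_class_eq[OF equiv_groth_rel assms])

lemma groth_carrier:
  "carrier (groth_ring R) = {groth_diff R a b | a b. a \<in> carrier R \<and> b \<in> carrier R}"
  by (auto simp: groth_ring_def groth_diff_def quotient_def)

lemma groth_carrierI: "\<lbrakk>a \<in> carrier R; b \<in> carrier R\<rbrakk> \<Longrightarrow> groth_diff R a b \<in> carrier (groth_ring R)"
  by (auto simp: groth_carrier)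

lemma groth_carrierE:
  assumes "x \<in> carrier (groth_ring R)"
  obtains a b where "a \<in> carrier R" "b \<in> carrier R" "x = groth_diff R a b"
  using assms by (auto simp: groth_carrier)

lemma groth_add:
  assumes "a \<in> carrier R" "b \<in> carrier R" "c \<in> carrier R" "d \<in> carrier R"
  shows "groth_diff R a b \<oplus>\<^bsub>groth_ring R\<^esub> groth_diff R c d = groth_diff R (a \<oplus> c) (b \<oplus> d)"
proof -
  have const: "groth_diff R (a' \<oplus> c') (b' \<oplus> d') = groth_diff R (a \<oplus> c) (b \<oplus> d)"
    if xy: "(a', b') \<in> groth_diff R a b" "(c', d') \<in> groth_diff R c d" for a' b' c' d'
  proof (rule groth_diff_eqI[symmetric])
    obtain e e' where car: "a' \<in> carrier R" "b' \<in> carrier R" "c' \<in> carrier R" "d' \<in> carrier R"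
        "e \<in> carrier R" "e' \<in> carrier R" and
      eq: "a \<oplus> b' \<oplus> e = a' \<oplus> b \<oplus> e" "c \<oplus> d' \<oplus> e' = c' \<oplus> d \<oplus> e'"
      using xy by (auto simp: groth_diff_mem groth_rel_iff)
    have "(a \<oplus> c) \<oplus> (b' \<oplus> d') \<oplus> (e \<oplus> e') = (a \<oplus> b' \<oplus> e) \<oplus> (c \<oplus> d' \<oplus> e')"
      using car assms by (simp add: a_ac)
    also have "\<dots> = (a' \<oplus> c') \<oplus> (b \<oplus> d) \<oplus> (e \<oplus> e')"
      unfolding eq using car assms by (simp add: a_ac)
    finally show "((a \<oplus> c, b \<oplus> d), (a' \<oplus> c', b' \<oplus> d')) \<in> groth_rel R"
      using car assms by (auto simp: groth_rel_iff intro!: bexI[of _ "e \<oplus> e'"])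
  qed
  have "(a, b) \<in> groth_diff R a b" "(c, d) \<in> groth_diff R c d"
    using assms by (auto intro: groth_diff_self)
  from UN_pair_const2[OF this const] show ?thesis by (simp add: groth_ring_def)
qed

lemma groth_zero: "\<zero>\<^bsub>groth_ring R\<^esub> = groth_diff R \<zero> \<zero>"
  by (simp add: groth_ring_def)

lemma groth_diff_refl: "a \<in> carrier R \<Longrightarrow> groth_diff R a a = \<zero>\<^bsub>groth_ring R\<^esub>"
  unfolding groth_zero by (rule groth_diff_eqI) (auto simp: groth_rel_iff)

lemma abelian_group_groth: "abelian_group (groth_ring R)"
proof (rule abelian_groupI)
  fix x assume "x \<in> carrier (groth_ring R)"
  then obtain a b where ab: "a \<in> carrier R" "b \<in> carrier R" "x = groth_diff R a b" by (rule groth_carrierE)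
  then have "groth_diff R b a \<oplus>\<^bsub>groth_ring R\<^esub> x = \<zero>\<^bsub>groth_ring R\<^esub>"
    by (simp add: groth_add groth_diff_refl a_comm)
  then show "\<exists>y\<in>carrier (groth_ring R). y \<oplus>\<^bsub>groth_ring R\<^esub> x = \<zero>\<^bsub>groth_ring R\<^esub>"
    using ab groth_carrierI by blast
  show "\<zero>\<^bsub>groth_ring R\<^esub> \<oplus>\<^bsub>groth_ring R\<^esub> x = x" using ab by (simp add: groth_zero groth_add)
next
  show "\<zero>\<^bsub>groth_ring R\<^esub> \<in> carrier (groth_ring R)" by (simp add: groth_zero groth_carrierI)
next
  fix x y assume x: "x \<in> carrier (groth_ring R)" and y: "y \<in> carrier (groth_ring R)"
  obtain a b where ab: "a \<in> carrier R" "b \<in> carrier R" "x = groth_diff R a b"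
    using x by (rule groth_carrierE)
  obtain c d where cd: "c \<in> carrier R" "d \<in> carrier R" "y = groth_diff R c d"
    using y by (rule groth_carrierE)
  show "x \<oplus>\<^bsub>groth_ring R\<^esub> y \<in> carrier (groth_ring R)"
    using ab cd by (simp add: groth_add groth_carrierI)
  show "x \<oplus>\<^bsub>groth_ring R\<^esub> y = y \<oplus>\<^bsub>groth_ring R\<^esub> x"
    using ab cd by (simp add: groth_add a_comm)
  fix z assume z: "z \<in> carrier (groth_ring R)"
  obtain e f where ef: "e \<in> carrier R" "f \<in> carrier R" "z = groth_diff R e f"
    using z by (rule groth_carrierE)
  show "x \<oplus>\<^bsub>groth_ring R\<^esub> y \<oplus>\<^bsub>groth_ring R\<^esub> z = x \<oplus>\<^bsub>groth_ring R\<^esub> (y \<oplus>\<^bsub>groth_ring R\<^esub> z)"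
    using ab cd ef by (simp add: groth_add a_assoc)
qed

lemma groth_uminus:
  assumes "a \<in> carrier R" "b \<in> carrier R"
  shows "\<ominus>\<^bsub>groth_ring R\<^esub> groth_diff R a b = groth_diff R b a"
proof -
  interpret A: abelian_group "groth_ring R" by (rule abelian_group_groth)
  have "groth_diff R a b \<oplus>\<^bsub>groth_ring R\<^esub> groth_diff R b a = \<zero>\<^bsub>groth_ring R\<^esub>"
    using assms by (simp add: groth_add groth_diff_refl a_comm)
  then show ?thesis using assms by (metis A.minus_equality A.a_comm groth_carrierI)
qed

end

definition additive :: "'a ring \<Rightarrow> ('c, 'k) ring_scheme \<Rightarrow> ('a \<Rightarrow> 'c) \<Rightarrow> bool" where
  "additive R S h \<longleftrightarrow> h \<in> carrier R \<rightarrow> carrier S \<and>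
     (\<forall>a \<in> carrier R. \<forall>b \<in> carrier R. h (a \<oplus>\<^bsub>R\<^esub> b) = h a \<oplus>\<^bsub>S\<^esub> h b)"

text \<open>The summand that witnesses equality of formal differences is mapped along by \<open>h\<close>.\<close>

lemma groth_map_diff:
  fixes R :: "'a ring" and S :: "'c ring"
  assumes "abelian_monoid R" "abelian_monoid S" and h: "additive R S h"
    and ab: "a \<in> carrier R" "b \<in> carrier R"
  shows "groth_map S h (groth_diff R a b) = groth_diff S (h a) (h b)"
proof -
  interpret R: groth R using assms(1) by (simp add: groth_def)
  interpret S: groth S using assms(2) by (simp add: groth_def)
  have const: "groth_diff S (h a') (h b') = groth_diff S (h a) (h b)"
    if mem: "(a', b') \<in> groth_diff R a b" for a' b'
  proof (rule S.groth_diff_eqI[symmetric])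
    obtain e where car: "a' \<in> carrier R" "b' \<in> carrier R" "e \<in> carrier R"
      and eq: "a \<oplus>\<^bsub>R\<^esub> b' \<oplus>\<^bsub>R\<^esub> e = a' \<oplus>\<^bsub>R\<^esub> b \<oplus>\<^bsub>R\<^esub> e"
      using mem by (auto simp: R.groth_diff_mem R.groth_rel_iff)
    have "h (a \<oplus>\<^bsub>R\<^esub> b' \<oplus>\<^bsub>R\<^esub> e) = h (a' \<oplus>\<^bsub>R\<^esub> b \<oplus>\<^bsub>R\<^esub> e)" by (simp add: eq)
    then have "h a \<oplus>\<^bsub>S\<^esub> h b' \<oplus>\<^bsub>S\<^esub> h e = h a' \<oplus>\<^bsub>S\<^esub> h b \<oplus>\<^bsub>S\<^esub> h e"
      using h ab car by (simp add: additive_def)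
    then show "((h a, h b), (h a', h b')) \<in> groth_rel S"
      using h ab car by (auto simp: S.groth_rel_iff additive_def)
  qed
  show ?thesis unfolding groth_map_def
    by (rule UN_pair_const[OF R.groth_diff_self[OF ab] const])
qed

lemma groth_map_hom:
  fixes R :: "'a ring" and S :: "'c ring"
  assumes "abelian_monoid R" "abelian_monoid S" and h: "additive R S h"
  shows "groth_map S h \<in> hom (add_monoid (groth_ring R)) (add_monoid (groth_ring S))"
proof -
  interpret R: groth R using assms(1) by (simp add: groth_def)
  interpret S: groth S using assms(2) by (simp add: groth_def)
  note d = groth_map_diff[OF assms]
  have hc: "h a \<in> carrier S" if "a \<in> carrier R" for a using h that by (auto simp: additive_def)
  have ha: "h (a \<oplus>\<^bsub>R\<^esub> b) = h a \<oplus>\<^bsub>S\<^esub> h b" if "a \<in> carrier R" "b \<in> carrier R" for a b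
    using h that by (auto simp: additive_def)
  show ?thesis
  proof (rule homI)
    fix x assume "x \<in> carrier (add_monoid (groth_ring R))"
    then obtain a b where ab: "a \<in> carrier R" "b \<in> carrier R" "x = groth_diff R a b"
      using R.groth_carrierE by auto
    then show "groth_map S h x \<in> carrier (add_monoid (groth_ring S))"
      by (simp add: d S.groth_carrierI hc)
    fix y assume "y \<in> carrier (add_monoid (groth_ring R))"
    then obtain c d' where "c \<in> carrier R" "d' \<in> carrier R" "y = groth_diff R c d'"
      using R.groth_carrierE by auto
    then show "groth_map S h (x \<otimes>\<^bsub>add_monoid (groth_ring R)\<^esub> y) =
        groth_map S h x \<otimes>\<^bsub>add_monoid (groth_ring S)\<^esub> groth_map S h y"
      using ab by (simp add: d R.groth_add S.groth_add hc ha)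
  qed
qed

section \<open>The monoid of finite $G$-sets over a finite $G$-set\<close>

text \<open>The parameter \<open>u\<close> only names the type of points of the objects of the category.\<close>

locale gset_universe = fin_group G
  for G :: "('g, 'b) monoid_scheme" (structure) and u :: "'u itself" +
  assumes infinite_universe: "infinite (UNIV :: 'u set)"
begin

lemma over_iso_inverseI:
  assumes "equivariant G X Y h" "\<And>y. y \<in> pts Y \<Longrightarrow> k y \<in> pts X \<and> h (k y) = y"
    and "\<And>x. x \<in> pts X \<Longrightarrow> k (h x) = x" and "\<And>x. x \<in> pts X \<Longrightarrow> g (h x) = f x"
  shows "over_iso G X f Y g"
proof (rule over_isoI[OF assms(1)])
  show "inj_on h (pts X)" by (rule inj_on_inverseI[of _ k]) (rule assms(3))
  show "\<exists>x \<in> pts X. y = h x" if "y \<in> pts Y" for y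
    by (rule bexI[of _ "k y"]) (use assms(2)[OF that] in auto)
qed (rule assms(4))

lemma over_class_mem:
  "fin_gset G X \<Longrightarrow> (Y, g) \<in> over_class G S X f \<longleftrightarrow> fin_gset G Y \<and> g \<in> gmaps G Y S \<and> over_iso G X f Y g"
  by (simp add: over_class_def over_iso_gisos)

lemma over_class_eqI:
  fixes S :: "('g, 't) gset"
  assumes "fin_gset G X" "fin_gset G X'" "over_iso G X f X' f'"
  shows "over_class G S X f = over_class G S X' f'"
proof -
  have "over_iso G X f Y g \<longleftrightarrow> over_iso G X' f' Y g" for Y :: "('g, 't) gset" and g
    using over_iso_trans[OF assms(3), of Y g] over_iso_trans[OF over_iso_sym[OF assms(1,3)], of Y g] by blast
  then show ?thesis using assms by (auto simp: over_class_mem)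
qed

lemma over_class_cong:
  assumes "fin_gset G X" "\<And>x. x \<in> pts X \<Longrightarrow> f x = f' x"
  shows "over_class G S X f = over_class G S X f'"
  by (rule over_class_eqI[OF assms(1,1)], rule over_isoI[OF equivariant_id]) (auto simp: assms)

lemma over_class_self: "\<lbrakk>fin_gset G X; f \<in> gmaps G X S\<rbrakk> \<Longrightarrow> (X, f) \<in> over_class G S X f"
  by (simp add: over_class_mem over_iso_refl)

text \<open>Disjoint unions and fibre products have points in sum and product types. This lemma
  moves them back into the universe, so that their classes are nonempty.\<close>

lemma ex_over_rep:
  fixes S :: "('g, 'u) gset"
  assumes X: "fin_gset G X" and f: "equivariant G X S f"
  shows "\<exists>(Y :: ('g, 'u) gset) g. fin_gset G Y \<and> g \<in> gmaps G Y S \<and> over_iso G X f Y g"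
proof -
  obtain Y :: "('g, 'u) gset" and h
    where Y: "fin_gset G Y" and h: "equivariant G X Y h" "bij_betw h (pts X) (pts Y)"
    using ex_copy[OF X infinite_universe] by blast
  let ?g = "restrict (\<lambda>y. f (inv_into (pts X) h y)) (pts Y)"
  have iso: "over_iso G X f Y ?g" unfolding over_iso_def
    using h bij_betwE[OF h(2)] bij_betw_inv_into_left[OF h(2)] by (intro exI[of _ h]) auto
  have "equivariant G Y S ?g" by (rule over_iso_equivariant[OF X f iso])
  then have "?g \<in> gmaps G Y S" by (simp add: gmaps_iff)
  then show ?thesis using Y iso by blast
qed

lemma over_class_carrier:
  fixes S :: "('g, 'u) gset"
  assumes X: "fin_gset G X" and f: "equivariant G X S f"
  shows "over_class G S X f \<in> carrier (over_semiring G S)"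
proof -
  obtain Y :: "('g, 'u) gset" and g where Y: "fin_gset G Y" "g \<in> gmaps G Y S" "over_iso G X f Y g"
    using ex_over_rep[OF X f] by blast
  then have "over_class G S X f = over_class G S Y g" using over_class_eqI X by blast
  then show ?thesis using Y by (auto simp: over_semiring_def)
qed

lemma over_carrierE:
  fixes S :: "('g, 'u) gset"
  assumes "C \<in> carrier (over_semiring G S)"
  obtains X :: "('g, 'u) gset" and f where "fin_gset G X" "f \<in> gmaps G X S" "C = over_class G S X f"
  using assms by (auto simp: over_semiring_def)

lemma over_class_nonempty:
  fixes S :: "('g, 'u) gset"
  assumes "fin_gset G X" "equivariant G X S f"
  obtains p where "p \<in> over_class G S X f"
  using ex_over_rep[OF assms] over_class_mem[OF assms(1)] by blast

lemma over_iso_disj_union: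
  assumes "over_iso G X f X' f'" "over_iso G Y g Y' g'"
  shows "over_iso G (disj_union X Y) (case_sum f g) (disj_union X' Y') (case_sum f' g')"
proof -
  obtain h where h: "equivariant G X X' h" "bij_betw h (pts X) (pts X')" "\<forall>x \<in> pts X. f' (h x) = f x"
    using assms(1) by (auto simp: over_iso_def)
  obtain k where k: "equivariant G Y Y' k" "bij_betw k (pts Y) (pts Y')" "\<forall>x \<in> pts Y. g' (k x) = g x"
    using assms(2) by (auto simp: over_iso_def)
  have inv: "inv_into (pts X) h x \<in> pts X" "h (inv_into (pts X) h x) = x" if "x \<in> pts X'" for x
    using h(2) that bij_betw_inv_into_right[OF h(2)] by (auto simp: bij_betw_def inv_into_into)
  have inv': "inv_into (pts Y) k y \<in> pts Y" "k (inv_into (pts Y) k y) = y" if "y \<in> pts Y'" for y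
    using k(2) that bij_betw_inv_into_right[OF k(2)] by (auto simp: bij_betw_def inv_into_into)
  show ?thesis
  proof (rule over_iso_inverseI[where h = "map_sum h k" and k = "map_sum (inv_into (pts X) h) (inv_into (pts Y) k)"])
    show "equivariant G (disj_union X Y) (disj_union X' Y') (map_sum h k)"
      using equivariantD[OF h(1)] equivariantD[OF k(1)]
      by (intro equivariantI) (auto simp: disj_union_pts disj_union_act)
  qed (use inv inv' h(3) k(3) bij_betw_inv_into_left[OF h(2)] bij_betw_inv_into_left[OF k(2)]
      in \<open>auto simp: disj_union_pts\<close>)
qed

lemma over_iso_fibre_prod:
  assumes "over_iso G X f X' f'"
  shows "over_iso G (fibre_prod \<phi> f S X) fst (fibre_prod \<phi> f' S X') fst"
proof -
  obtain h where h: "equivariant G X X' h" "bij_betw h (pts X) (pts X')" "\<forall>x \<in> pts X. f' (h x) = f x"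
    using assms(1) by (auto simp: over_iso_def)
  show ?thesis
  proof (rule over_isoI[where h = "\<lambda>z. (fst z, h (snd z))"])
    show "equivariant G (fibre_prod \<phi> f S X) (fibre_prod \<phi> f' S X') (\<lambda>z. (fst z, h (snd z)))"
      using equivariantD[OF h(1)] h(3)
      by (intro equivariantI) (auto simp: fibre_prod_def fibre_points_def)
    show "inj_on (\<lambda>z. (fst z, h (snd z))) (pts (fibre_prod \<phi> f S X))"
      using h(2) by (auto simp: inj_on_def bij_betw_def fibre_prod_def fibre_points_def)
    fix y assume "y \<in> pts (fibre_prod \<phi> f' S X')"
    then obtain s x' where y: "y = (s, x')" "s \<in> pts S" "x' \<in> pts X'" "\<phi> s = f' x'"
      by (cases y) (auto simp: fibre_prod_pts)
    then obtain x where "x \<in> pts X" "x' = h x" using h(2) by (auto simp: bij_betw_def)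
    then show "\<exists>x \<in> pts (fibre_prod \<phi> f S X). y = (fst x, h (snd x))"
      using y h(3) by (intro bexI[of _ "(s, x)"]) (auto simp: fibre_prod_pts)
  qed auto
qed

text \<open>The union in the definition of the sum ranges over representatives of one and the same class.
  The formula holds for representatives with points in any type.\<close>

lemma over_add:
  fixes S :: "('g, 'u) gset"
  assumes X: "fin_gset G X" "equivariant G X S f" and Y: "fin_gset G Y" "equivariant G Y S g"
  shows "over_class G S X f \<oplus>\<^bsub>over_semiring G S\<^esub> over_class G S Y g
    = over_class G S (disj_union X Y) (case_sum f g)"
proof -
  obtain p where p: "p \<in> over_class G S X f" using over_class_nonempty[OF X] .
  obtain q where q: "q \<in> over_class G S Y g" using over_class_nonempty[OF Y] .
  have "over_class G S (disj_union X' Y') (case_sum f' g') = over_class G S (disj_union X Y) (case_sum f g)"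
    if "(X', f') \<in> over_class G S X f" "(Y', g') \<in> over_class G S Y g" for X' f' Y' g'
    using that unfolding over_class_mem[OF X(1)] over_class_mem[OF Y(1)]
    by (intro over_class_eqI[symmetric] disj_union_gset over_iso_disj_union X Y) auto
  from UN_pair_const2[OF p q this] show ?thesis by (simp add: over_semiring_def)
qed

lemma over_push_class:
  fixes S T :: "('g, 'u) gset"
  assumes X: "fin_gset G X" "equivariant G X S f"
  shows "over_push G T \<phi> (over_class G S X f) = over_class G T X (\<lambda>x. \<phi> (f x))"
proof -
  obtain p where p: "p \<in> over_class G S X f" using over_class_nonempty[OF X] .
  have "over_class G T X' (compose (pts X') \<phi> f') = over_class G T X (\<lambda>x. \<phi> (f x))"
    if "(X', f') \<in> over_class G S X f" for X' f'
  proof -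
    have X': "fin_gset G X'" "over_iso G X f X' f'" using that by (auto simp: over_class_mem[OF X(1)])
    have "over_class G T X' (compose (pts X') \<phi> f') = over_class G T X' (\<lambda>x. \<phi> (f' x))"
      by (rule over_class_cong[OF X'(1)]) (simp add: compose_def)
    also have "\<dots> = over_class G T X (\<lambda>x. \<phi> (f x))"
      by (rule over_class_eqI[symmetric, OF X(1) X'(1) over_iso_comp[OF X'(2)]])
    finally show ?thesis .
  qed
  from UN_pair_const[OF p this] show ?thesis by (simp add: over_push_def)
qed

lemma over_pull_class:
  fixes S T :: "('g, 'u) gset"
  assumes X: "fin_gset G X" "equivariant G X T f" and S: "fin_gset G S" "equivariant G S T \<phi>"
  shows "over_pull G S \<phi> (over_class G T X f) = over_class G S (fibre_prod \<phi> f S X) fst"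
proof -
  obtain p where p: "p \<in> over_class G T X f" using over_class_nonempty[OF X] .
  have "over_class G S (fibre_prod \<phi> f' S X') fst = over_class G S (fibre_prod \<phi> f S X) fst"
    if "(X', f') \<in> over_class G T X f" for X' f'
  proof -
    have X': "fin_gset G X'" "equivariant G X' T f'" "over_iso G X f X' f'"
      using that by (auto simp: over_class_mem[OF X(1)] gmapsD(4))
    show ?thesis
      by (rule over_class_eqI[symmetric, OF _ _ over_iso_fibre_prod[OF X'(3)]])
        (rule fibre_prod_gset S X X'(1,2))+
  qed
  from UN_pair_const[OF p this] show ?thesis by (simp add: over_pull_def)
qed

abbreviation empty_set :: "('g, 'u) gset" where
  "empty_set \<equiv> \<lparr>pts = {}, act = (\<lambda>g. \<lambda>x \<in> {}. x)\<rparr>"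

lemma over_zero: "\<zero>\<^bsub>over_semiring G S\<^esub> = over_class G S empty_set (\<lambda>x \<in> {}. x)"
  by (simp add: over_semiring_def)

lemma abelian_monoid_over_semiring:
  fixes S :: "('g, 'u) gset"
  shows "abelian_monoid (over_semiring G S)"
proof -
  have empty: "equivariant G empty_set S (\<lambda>x \<in> {}. x)" by (rule equivariantI) auto
  show ?thesis
  proof (rule abelian_monoidI)
    show "\<zero>\<^bsub>over_semiring G S\<^esub> \<in> carrier (over_semiring G S)"
      unfolding over_zero by (rule over_class_carrier[OF empty_gset empty])
  next
    fix C D assume "C \<in> carrier (over_semiring G S)" "D \<in> carrier (over_semiring G S)"
    then obtain X Y :: "('g, 'u) gset" and f g where X: "fin_gset G X" "equivariant G X S f" and
      Y: "fin_gset G Y" "equivariant G Y S g" and CD: "C = over_class G S X f" "D = over_class G S Y g"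
      by (metis over_carrierE gmapsD(4))
    show "C \<oplus>\<^bsub>over_semiring G S\<^esub> D \<in> carrier (over_semiring G S)"
      unfolding CD over_add[OF X Y]
      by (intro over_class_carrier disj_union_gset equivariant_case_sum X Y)
    show "C \<oplus>\<^bsub>over_semiring G S\<^esub> D = D \<oplus>\<^bsub>over_semiring G S\<^esub> C"
      unfolding CD over_add[OF X Y] over_add[OF Y X]
    proof (rule over_class_eqI)
      show "over_iso G (disj_union X Y) (case_sum f g) (disj_union Y X) (case_sum g f)"
        by (rule over_iso_inverseI[where h = "case_sum Inr Inl" and k = "case_sum Inr Inl"])
          (auto simp: equivariant_def disj_union_def)
    qed (intro disj_union_gset X Y)+
    have "over_class G S empty_set (\<lambda>x \<in> {}. x) \<oplus>\<^bsub>over_semiring G S\<^esub> C = C"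
      unfolding CD over_add[OF empty_gset empty X]
    proof (rule over_class_eqI)
      show "over_iso G (disj_union empty_set X) (case_sum (\<lambda>x \<in> {}. x) f) X f"
        by (rule over_iso_inverseI[where h = projr and k = Inr]) (auto simp: equivariant_def disj_union_def)
    qed (intro disj_union_gset X empty_gset)+
    then show "\<zero>\<^bsub>over_semiring G S\<^esub> \<oplus>\<^bsub>over_semiring G S\<^esub> C = C" by (simp add: over_zero)
    fix E assume "E \<in> carrier (over_semiring G S)"
    then obtain Z :: "('g, 'u) gset" and k where Z: "fin_gset G Z" "equivariant G Z S k" and
      E: "E = over_class G S Z k"
      by (metis over_carrierE gmapsD(4))
    note XY = disj_union_gset[OF X(1) Y(1)] equivariant_case_sum[OF X(2) Y(2)]
    note YZ = disj_union_gset[OF Y(1) Z(1)] equivariant_case_sum[OF Y(2) Z(2)]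
    show "C \<oplus>\<^bsub>over_semiring G S\<^esub> D \<oplus>\<^bsub>over_semiring G S\<^esub> E =
        C \<oplus>\<^bsub>over_semiring G S\<^esub> (D \<oplus>\<^bsub>over_semiring G S\<^esub> E)"
      unfolding CD E over_add[OF X Y] over_add[OF Y Z] over_add[OF XY Z] over_add[OF X YZ]
    proof (rule over_class_eqI)
      show "over_iso G (disj_union (disj_union X Y) Z) (case_sum (case_sum f g) k)
          (disj_union X (disj_union Y Z)) (case_sum f (case_sum g k))"
        by (rule over_iso_inverseI[where h = "case_sum (case_sum Inl (\<lambda>y. Inr (Inl y))) (\<lambda>z. Inr (Inr z))"
              and k = "case_sum (\<lambda>x. Inl (Inl x)) (case_sum (\<lambda>y. Inl (Inr y)) Inr)"])
          (auto simp: equivariant_def disj_union_def)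
    qed (intro disj_union_gset XY YZ X Z)+
  qed
qed

lemma over_push_additive:
  fixes S T :: "('g, 'u) gset"
  assumes \<phi>: "equivariant G S T \<phi>"
  shows "additive (over_semiring G S) (over_semiring G T) (over_push G T \<phi>)"
  unfolding additive_def
proof (intro conjI ballI Pi_I)
  fix C assume "C \<in> carrier (over_semiring G S)"
  then obtain X :: "('g, 'u) gset" and f where X: "fin_gset G X" "equivariant G X S f" and
    C: "C = over_class G S X f" by (metis over_carrierE gmapsD(4))
  show "over_push G T \<phi> C \<in> carrier (over_semiring G T)"
    unfolding C over_push_class[OF X] by (rule over_class_carrier[OF X(1) equivariant_comp[OF X(2) \<phi>]])
  fix D assume "D \<in> carrier (over_semiring G S)"
  then obtain Y :: "('g, 'u) gset" and g where Y: "fin_gset G Y" "equivariant G Y S g" and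
    D: "D = over_class G S Y g" by (metis over_carrierE gmapsD(4))
  note XY = disj_union_gset[OF X(1) Y(1)] equivariant_case_sum[OF X(2) Y(2)]
  show "over_push G T \<phi> (C \<oplus>\<^bsub>over_semiring G S\<^esub> D)
      = over_push G T \<phi> C \<oplus>\<^bsub>over_semiring G T\<^esub> over_push G T \<phi> D"
    unfolding C D over_add[OF X Y] over_push_class[OF X] over_push_class[OF Y] over_push_class[OF XY]
      over_add[OF X(1) equivariant_comp[OF X(2) \<phi>] Y(1) equivariant_comp[OF Y(2) \<phi>]]
    by (rule over_class_cong[OF XY(1)]) (auto split: sum.split)
qed

lemma over_pull_additive:
  fixes S T :: "('g, 'u) gset"
  assumes S: "fin_gset G S" "equivariant G S T \<phi>"
  shows "additive (over_semiring G T) (over_semiring G S) (over_pull G S \<phi>)"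
  unfolding additive_def
proof (intro conjI ballI Pi_I)
  fix C assume "C \<in> carrier (over_semiring G T)"
  then obtain X :: "('g, 'u) gset" and f where X: "fin_gset G X" "equivariant G X T f" and
    C: "C = over_class G T X f" by (metis over_carrierE gmapsD(4))
  note SX = fibre_prod_gset[OF S(1) X(1) S(2) X(2)] fibre_prod_proj(1)
  show "over_pull G S \<phi> C \<in> carrier (over_semiring G S)"
    unfolding C over_pull_class[OF X S] by (rule over_class_carrier[OF SX])
  fix D assume "D \<in> carrier (over_semiring G T)"
  then obtain Y :: "('g, 'u) gset" and g where Y: "fin_gset G Y" "equivariant G Y T g" and
    D: "D = over_class G T Y g" by (metis over_carrierE gmapsD(4))
  note SY = fibre_prod_gset[OF S(1) Y(1) S(2) Y(2)] fibre_prod_proj(1)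
  note XY = disj_union_gset[OF X(1) Y(1)] equivariant_case_sum[OF X(2) Y(2)]
  show "over_pull G S \<phi> (C \<oplus>\<^bsub>over_semiring G T\<^esub> D)
      = over_pull G S \<phi> C \<oplus>\<^bsub>over_semiring G S\<^esub> over_pull G S \<phi> D"
    unfolding C D over_add[OF X Y] over_pull_class[OF X S] over_pull_class[OF Y S] over_pull_class[OF XY S]
      over_add[OF SX SY]
  proof (rule over_class_eqI[symmetric])
    show "over_iso G (disj_union (fibre_prod \<phi> f S X) (fibre_prod \<phi> g S Y)) (case_sum fst fst)
        (fibre_prod \<phi> (case_sum f g) S (disj_union X Y)) fst"
      by (rule over_iso_inverseI[where h = "case_sum (map_prod id Inl) (map_prod id Inr)"
            and k = "\<lambda>(s, z). case_sum (\<lambda>x. Inl (s, x)) (\<lambda>y. Inr (s, y)) z"])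
        (auto simp: equivariant_def disj_union_def fibre_prod_def fibre_points_def)
  qed (intro disj_union_gset SX SY fibre_prod_gset[OF S(1) XY(1) S(2) XY(2)])+
qed

lemma over_pull_id:
  fixes S :: "('g, 'u) gset"
  assumes S: "fin_gset G S" and C: "C \<in> carrier (over_semiring G S)"
  shows "over_pull G S (\<lambda>s \<in> pts S. s) C = C"
proof -
  obtain X :: "('g, 'u) gset" and f where X: "fin_gset G X" "equivariant G X S f" and
    C: "C = over_class G S X f" using C by (metis over_carrierE gmapsD(4))
  note id = gmapsD(4)[OF gmaps_id[OF S]]
  show ?thesis unfolding C over_pull_class[OF X S id]
  proof (rule over_class_eqI[OF fibre_prod_gset[OF S X(1) id X(2)] X(1)])
    show "over_iso G (fibre_prod (\<lambda>s \<in> pts S. s) f S X) fst X f"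
      using equivariantD(1)[OF X(2)]
      by (intro over_iso_inverseI[OF fibre_prod_proj(2), where k = "\<lambda>x. (f x, x)"])
        (auto simp: fibre_prod_def fibre_points_def)
  qed
qed

lemma over_pull_compose:
  fixes S U W :: "('g, 'u) gset"
  assumes W: "fin_gset G W" and U: "fin_gset G U" and q: "q \<in> gmaps G W U" and \<psi>: "\<psi> \<in> gmaps G U S"
    and C: "C \<in> carrier (over_semiring G S)"
  shows "over_pull G W q (over_pull G U \<psi> C) = over_pull G W (compose (pts W) \<psi> q) C"
proof -
  obtain X :: "('g, 'u) gset" and f where X: "fin_gset G X" "equivariant G X S f" and
    C: "C = over_class G S X f" using C by (metis over_carrierE gmapsD(4))
  note \<psi>q = gmapsD(4)[OF gmaps_compose[OF W q \<psi>]]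
  note UX = fibre_prod_gset[OF U X(1) gmapsD(4)[OF \<psi>] X(2)] fibre_prod_proj(1)[of \<psi> f U X]
  show ?thesis
    unfolding C over_pull_class[OF X U gmapsD(4)[OF \<psi>]] over_pull_class[OF X W \<psi>q]
      over_pull_class[OF UX W gmapsD(4)[OF q]]
  proof (rule over_class_eqI)
    show "over_iso G (fibre_prod q fst W (fibre_prod \<psi> f U X)) fst
        (fibre_prod (compose (pts W) \<psi> q) f W X) fst"
      by (rule over_iso_inverseI[where h = "map_prod id snd" and k = "\<lambda>(w, x). (w, q w, x)"])
        (auto simp: equivariant_def fibre_prod_def fibre_points_def compose_def gmapsD(1)[OF q])
  qed (rule fibre_prod_gset W X gmapsD(4)[OF q] \<psi>q UX)+
qed

text \<open>Pulling back \<open>X\<close> over \<open>S\<^sub>2\<close> along \<open>\<Phi>\<close> first, or the composite \<open>X \<rightarrow> T\<close> along \<open>\<phi>\<close>, gives the same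
  fibre product: \<open>S \<times> X\<close> over \<open>S\<^sub>2\<close> is \<open>(S\<^sub>1 \<times> S\<^sub>2) \<times> X\<close> over \<open>T\<close> and \<open>S\<^sub>2\<close>, which is \<open>S\<^sub>1 \<times> X\<close> over \<open>T\<close>.\<close>

lemma over_pull_push:
  fixes S S1 S2 T :: "('g, 'u) gset"
  assumes S: "fin_gset G S" and S1: "fin_gset G S1"
    and sq: "pullback_square G S S1 S2 T \<Psi> \<Phi> \<phi> \<psi>" and C: "C \<in> carrier (over_semiring G S2)"
  shows "over_pull G S1 \<phi> (over_push G T \<psi> C) = over_push G S1 \<Psi> (over_pull G S \<Phi> C)"
proof -
  obtain X :: "('g, 'u) gset" and f where X: "fin_gset G X" "equivariant G X S2 f" and
    C: "C = over_class G S2 X f" using C by (metis over_carrierE gmapsD(4))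
  have \<Psi>: "equivariant G S S1 \<Psi>" and \<Phi>: "equivariant G S S2 \<Phi>"
    and \<phi>: "equivariant G S1 T \<phi>" and \<psi>: "equivariant G S2 T \<psi>"
    and iso: "bij_betw (\<lambda>s \<in> pts S. (\<Psi> s, \<Phi> s)) (pts S) (pts (fibre_prod \<phi> \<psi> S1 S2))"
    using sq by (auto simp: pullback_square_def gmapsD(4) gisos_def)
  have inj: "s = s'" if "s \<in> pts S" "s' \<in> pts S" "\<Psi> s = \<Psi> s'" "\<Phi> s = \<Phi> s'" for s s'
    using iso that by (auto simp: bij_betw_def inj_on_def)
  have comm: "\<phi> (\<Psi> s) = \<psi> (\<Phi> s)" if "s \<in> pts S" for s
    using bij_betwE[OF iso] that by (auto simp: fibre_prod_pts)
  note X\<psi> = X(1) equivariant_comp[OF X(2) \<psi>]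
  note SX = fibre_prod_gset[OF S X(1) \<Phi> X(2)] fibre_prod_proj(1)[of \<Phi> f S X]
  show ?thesis
    unfolding C over_push_class[OF X] over_pull_class[OF X S \<Phi>] over_pull_class[OF X\<psi> S1 \<phi>]
      over_push_class[OF SX]
  proof (rule over_class_eqI[symmetric, OF SX(1) fibre_prod_gset[OF S1 X(1) \<phi> X\<psi>(2)]])
    show "over_iso G (fibre_prod \<Phi> f S X) (\<lambda>x. \<Psi> (fst x)) (fibre_prod \<phi> (\<lambda>x. \<psi> (f x)) S1 X) fst"
    proof (rule over_isoI[where h = "map_prod \<Psi> id"])
      show "equivariant G (fibre_prod \<Phi> f S X) (fibre_prod \<phi> (\<lambda>x. \<psi> (f x)) S1 X) (map_prod \<Psi> id)"
        using equivariantD[OF \<Psi>] comm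
        by (intro equivariantI) (auto simp: fibre_prod_def fibre_points_def)
      show "inj_on (map_prod \<Psi> id) (pts (fibre_prod \<Phi> f S X))"
        using inj by (auto simp: inj_on_def fibre_prod_def fibre_points_def)
      fix y assume "y \<in> pts (fibre_prod \<phi> (\<lambda>x. \<psi> (f x)) S1 X)"
      then obtain t x where y: "y = (t, x)" "t \<in> pts S1" "x \<in> pts X" "\<phi> t = \<psi> (f x)"
        by (cases y) (auto simp: fibre_prod_pts)
      then have "(t, f x) \<in> pts (fibre_prod \<phi> \<psi> S1 S2)"
        using equivariantD(1)[OF X(2)] by (simp add: fibre_prod_pts)
      then have "(t, f x) \<in> (\<lambda>s \<in> pts S. (\<Psi> s, \<Phi> s)) ` pts S" using iso by (simp add: bij_betw_def)
      then obtain s where "s \<in> pts S" "t = \<Psi> s" "f x = \<Phi> s" by auto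
      then show "\<exists>z \<in> pts (fibre_prod \<Phi> f S X). y = map_prod \<Psi> id z"
        using y by (intro bexI[of _ "(s, x)"]) (auto simp: fibre_prod_pts)
    qed auto
  qed
qed

end

section \<open>The Burnside functor\<close>

context gset_universe
begin

abbreviation "B S \<equiv> groth_ring (over_semiring G S)"

lemma burnside_simps:
  "mval (burnside G) S = B S"
  "mcov (burnside G) S T \<phi> = groth_map (over_semiring G T) (over_push G T \<phi>)"
  "mcon (burnside G) S T \<phi> = groth_map (over_semiring G S) (over_pull G S \<phi>)"
  by (simp_all add: burnside_def)

lemma groth_over_semiring: fixes S :: "('g, 'u) gset" shows "groth (over_semiring G S)"
  using abelian_monoid_over_semiring[of S] by (simp add: groth_def)

lemma B_abelian_group: fixes S :: "('g, 'u) gset" shows "abelian_group (B S)"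
  by (rule groth.abelian_group_groth[OF groth_over_semiring])

lemma B_carrierE:
  fixes S :: "('g, 'u) gset"
  assumes "a \<in> carrier (B S)"
  obtains C D where "C \<in> carrier (over_semiring G S)" "D \<in> carrier (over_semiring G S)"
    "a = groth_diff (over_semiring G S) C D"
  using groth.groth_carrierE[OF groth_over_semiring assms] by blast

lemma B_push_hom:
  fixes S T :: "('g, 'u) gset"
  assumes "\<phi> \<in> gmaps G S T"
  shows "mcov (burnside G) S T \<phi> \<in> hom (add_monoid (B S)) (add_monoid (B T))"
  unfolding burnside_simps
  by (rule groth_map_hom[OF abelian_monoid_over_semiring abelian_monoid_over_semiring over_push_additive[OF gmapsD(4)[OF assms]]])

lemma B_pull_hom:
  fixes S T :: "('g, 'u) gset"
  assumes "fin_gset G S" "\<phi> \<in> gmaps G S T"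
  shows "mcon (burnside G) S T \<phi> \<in> hom (add_monoid (B T)) (add_monoid (B S))"
  unfolding burnside_simps
  by (rule groth_map_hom[OF abelian_monoid_over_semiring abelian_monoid_over_semiring over_pull_additive[OF assms(1) gmapsD(4)[OF assms(2)]]])

lemma B_push_diff:
  fixes S T :: "('g, 'u) gset"
  assumes "\<phi> \<in> gmaps G S T" "C \<in> carrier (over_semiring G S)" "D \<in> carrier (over_semiring G S)"
  shows "mcov (burnside G) S T \<phi> (groth_diff (over_semiring G S) C D)
    = groth_diff (over_semiring G T) (over_push G T \<phi> C) (over_push G T \<phi> D)"
  unfolding burnside_simps
  by (rule groth_map_diff[OF abelian_monoid_over_semiring abelian_monoid_over_semiring over_push_additive[OF gmapsD(4)[OF assms(1)]] assms(2,3)])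

lemma B_pull_diff:
  fixes S T :: "('g, 'u) gset"
  assumes "fin_gset G S" "\<phi> \<in> gmaps G S T" "C \<in> carrier (over_semiring G T)" "D \<in> carrier (over_semiring G T)"
  shows "mcon (burnside G) S T \<phi> (groth_diff (over_semiring G T) C D)
    = groth_diff (over_semiring G S) (over_pull G S \<phi> C) (over_pull G S \<phi> D)"
  unfolding burnside_simps
  by (rule groth_map_diff[OF abelian_monoid_over_semiring abelian_monoid_over_semiring over_pull_additive[OF assms(1) gmapsD(4)[OF assms(2)]] assms(3,4)])

lemma over_push_carrier:
  fixes S T :: "('g, 'u) gset"
  shows "\<lbrakk>\<phi> \<in> gmaps G S T; C \<in> carrier (over_semiring G S)\<rbrakk> \<Longrightarrow> over_push G T \<phi> C \<in> carrier (over_semiring G T)"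
  using over_push_additive[OF gmapsD(4)] by (auto simp: additive_def)

lemma over_pull_carrier:
  fixes S T :: "('g, 'u) gset"
  shows "\<lbrakk>fin_gset G S; \<phi> \<in> gmaps G S T; C \<in> carrier (over_semiring G T)\<rbrakk>
    \<Longrightarrow> over_pull G S \<phi> C \<in> carrier (over_semiring G S)"
  using over_pull_additive[OF _ gmapsD(4)] by (auto simp: additive_def)

lemma B_pull_id:
  fixes S :: "('g, 'u) gset"
  assumes "fin_gset G S" "a \<in> carrier (B S)"
  shows "mcon (burnside G) S S (\<lambda>s \<in> pts S. s) a = a"
  using assms(2) by (rule B_carrierE) (simp add: B_pull_diff gmaps_id assms(1) over_pull_id)

lemma B_pull_compose:
  fixes S U W :: "('g, 'u) gset"
  assumes "fin_gset G W" "fin_gset G U" "q \<in> gmaps G W U" "\<psi> \<in> gmaps G U S" "a \<in> carrier (B S)"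
  shows "mcon (burnside G) W U q (mcon (burnside G) U S \<psi> a)
    = mcon (burnside G) W S (compose (pts W) \<psi> q) a"
  using assms(5)
  by (rule B_carrierE)
    (simp add: B_pull_diff assms(1-4) gmaps_compose[OF assms(1,3,4)] over_pull_carrier[OF assms(2,4)]
      over_pull_compose[OF assms(1-4)])

lemma B_pull_push:
  fixes S S1 S2 T :: "('g, 'u) gset"
  assumes "fin_gset G S" "fin_gset G S1" and sq: "pullback_square G S S1 S2 T \<Psi> \<Phi> \<phi> \<psi>"
    and a: "a \<in> carrier (B S2)"
  shows "mcon (burnside G) S1 T \<phi> (mcov (burnside G) S2 T \<psi> a)
    = mcov (burnside G) S S1 \<Psi> (mcon (burnside G) S S2 \<Phi> a)"
proof -
  have *: "\<Psi> \<in> gmaps G S S1" "\<Phi> \<in> gmaps G S S2" "\<phi> \<in> gmaps G S1 T" "\<psi> \<in> gmaps G S2 T"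
    using sq by (auto simp: pullback_square_def)
  show ?thesis using a
    by (rule B_carrierE)
      (simp add: B_pull_diff B_push_diff * assms(1,2) over_push_carrier[OF *(4)] over_pull_carrier[OF assms(1) *(2)] over_pull_push[OF assms(1,2) sq])
qed

lemma pullback_squareI:
  assumes S: "fin_gset G S"
    and gm: "\<Psi> \<in> gmaps G S S1" "\<Phi> \<in> gmaps G S S2" "\<phi> \<in> gmaps G S1 T" "\<psi> \<in> gmaps G S2 T"
    and comm: "\<And>s. s \<in> pts S \<Longrightarrow> \<phi> (\<Psi> s) = \<psi> (\<Phi> s)"
    and inj: "\<And>s s'. \<lbrakk>s \<in> pts S; s' \<in> pts S; \<Psi> s = \<Psi> s'; \<Phi> s = \<Phi> s'\<rbrakk> \<Longrightarrow> s = s'"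
    and surj: "\<And>t v. \<lbrakk>t \<in> pts S1; v \<in> pts S2; \<phi> t = \<psi> v\<rbrakk> \<Longrightarrow> \<exists>s \<in> pts S. \<Psi> s = t \<and> \<Phi> s = v"
  shows "pullback_square G S S1 S2 T \<Psi> \<Phi> \<phi> \<psi>"
proof -
  let ?h = "\<lambda>s \<in> pts S. (\<Psi> s, \<Phi> s)"
  have "equivariant G S (fibre_prod \<phi> \<psi> S1 S2) ?h"
    unfolding equivariant_restrict[OF S]
    by (rule equivariantI) (auto simp: fibre_prod_def fibre_points_def gmapsD(1,2)[OF gm(1)] gmapsD(1,2)[OF gm(2)] comm)
  moreover have "bij_betw ?h (pts S) (pts (fibre_prod \<phi> \<psi> S1 S2))"
  proof (rule bij_betw_imageI)
    show "inj_on ?h (pts S)" using inj by (auto simp: inj_on_def)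
    show "?h ` pts S = pts (fibre_prod \<phi> \<psi> S1 S2)"
    proof (intro equalityI subsetI)
      fix z assume "z \<in> ?h ` pts S"
      then show "z \<in> pts (fibre_prod \<phi> \<psi> S1 S2)"
        by (auto simp: fibre_prod_pts gmapsD(1)[OF gm(1)] gmapsD(1)[OF gm(2)] comm)
    next
      fix z assume "z \<in> pts (fibre_prod \<phi> \<psi> S1 S2)"
      then obtain t v where "z = (t, v)" "t \<in> pts S1" "v \<in> pts S2" "\<phi> t = \<psi> v"
        by (cases z) (auto simp: fibre_prod_pts)
      moreover from this obtain s where "s \<in> pts S" "\<Psi> s = t" "\<Phi> s = v" using surj by blast
      ultimately show "z \<in> ?h ` pts S" by (intro rev_image_eqI[of s]) simp_all
    qed
  qed
  ultimately show ?thesis using gm by (simp add: pullback_square_def gisos_iff[OF S])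
qed

text \<open>The fibre product, copied into the universe.\<close>

lemma ex_pullback:
  fixes S1 S2 T :: "('g, 'u) gset"
  assumes S1: "fin_gset G S1" and S2: "fin_gset G S2" and \<phi>: "\<phi> \<in> gmaps G S1 T" and \<psi>: "\<psi> \<in> gmaps G S2 T"
  shows "\<exists>(S :: ('g, 'u) gset) \<Psi> \<Phi>. fin_gset G S \<and> pullback_square G S S1 S2 T \<Psi> \<Phi> \<phi> \<psi>"
proof -
  let ?P = "fibre_prod \<phi> \<psi> S1 S2"
  have P: "fin_gset G ?P" by (rule fibre_prod_gset[OF S1 S2 gmapsD(4)[OF \<phi>] gmapsD(4)[OF \<psi>]])
  obtain S :: "('g, 'u) gset" and h where S: "fin_gset G S" and h: "equivariant G ?P S h" "bij_betw h (pts ?P) (pts S)"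
    using ex_copy[OF P infinite_universe] by blast
  let ?k = "inv_into (pts ?P) h"
  have k: "equivariant G S ?P ?k" by (rule equivariant_inv_into[OF P h])
  have kp: "fst (?k s) \<in> pts S1" "snd (?k s) \<in> pts S2" "\<phi> (fst (?k s)) = \<psi> (snd (?k s))" if "s \<in> pts S" for s
    using equivariantD(1)[OF k that] by (auto simp: fibre_prod_def fibre_points_def)
  have hk: "h (?k s) = s" if "s \<in> pts S" for s using bij_betw_inv_into_right[OF h(2) that] .
  have "pullback_square G S S1 S2 T (\<lambda>s \<in> pts S. fst (?k s)) (\<lambda>s \<in> pts S. snd (?k s)) \<phi> \<psi>"
  proof (rule pullback_squareI[OF S _ _ \<phi> \<psi>])
    show "(\<lambda>s \<in> pts S. fst (?k s)) \<in> gmaps G S S1" "(\<lambda>s \<in> pts S. snd (?k s)) \<in> gmaps G S S2"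
      by (intro gmaps_restrict S equivariant_comp[OF k] fibre_prod_proj)+
    show "s = s'" if "s \<in> pts S" "s' \<in> pts S"
      "(\<lambda>s \<in> pts S. fst (?k s)) s = (\<lambda>s \<in> pts S. fst (?k s)) s'"
      "(\<lambda>s \<in> pts S. snd (?k s)) s = (\<lambda>s \<in> pts S. snd (?k s)) s'" for s s'
    proof -
      have "?k s = ?k s'" using that by (simp add: prod_eq_iff)
      then show ?thesis using hk[OF that(1)] hk[OF that(2)] by metis
    qed
    fix t v assume tv: "t \<in> pts S1" "v \<in> pts S2" "\<phi> t = \<psi> v"
    then have "(t, v) \<in> pts ?P" by (simp add: fibre_prod_pts)
    then have "h (t, v) \<in> pts S" "?k (h (t, v)) = (t, v)"
      using bij_betwE[OF h(2)] bij_betw_inv_into_left[OF h(2)] by auto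
    then show "\<exists>s \<in> pts S. (\<lambda>s \<in> pts S. fst (?k s)) s = t \<and> (\<lambda>s \<in> pts S. snd (?k s)) s = v"
      by (intro bexI[of _ "h (t, v)"]) auto
  qed (simp add: kp)
  then show ?thesis using S by blast
qed

end

section \<open>The action of the Burnside ring on a Mackey functor\<close>

locale mackey_action = gset_universe G u + mackey_functor G M
  for G :: "('g, 'b) monoid_scheme" (structure) and u :: "'u itself" and M :: "('g, 'u, 'm) mackey"
begin

lemma cov_closed:
  "\<lbrakk>fin_gset G S; fin_gset G T; \<phi> \<in> gmaps G S T; x \<in> carrier (mval M S)\<rbrakk> \<Longrightarrow> mcov M S T \<phi> x \<in> carrier (mval M T)"
  using cov_hom[of S T \<phi>] by (auto simp: hom_def)

lemma con_closed:
  "\<lbrakk>fin_gset G S; fin_gset G T; \<phi> \<in> gmaps G S T; x \<in> carrier (mval M T)\<rbrakk> \<Longrightarrow> mcon M S T \<phi> x \<in> carrier (mval M S)"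
  using con_hom[of S T \<phi>] by (auto simp: hom_def)

lemma cov_add:
  "\<lbrakk>fin_gset G S; fin_gset G T; \<phi> \<in> gmaps G S T; x \<in> carrier (mval M S); y \<in> carrier (mval M S)\<rbrakk>
    \<Longrightarrow> mcov M S T \<phi> (x \<oplus>\<^bsub>mval M S\<^esub> y) = mcov M S T \<phi> x \<oplus>\<^bsub>mval M T\<^esub> mcov M S T \<phi> y"
  using cov_hom[of S T \<phi>] by (auto simp: hom_def)

lemma con_add:
  "\<lbrakk>fin_gset G S; fin_gset G T; \<phi> \<in> gmaps G S T; x \<in> carrier (mval M T); y \<in> carrier (mval M T)\<rbrakk>
    \<Longrightarrow> mcon M S T \<phi> (x \<oplus>\<^bsub>mval M T\<^esub> y) = mcon M S T \<phi> x \<oplus>\<^bsub>mval M S\<^esub> mcon M S T \<phi> y"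
  using con_hom[of S T \<phi>] by (auto simp: hom_def)

lemma cov_zero:
  assumes "fin_gset G S" "fin_gset G T" "\<phi> \<in> gmaps G S T"
  shows "mcov M S T \<phi> \<zero>\<^bsub>mval M S\<^esub> = \<zero>\<^bsub>mval M T\<^esub>"
proof -
  interpret group_hom "add_monoid (mval M S)" "add_monoid (mval M T)" "mcov M S T \<phi>"
    using cov_hom[OF assms] abelian_group.a_group[OF val_abelian] assms
    by (simp add: group_hom_def group_hom_axioms_def)
  show ?thesis using hom_one by simp
qed

text \<open>The pullback of an injective map along itself is the identity.\<close>

lemma con_cov_inj:
  assumes S: "fin_gset G S" and T: "fin_gset G T" and \<iota>: "\<iota> \<in> gmaps G S T" and inj: "inj_on \<iota> (pts S)"
    and x: "x \<in> carrier (mval M S)"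
  shows "mcon M S T \<iota> (mcov M S T \<iota> x) = x"
proof -
  have "pullback_square G S S S T (\<lambda>s \<in> pts S. s) (\<lambda>s \<in> pts S. s) \<iota> \<iota>"
    by (rule pullback_squareI[OF S gmaps_id[OF S] gmaps_id[OF S] \<iota> \<iota>]) (use inj in \<open>auto simp: inj_on_def\<close>)
  then show ?thesis using pullback[OF S S S T _ x] cov_id[OF S] con_id[OF S] x by simp
qed

text \<open>The pullback is the empty \<open>G\<close>-set, where a Mackey functor vanishes.\<close>

lemma con_cov_disjoint:
  assumes S1: "fin_gset G S1" and S2: "fin_gset G S2" and T: "fin_gset G T"
    and \<iota>: "\<iota>1 \<in> gmaps G S1 T" "\<iota>2 \<in> gmaps G S2 T"
    and disj: "\<And>s t. \<lbrakk>s \<in> pts S1; t \<in> pts S2\<rbrakk> \<Longrightarrow> \<iota>1 s \<noteq> \<iota>2 t" and x: "x \<in> carrier (mval M S2)"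
  shows "mcon M S1 T \<iota>1 (mcov M S2 T \<iota>2 x) = \<zero>\<^bsub>mval M S1\<^esub>"
proof -
  let ?e = "(\<lambda>s \<in> {}. s) :: 'u \<Rightarrow> 'u"
  have e: "?e \<in> gmaps G empty_set S1" "?e \<in> gmaps G empty_set S2"
    unfolding gmaps_iff equivariant_def by (simp_all add: restrict_def)
  have "pullback_square G empty_set S1 S2 T ?e ?e \<iota>1 \<iota>2"
    by (rule pullback_squareI[OF empty_gset e \<iota>]) (use disj in auto)
  from pullback[OF empty_gset S1 S2 T this x]
  have "mcon M S1 T \<iota>1 (mcov M S2 T \<iota>2 x) = mcov M empty_set S1 ?e (mcon M empty_set S2 ?e x)" .
  moreover have "mcon M empty_set S2 ?e x = \<zero>\<^bsub>mval M empty_set\<^esub>"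
    using con_closed[OF empty_gset S2 e(2) x] empty[OF empty_gset] by simp
  ultimately show ?thesis using cov_zero[OF empty_gset S1 e(1)] by simp
qed

text \<open>Both sides have the same components under the isomorphism of the coproduct axiom, by the
  two preceding lemmas. This is what makes the action of a disjoint union the sum of the actions.\<close>

lemma coproduct_decomposition:
  assumes S: "fin_gset G S1" "fin_gset G S2" "fin_gset G S" and co: "coproduct_diagram G S1 S2 S \<iota>1 \<iota>2"
    and z: "z \<in> carrier (mval M S)"
  shows "z = mcov M S1 S \<iota>1 (mcon M S1 S \<iota>1 z) \<oplus>\<^bsub>mval M S\<^esub> mcov M S2 S \<iota>2 (mcon M S2 S \<iota>2 z)"
    (is "z = ?a \<oplus>\<^bsub>mval M S\<^esub> ?b")
proof -
  interpret V: abelian_group "mval M S" by (rule val_abelian[OF S(3)])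
  interpret V1: abelian_group "mval M S1" by (rule val_abelian[OF S(1)])
  interpret V2: abelian_group "mval M S2" by (rule val_abelian[OF S(2)])
  have \<iota>: "\<iota>1 \<in> gmaps G S1 S" "\<iota>2 \<in> gmaps G S2 S" and
    bij: "bij_betw (\<lambda>z \<in> pts S1 <+> pts S2. case_sum \<iota>1 \<iota>2 z) (pts (disj_union S1 S2)) (pts S)"
    using co by (auto simp: coproduct_diagram_def gisos_def)
  have inj: "inj_on (\<lambda>z \<in> pts S1 <+> pts S2. case_sum \<iota>1 \<iota>2 z) (pts S1 <+> pts S2)"
    using bij by (simp add: bij_betw_def disj_union_pts)
  have inj1: "inj_on \<iota>1 (pts S1)" 
    by (rule inj_onI) (use inj_onD[OF inj, of "Inl _" "Inl _"] in auto)
  have inj2: "inj_on \<iota>2 (pts S2)"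
    by (rule inj_onI) (use inj_onD[OF inj, of "Inr _" "Inr _"] in auto)
  have disj: "\<iota>1 s \<noteq> \<iota>2 t" if "s \<in> pts S1" "t \<in> pts S2" for s t
    using inj_onD[OF inj, of "Inl s" "Inr t"] that by auto
  let ?c = "\<lambda>x. (mcon M S1 S \<iota>1 x, mcon M S2 S \<iota>2 x)"
  have c: "mcon M S1 S \<iota>1 z \<in> carrier (mval M S1)" "mcon M S2 S \<iota>2 z \<in> carrier (mval M S2)"
    using con_closed S \<iota> z by auto
  have ab: "?a \<in> carrier (mval M S)" "?b \<in> carrier (mval M S)" using cov_closed S \<iota> c by auto
  have inj_c: "inj_on ?c (carrier (mval M S))"
    using coproduct[OF S co] by (auto simp: iso_def bij_betw_def)
  have eq_c: "?c (?a \<oplus>\<^bsub>mval M S\<^esub> ?b) = ?c z"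
  proof -
    have "mcon M S1 S \<iota>1 (?a \<oplus>\<^bsub>mval M S\<^esub> ?b) = mcon M S1 S \<iota>1 z"
      using con_add[OF S(1,3) \<iota>(1) ab] con_cov_inj[OF S(1,3) \<iota>(1) inj1 c(1)]
        con_cov_disjoint[OF S \<iota> disj c(2)] c by simp
    moreover have "mcon M S2 S \<iota>2 (?a \<oplus>\<^bsub>mval M S\<^esub> ?b) = mcon M S2 S \<iota>2 z"
      using con_add[OF S(2,3) \<iota>(2) ab] con_cov_inj[OF S(2,3) \<iota>(2) inj2 c(2)]
        con_cov_disjoint[OF S(2,1,3) \<iota>(2,1) disj[symmetric] c(1)] c by simp
    ultimately show ?thesis by simp
  qed
  show ?thesis using inj_onD[OF inj_c eq_c V.a_closed[OF ab] z] by (rule sym)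
qed

text \<open>For an isomorphism \<open>h\<close> the maps \<open>h\<^sub>*\<close> and \<open>h\<^sup>*\<close> are inverse to each other, so that \<open>f\<^sub>* f\<^sup>*\<close>
  depends only on the class of \<open>f\<close>.\<close>

lemma over_act_class:
  assumes S: "fin_gset G S" and X: "fin_gset G X" and f: "f \<in> gmaps G X S" and x: "x \<in> carrier (mval M S)"
  shows "over_act M S (over_class G S X f) x = mcov M X S f (mcon M X S f x)"
proof -
  have "mcov M Y S g (mcon M Y S g x) = mcov M X S f (mcon M X S f x)"
    if "(Y, g) \<in> over_class G S X f" for Y g
  proof -
    have Y: "fin_gset G Y" and g: "g \<in> gmaps G Y S" and "over_iso G X f Y g"
      using that by (auto simp: over_class_mem[OF X])
    then obtain h where h: "equivariant G X Y h" "bij_betw h (pts X) (pts Y)" "\<forall>x \<in> pts X. g (h x) = f x"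
      by (auto simp: over_iso_def)
    let ?h = "restrict h (pts X)" and ?k = "restrict (inv_into (pts X) h) (pts Y)"
    have hg: "?h \<in> gmaps G X Y" by (rule gmaps_restrict[OF X h(1)])
    have kg: "?k \<in> gmaps G Y X" by (rule gmaps_restrict[OF Y equivariant_inv_into[OF X h(1,2)]])
    have f_eq: "f = compose (pts X) g ?h"
      using h(3) gmapsD(3)[OF f] by (auto simp: fun_eq_iff compose_def extensional_def)
    have hk: "compose (pts Y) ?h ?k = (\<lambda>y \<in> pts Y. y)"
      using bij_betw_inv_into_right[OF h(2)] gmapsD(1)[OF kg]
      by (auto simp: fun_eq_iff compose_def) 
    have inj: "inj_on ?h (pts X)" using h(2) by (auto simp: bij_betw_def inj_on_def)
    define y where "y = mcon M Y S g x"
    have y: "y \<in> carrier (mval M Y)" unfolding y_def by (rule con_closed[OF Y S g x])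
    \<comment> \<open>\<open>h\<^sup>* h\<^sub>* = id\<close> by injectivity; as \<open>h\<^sub>*\<close> is surjective, \<open>h\<^sub>* h\<^sup>* = id\<close> as well.\<close>
    have "y = mcov M X Y ?h (mcov M Y X ?k y)"
      using cov_compose[OF Y X Y kg hg y] cov_id[OF Y y] hk by simp
    then have "mcov M X Y ?h (mcon M X Y ?h y) = y"
      using con_cov_inj[OF X Y hg inj] cov_closed[OF Y X kg y] by metis
    then have "mcov M Y S g y = mcov M X S f (mcon M X Y ?h y)"
      using cov_compose[OF X Y S hg g con_closed[OF X Y hg y]] f_eq by simp
    then show ?thesis using con_compose[OF X Y S hg g x] f_eq y_def by simp
  qed
  then have "the_elem ((\<lambda>(X, f). mcov M X S f (mcon M X S f x)) ` over_class G S X f)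
      = (\<lambda>(X, f). mcov M X S f (mcon M X S f x)) (X, f)"
    by (intro the_elem_const[OF over_class_self[OF X f]]) auto
  then show ?thesis by (simp add: over_act_def)
qed

lemma over_act_closed:
  assumes S: "fin_gset G S" and C: "C \<in> carrier (over_semiring G S)" and x: "x \<in> carrier (mval M S)"
  shows "over_act M S C x \<in> carrier (mval M S)"
proof -
  obtain X :: "('g, 'u) gset" and f where X: "fin_gset G X" "f \<in> gmaps G X S" "C = over_class G S X f"
    using C by (rule over_carrierE)
  show ?thesis unfolding X(3) over_act_class[OF S X(1,2) x]
    by (rule cov_closed[OF X(1) S X(2) con_closed[OF X(1) S X(2) x]])
qed

lemma over_act_add_right:
  assumes S: "fin_gset G S" and C: "C \<in> carrier (over_semiring G S)"
    and x: "x \<in> carrier (mval M S)" "y \<in> carrier (mval M S)"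
  shows "over_act M S C (x \<oplus>\<^bsub>mval M S\<^esub> y) = over_act M S C x \<oplus>\<^bsub>mval M S\<^esub> over_act M S C y"
proof -
  interpret V: abelian_group "mval M S" by (rule val_abelian[OF S])
  obtain X :: "('g, 'u) gset" and f where X: "fin_gset G X" "f \<in> gmaps G X S" "C = over_class G S X f"
    using C by (rule over_carrierE)
  have con: "mcon M X S f x \<in> carrier (mval M X)" "mcon M X S f y \<in> carrier (mval M X)"
    using con_closed[OF X(1) S X(2)] x by auto
  show ?thesis
    unfolding X(3) over_act_class[OF S X(1,2) V.a_closed[OF x]] over_act_class[OF S X(1,2) x(1)] over_act_class[OF S X(1,2) x(2)]
    by (simp only: con_add[OF X(1) S X(2) x] cov_add[OF X(1) S X(2) con])
qed

text \<open>For the union \<open>Z\<close> of \<open>X\<close> and \<open>Y\<close> with its map \<open>r\<close> to \<open>S\<close>, decompose \<open>r\<^sup>* x\<close> along the two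
  inclusions and apply \<open>r\<^sub>*\<close>.\<close>

lemma over_act_add_left:
  assumes S: "fin_gset G S" and C: "C \<in> carrier (over_semiring G S)" and D: "D \<in> carrier (over_semiring G S)"
    and x: "x \<in> carrier (mval M S)"
  shows "over_act M S (C \<oplus>\<^bsub>over_semiring G S\<^esub> D) x = over_act M S C x \<oplus>\<^bsub>mval M S\<^esub> over_act M S D x"
proof -
  interpret V: abelian_group "mval M S" by (rule val_abelian[OF S])
  obtain X :: "('g, 'u) gset" and f where X: "fin_gset G X" and f: "f \<in> gmaps G X S" and C: "C = over_class G S X f"
    using C by (rule over_carrierE)
  obtain Y :: "('g, 'u) gset" and g where Y: "fin_gset G Y" and g: "g \<in> gmaps G Y S" and D: "D = over_class G S Y g"
    using D by (rule over_carrierE)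
  note XY = disj_union_gset[OF X Y] equivariant_case_sum[OF gmapsD(4)[OF f] gmapsD(4)[OF g]]
  obtain Z :: "('g, 'u) gset" and r where Z: "fin_gset G Z" and r: "r \<in> gmaps G Z S"
    and iso: "over_iso G (disj_union X Y) (case_sum f g) Z r"
    using ex_over_rep[OF XY] by blast
  have CD: "C \<oplus>\<^bsub>over_semiring G S\<^esub> D = over_class G S Z r"
    unfolding C D over_add[OF X gmapsD(4)[OF f] Y gmapsD(4)[OF g]] by (rule over_class_eqI[OF XY(1) Z iso])
  obtain h where h: "equivariant G (disj_union X Y) Z h" "bij_betw h (pts (disj_union X Y)) (pts Z)"
    "\<forall>z \<in> pts (disj_union X Y). r (h z) = case_sum f g z"
    using iso by (auto simp: over_iso_def)
  let ?i = "\<lambda>x \<in> pts X. h (Inl x)" and ?j = "\<lambda>y \<in> pts Y. h (Inr y)"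
  have i: "?i \<in> gmaps G X Z"
    by (intro gmaps_restrict X equivariant_comp[OF _ h(1)]) (auto simp: equivariant_def disj_union_def)
  have j: "?j \<in> gmaps G Y Z"
    by (intro gmaps_restrict Y equivariant_comp[OF _ h(1)]) (auto simp: equivariant_def disj_union_def)
  have "(\<lambda>z \<in> pts X <+> pts Y. case_sum ?i ?j z) = restrict h (pts (disj_union X Y))"
    by (auto simp: fun_eq_iff disj_union_pts)
  moreover have "restrict h (pts (disj_union X Y)) \<in> gisos G (disj_union X Y) Z"
    using h by (auto simp: gisos_iff[OF XY(1)] equivariant_restrict[OF XY(1)])
  ultimately have co: "coproduct_diagram G X Y Z ?i ?j" using i j by (simp add: coproduct_diagram_def)
  have ri: "compose (pts X) r ?i = f" and rj: "compose (pts Y) r ?j = g"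
    using h(3) gmapsD(3)[OF f] gmapsD(3)[OF g]
    by (auto simp: fun_eq_iff compose_def disj_union_pts extensional_def Plus_def)
  define z where "z = mcon M Z S r x"
  have z: "z \<in> carrier (mval M Z)" unfolding z_def by (rule con_closed[OF Z S r x])
  have zi: "mcon M X Z ?i z \<in> carrier (mval M X)" and zj: "mcon M Y Z ?j z \<in> carrier (mval M Y)"
    using con_closed X Y Z i j z by auto
  have "over_act M S (C \<oplus>\<^bsub>over_semiring G S\<^esub> D) x = mcov M Z S r z"
    unfolding CD over_act_class[OF S Z r x] z_def ..
  also have "\<dots> = mcov M Z S r (mcov M X Z ?i (mcon M X Z ?i z) \<oplus>\<^bsub>mval M Z\<^esub> mcov M Y Z ?j (mcon M Y Z ?j z))"
    using coproduct_decomposition[OF X Y Z co z] by simp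
  also have "\<dots> = mcov M Z S r (mcov M X Z ?i (mcon M X Z ?i z)) \<oplus>\<^bsub>mval M S\<^esub> mcov M Z S r (mcov M Y Z ?j (mcon M Y Z ?j z))"
    by (rule cov_add[OF Z S r cov_closed[OF X Z i zi] cov_closed[OF Y Z j zj]])
  also have "\<dots> = mcov M X S f (mcon M X Z ?i z) \<oplus>\<^bsub>mval M S\<^esub> mcov M Y S g (mcon M Y Z ?j z)"
    using cov_compose[OF X Z S i r zi] cov_compose[OF Y Z S j r zj] ri rj by simp
  also have "\<dots> = over_act M S C x \<oplus>\<^bsub>mval M S\<^esub> over_act M S D x"
    unfolding C D over_act_class[OF S X f x] over_act_class[OF S Y g x] z_def
    using con_compose[OF X Z S i r x] con_compose[OF Y Z S j r x] ri rj by simp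
  finally show ?thesis .
qed

end

lemma (in abelian_group) minus_eq_minusI:
  assumes car: "c \<in> carrier G" "d \<in> carrier G" "c' \<in> carrier G" "d' \<in> carrier G"
    and eq: "c \<oplus> d' = c' \<oplus> d"
  shows "c \<ominus> d = c' \<ominus> d'"
proof -
  have "(c \<oplus> d') \<oplus> (\<ominus> d \<oplus> \<ominus> d') = (c \<oplus> \<ominus> d) \<oplus> (d' \<oplus> \<ominus> d')"
    using car by (simp add: a_ac)
  moreover have "(c' \<oplus> d) \<oplus> (\<ominus> d \<oplus> \<ominus> d') = (c' \<oplus> \<ominus> d') \<oplus> (d \<oplus> \<ominus> d)"
    using car by (simp add: a_ac)
  ultimately show ?thesis using eq car by (simp add: a_minus_def r_neg)
qed

lemma (in abelian_group) minus_add_minus: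
  assumes "c \<in> carrier G" "d \<in> carrier G" "c' \<in> carrier G" "d' \<in> carrier G"
  shows "(c \<oplus> c') \<ominus> (d \<oplus> d') = (c \<ominus> d) \<oplus> (c' \<ominus> d')"
  using assms by (simp add: a_minus_def minus_add a_ac)

context gset_universe
begin

lemma pullback_squareD:
  assumes sq: "pullback_square G S S1 S2 T \<Psi> \<Phi> \<phi> \<psi>"
  shows "\<Psi> \<in> gmaps G S S1" "\<Phi> \<in> gmaps G S S2" "\<phi> \<in> gmaps G S1 T" "\<psi> \<in> gmaps G S2 T"
    and "s \<in> pts S \<Longrightarrow> \<phi> (\<Psi> s) = \<psi> (\<Phi> s)"
    and "\<lbrakk>s \<in> pts S; s' \<in> pts S; \<Psi> s = \<Psi> s'; \<Phi> s = \<Phi> s'\<rbrakk> \<Longrightarrow> s = s'"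
    and "\<lbrakk>t \<in> pts S1; v \<in> pts S2; \<phi> t = \<psi> v\<rbrakk> \<Longrightarrow> \<exists>s \<in> pts S. \<Psi> s = t \<and> \<Phi> s = v"
proof -
  have iso: "bij_betw (\<lambda>s \<in> pts S. (\<Psi> s, \<Phi> s)) (pts S) (pts (fibre_prod \<phi> \<psi> S1 S2))"
    using sq by (auto simp: pullback_square_def gisos_def)
  show "\<Psi> \<in> gmaps G S S1" "\<Phi> \<in> gmaps G S S2" "\<phi> \<in> gmaps G S1 T" "\<psi> \<in> gmaps G S2 T"
    using sq by (auto simp: pullback_square_def)
  show "\<phi> (\<Psi> s) = \<psi> (\<Phi> s)" if "s \<in> pts S" for s
    using bij_betwE[OF iso] that by (auto simp: fibre_prod_pts)
  show "s = s'" if "s \<in> pts S" "s' \<in> pts S" "\<Psi> s = \<Psi> s'" "\<Phi> s = \<Phi> s'" for s s'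
    using iso that by (auto simp: bij_betw_def inj_on_def)
  show "\<exists>s \<in> pts S. \<Psi> s = t \<and> \<Phi> s = v" if "t \<in> pts S1" "v \<in> pts S2" "\<phi> t = \<psi> v" for t v
  proof -
    have "(t, v) \<in> (\<lambda>s \<in> pts S. (\<Psi> s, \<Phi> s)) ` pts S"
      using iso that by (simp add: bij_betw_def fibre_prod_pts)
    then show ?thesis by auto
  qed
qed

lemma pullback_square_sym:
  assumes S: "fin_gset G S" and sq: "pullback_square G S S1 S2 T \<Psi> \<Phi> \<phi> \<psi>"
  shows "pullback_square G S S2 S1 T \<Phi> \<Psi> \<psi> \<phi>"
proof (rule pullback_squareI[OF S pullback_squareD(2,1,4,3)[OF sq]])
  show "\<psi> (\<Phi> s) = \<phi> (\<Psi> s)" if "s \<in> pts S" for s using pullback_squareD(5)[OF sq that] ..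
  show "s = s'" if "s \<in> pts S" "s' \<in> pts S" "\<Phi> s = \<Phi> s'" "\<Psi> s = \<Psi> s'" for s s'
    using pullback_squareD(6)[OF sq] that by blast
  show "\<exists>s \<in> pts S. \<Phi> s = t \<and> \<Psi> s = v" if "t \<in> pts S2" "v \<in> pts S1" "\<psi> t = \<phi> v" for t v
    using pullback_squareD(7)[OF sq that(2,1)] that(3) by auto
qed

end

context mackey_action
begin

lemma cov_group_hom:
  assumes "fin_gset G S" "fin_gset G T" "\<phi> \<in> gmaps G S T"
  shows "abelian_group_hom (mval M S) (mval M T) (mcov M S T \<phi>)"
  using cov_hom[OF assms] val_abelian[OF assms(1)] val_abelian[OF assms(2)]
  by (intro abelian_group_homI group_hom.intro abelian_group.a_group group_hom_axioms.intro)

lemma cov_minus: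
  assumes S: "fin_gset G S" "fin_gset G T" "\<phi> \<in> gmaps G S T"
    and x: "x \<in> carrier (mval M S)" "y \<in> carrier (mval M S)"
  shows "mcov M S T \<phi> (x \<ominus>\<^bsub>mval M S\<^esub> y) = mcov M S T \<phi> x \<ominus>\<^bsub>mval M T\<^esub> mcov M S T \<phi> y"
proof -
  interpret abelian_group_hom "mval M S" "mval M T" "mcov M S T \<phi>" by (rule cov_group_hom[OF S])
  show ?thesis using x by (simp add: a_minus_def)
qed

text \<open>Representatives of a formal difference differ by a relation \<open>C + D' + E = C' + D + E\<close>; the action
  is additive, and the term of \<open>E\<close> cancels in the group \<open>M(S)\<close>.\<close>

lemma burnside_act_diff:
  assumes S: "fin_gset G S" and C: "C \<in> carrier (over_semiring G S)" "D \<in> carrier (over_semiring G S)"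
    and x: "x \<in> carrier (mval M S)"
  shows "burnside_act M S (groth_diff (over_semiring G S) C D) x
    = over_act M S C x \<ominus>\<^bsub>mval M S\<^esub> over_act M S D x"
proof -
  interpret V: abelian_group "mval M S" by (rule val_abelian[OF S])
  interpret R: groth "over_semiring G S" by (rule groth_over_semiring)
  note ac = over_act_closed[OF S _ x] and aa = over_act_add_left[OF S _ _ x]
  have "over_act M S C' x \<ominus>\<^bsub>mval M S\<^esub> over_act M S D' x = over_act M S C x \<ominus>\<^bsub>mval M S\<^esub> over_act M S D x"
    if mem: "(C', D') \<in> groth_diff (over_semiring G S) C D" for C' D'
  proof -
    obtain E where car: "C' \<in> carrier (over_semiring G S)" "D' \<in> carrier (over_semiring G S)"
        "E \<in> carrier (over_semiring G S)" and
      eq: "C \<oplus>\<^bsub>over_semiring G S\<^esub> D' \<oplus>\<^bsub>over_semiring G S\<^esub> E = C' \<oplus>\<^bsub>over_semiring G S\<^esub> D \<oplus>\<^bsub>over_semiring G S\<^esub> E"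
      using mem by (auto simp: R.groth_diff_mem R.groth_rel_iff)
    have "over_act M S C x \<oplus>\<^bsub>mval M S\<^esub> over_act M S D' x \<oplus>\<^bsub>mval M S\<^esub> over_act M S E x
        = over_act M S C' x \<oplus>\<^bsub>mval M S\<^esub> over_act M S D x \<oplus>\<^bsub>mval M S\<^esub> over_act M S E x"
      using arg_cong[OF eq, of "\<lambda>C. over_act M S C x"] C car by (simp add: aa)
    then have "over_act M S C x \<oplus>\<^bsub>mval M S\<^esub> over_act M S D' x = over_act M S C' x \<oplus>\<^bsub>mval M S\<^esub> over_act M S D x"
      using C car ac by simp
    then show ?thesis using C car ac by (intro V.minus_eq_minusI[symmetric]) auto
  qed
  then have "the_elem ((\<lambda>(C, D). over_act M S C x \<ominus>\<^bsub>mval M S\<^esub> over_act M S D x) ` groth_diff (over_semiring G S) C D)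
      = (\<lambda>(C, D). over_act M S C x \<ominus>\<^bsub>mval M S\<^esub> over_act M S D x) (C, D)"
    by (intro the_elem_const[OF R.groth_diff_self[OF C]]) auto
  then show ?thesis by (simp add: burnside_act_def)
qed

lemma burnside_act_closed:
  assumes S: "fin_gset G S" and a: "a \<in> carrier (B S)" and x: "x \<in> carrier (mval M S)"
  shows "burnside_act M S a x \<in> carrier (mval M S)"
proof -
  interpret V: abelian_group "mval M S" by (rule val_abelian[OF S])
  obtain C D where C: "C \<in> carrier (over_semiring G S)" "D \<in> carrier (over_semiring G S)"
    "a = groth_diff (over_semiring G S) C D" using a by (rule B_carrierE)
  show ?thesis unfolding C(3) burnside_act_diff[OF S C(1,2) x]
    using over_act_closed[OF S C(1) x] over_act_closed[OF S C(2) x] by simp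
qed

lemma burnside_act_hom_left:
  assumes S: "fin_gset G S" and x: "x \<in> carrier (mval M S)"
  shows "abelian_group_hom (B S) (mval M S) (\<lambda>a. burnside_act M S a x)"
proof -
  interpret V: abelian_group "mval M S" by (rule val_abelian[OF S])
  interpret R: groth "over_semiring G S" by (rule groth_over_semiring)
  have "burnside_act M S (a \<oplus>\<^bsub>B S\<^esub> b) x = burnside_act M S a x \<oplus>\<^bsub>mval M S\<^esub> burnside_act M S b x"
    if ab: "a \<in> carrier (B S)" "b \<in> carrier (B S)" for a b
  proof -
    obtain C D where C: "C \<in> carrier (over_semiring G S)" "D \<in> carrier (over_semiring G S)"
      "a = groth_diff (over_semiring G S) C D" using ab(1) by (rule B_carrierE)
    obtain E F where E: "E \<in> carrier (over_semiring G S)" "F \<in> carrier (over_semiring G S)"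
      "b = groth_diff (over_semiring G S) E F" using ab(2) by (rule B_carrierE)
    note ac = over_act_closed[OF S _ x] and aa = over_act_add_left[OF S _ _ x]
    show ?thesis unfolding C(3) E(3) R.groth_add[OF C(1,2) E(1,2)] burnside_act_diff[OF S C(1,2) x]
        burnside_act_diff[OF S E(1,2) x] burnside_act_diff[OF S R.a_closed[OF C(1) E(1)] R.a_closed[OF C(2) E(2)] x]
        aa[OF C(1) E(1)] aa[OF C(2) E(2)]
      by (rule V.minus_add_minus[OF ac[OF C(1)] ac[OF C(2)] ac[OF E(1)] ac[OF E(2)]])
  qed
  then have "(\<lambda>a. burnside_act M S a x) \<in> hom (add_monoid (B S)) (add_monoid (mval M S))"
    by (intro homI) (auto simp: burnside_act_closed[OF S _ x])
  then show ?thesis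
    using B_abelian_group[of S] val_abelian[OF S]
    by (intro abelian_group_homI group_hom.intro abelian_group.a_group group_hom_axioms.intro)
qed

lemma burnside_act_hom_right:
  assumes S: "fin_gset G S" and a: "a \<in> carrier (B S)"
  shows "abelian_group_hom (mval M S) (mval M S) (burnside_act M S a)"
proof -
  interpret V: abelian_group "mval M S" by (rule val_abelian[OF S])
  obtain C D where C: "C \<in> carrier (over_semiring G S)" "D \<in> carrier (over_semiring G S)"
    "a = groth_diff (over_semiring G S) C D" using a by (rule B_carrierE)
  have "burnside_act M S a (x \<oplus>\<^bsub>mval M S\<^esub> y) = burnside_act M S a x \<oplus>\<^bsub>mval M S\<^esub> burnside_act M S a y"
    if xy: "x \<in> carrier (mval M S)" "y \<in> carrier (mval M S)" for x y
  proof -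
    note ac = over_act_closed[OF S C(1)] over_act_closed[OF S C(2)]
    show ?thesis
      unfolding C(3) burnside_act_diff[OF S C(1,2) xy(1)] burnside_act_diff[OF S C(1,2) xy(2)]
        burnside_act_diff[OF S C(1,2) V.a_closed[OF xy]] over_act_add_right[OF S C(1) xy] over_act_add_right[OF S C(2) xy]
      by (rule V.minus_add_minus) (use ac xy in auto)
  qed
  then have "burnside_act M S a \<in> hom (add_monoid (mval M S)) (add_monoid (mval M S))"
    by (intro homI) (auto simp: burnside_act_closed[OF S a])
  then show ?thesis
    using val_abelian[OF S]
    by (intro abelian_group_homI group_hom.intro abelian_group.a_group group_hom_axioms.intro)
qed

text \<open>This half of Frobenius reciprocity is functoriality: \<open>(\<phi> f)\<^sub>* (\<phi> f)\<^sup>* = \<phi>\<^sub>* (f\<^sub>* f\<^sup>*) \<phi>\<^sup>*\<close>.\<close>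

lemma over_act_push:
  assumes S: "fin_gset G S" and T: "fin_gset G T" and \<phi>: "\<phi> \<in> gmaps G S T"
    and C: "C \<in> carrier (over_semiring G S)" and y: "y \<in> carrier (mval M T)"
  shows "over_act M T (over_push G T \<phi> C) y = mcov M S T \<phi> (over_act M S C (mcon M S T \<phi> y))"
proof -
  obtain X :: "('g, 'u) gset" and f where X: "fin_gset G X" and f: "f \<in> gmaps G X S" and C: "C = over_class G S X f"
    using C by (rule over_carrierE)
  have "over_push G T \<phi> C = over_class G T X (compose (pts X) \<phi> f)"
    unfolding C over_push_class[OF X gmapsD(4)[OF f]] by (rule over_class_cong[OF X]) (simp add: compose_def)
  then show ?thesis
    unfolding C
    using over_act_class[OF T X gmaps_compose[OF X f \<phi>] y] over_act_class[OF S X f con_closed[OF S T \<phi> y]]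
      con_compose[OF X S T f \<phi> y] cov_compose[OF X S T f \<phi> con_closed[OF X S f con_closed[OF S T \<phi> y]]]
    by simp
qed

lemma burnside_act_push:
  assumes S: "fin_gset G S" and T: "fin_gset G T" and \<phi>: "\<phi> \<in> gmaps G S T"
    and a: "a \<in> carrier (B S)" and y: "y \<in> carrier (mval M T)"
  shows "burnside_act M T (mcov (burnside G) S T \<phi> a) y = mcov M S T \<phi> (burnside_act M S a (mcon M S T \<phi> y))"
proof -
  obtain C D where C: "C \<in> carrier (over_semiring G S)" "D \<in> carrier (over_semiring G S)"
    and a: "a = groth_diff (over_semiring G S) C D" using a by (rule B_carrierE)
  note y' = con_closed[OF S T \<phi> y]
  show ?thesis
    unfolding a B_push_diff[OF \<phi> C] burnside_act_diff[OF S C y'] over_act_push[OF S T \<phi> C(1) y] over_act_push[OF S T \<phi> C(2) y]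
      burnside_act_diff[OF T over_push_carrier[OF \<phi> C(1)] over_push_carrier[OF \<phi> C(2)] y]
    by (rule cov_minus[OF S T \<phi> over_act_closed[OF S C(1) y'] over_act_closed[OF S C(2) y'], symmetric])
qed

text \<open>The other half of Frobenius reciprocity uses the pullback \<open>P\<close> of \<open>f : X \<rightarrow> U\<close> and \<open>q : W \<rightarrow> U\<close>:
  \<open>f\<^sub>* f\<^sup>* q\<^sub>* w = f\<^sub>* p\<^sub>* g\<^sup>* w = q\<^sub>* g\<^sub>* g\<^sup>* w\<close>.\<close>

lemma over_act_cov:
  assumes W: "fin_gset G W" and U: "fin_gset G U" and q: "q \<in> gmaps G W U"
    and C: "C \<in> carrier (over_semiring G U)" and w: "w \<in> carrier (mval M W)"
  shows "over_act M U C (mcov M W U q w) = mcov M W U q (over_act M W (over_pull G W q C) w)"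
proof -
  obtain X :: "('g, 'u) gset" and f where X: "fin_gset G X" and f: "f \<in> gmaps G X U" and C: "C = over_class G U X f"
    using C by (rule over_carrierE)
  obtain P :: "('g, 'u) gset" and g p where P: "fin_gset G P" and sq: "pullback_square G P W X U g p q f"
    using ex_pullback[OF W X q f] by blast
  have g: "g \<in> gmaps G P W" and p: "p \<in> gmaps G P X" using pullback_squareD(1,2)[OF sq] .
  note WX = fibre_prod_gset[OF W X gmapsD(4)[OF q] gmapsD(4)[OF f]]
  have "over_iso G P g (fibre_prod q f W X) fst"
    unfolding over_iso_gisos[OF P] using sq
    by (intro bexI[of _ "\<lambda>s \<in> pts P. (g s, p s)"]) (auto simp: pullback_square_def)
  then have "over_pull G W q C = over_class G W P g"
    unfolding C over_pull_class[OF X gmapsD(4)[OF f] W gmapsD(4)[OF q]]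
    by (rule over_class_eqI[OF P WX, symmetric])
  then have "mcov M W U q (over_act M W (over_pull G W q C) w) = mcov M W U q (mcov M P W g (mcon M P W g w))"
    by (simp add: over_act_class[OF W P g w])
  also have "\<dots> = mcov M P U (compose (pts P) q g) (mcon M P W g w)"
    by (rule cov_compose[OF P W U g q con_closed[OF P W g w], symmetric])
  also have "compose (pts P) q g = compose (pts P) f p"
    using pullback_squareD(5)[OF sq] by (auto simp: compose_def fun_eq_iff)
  also have "mcov M P U (compose (pts P) f p) (mcon M P W g w) = mcov M X U f (mcov M P X p (mcon M P W g w))"
    by (rule cov_compose[OF P X U p f con_closed[OF P W g w]])
  also have "mcov M P X p (mcon M P W g w) = mcon M X U f (mcov M W U q w)"
    by (rule pullback[OF P X W U pullback_square_sym[OF P sq] w, symmetric])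
  finally show ?thesis unfolding C by (simp add: over_act_class[OF U X f cov_closed[OF W U q w]])
qed

lemma burnside_act_cov:
  assumes W: "fin_gset G W" and U: "fin_gset G U" and q: "q \<in> gmaps G W U"
    and a: "a \<in> carrier (B U)" and w: "w \<in> carrier (mval M W)"
  shows "burnside_act M U a (mcov M W U q w) = mcov M W U q (burnside_act M W (mcon (burnside G) W U q a) w)"
proof -
  obtain C D where C: "C \<in> carrier (over_semiring G U)" "D \<in> carrier (over_semiring G U)"
    and a: "a = groth_diff (over_semiring G U) C D" using a by (rule B_carrierE)
  note C' = over_pull_carrier[OF W q C(1)] over_pull_carrier[OF W q C(2)]
  show ?thesis
    unfolding a B_pull_diff[OF W q C] burnside_act_diff[OF U C cov_closed[OF W U q w]] burnside_act_diff[OF W C' w]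
      over_act_cov[OF W U q C(1) w] over_act_cov[OF W U q C(2) w]
    by (rule cov_minus[OF W U q over_act_closed[OF W C'(1) w] over_act_closed[OF W C'(2) w], symmetric])
qed

section \<open>The Burnside quotient\<close>

lemma B_pull_closed:
  fixes U S :: "('g, 'u) gset"
  shows "\<lbrakk>fin_gset G U; \<psi> \<in> gmaps G U S; a \<in> carrier (B S)\<rbrakk> \<Longrightarrow> mcon (burnside G) U S \<psi> a \<in> carrier (B U)"
  using B_pull_hom[of U \<psi> S] by (auto simp: hom_def)

lemma B_push_closed:
  fixes S T :: "('g, 'u) gset"
  shows "\<lbrakk>\<phi> \<in> gmaps G S T; a \<in> carrier (B S)\<rbrakk> \<Longrightarrow> mcov (burnside G) S T \<phi> a \<in> carrier (B T)"
  using B_push_hom[of \<phi> S T] by (auto simp: hom_def)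

text \<open>The condition on \<open>\<phi>\<^sub>*(a)\<close> in the definition follows from the one on \<open>\<psi>\<^sup>*(a)\<close> for \<open>\<psi> = id\<close>, as
  \<open>\<phi>\<^sub>*(a)\<cdot>y = \<phi>\<^sub>*(a\<cdot>\<phi>\<^sup>*(y))\<close>.\<close>

lemma annihilator_iff:
  assumes S: "fin_gset G S"
  shows "a \<in> burnside_annihilator G M S \<longleftrightarrow> a \<in> carrier (B S) \<and>
    (\<forall>U \<psi> z. fin_gset G U \<and> \<psi> \<in> gmaps G U S \<and> z \<in> carrier (mval M U) \<longrightarrow>
        burnside_act M U (mcon (burnside G) U S \<psi> a) z = \<zero>\<^bsub>mval M U\<^esub>)" (is "_ \<longleftrightarrow> _ \<and> ?P")
proof -
  have "burnside_act M T (mcov (burnside G) S T \<phi> a) y = \<zero>\<^bsub>mval M T\<^esub>"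
    if a: "a \<in> carrier (B S)" and P: ?P and T: "fin_gset G T" and \<phi>: "\<phi> \<in> gmaps G S T"
      and y: "y \<in> carrier (mval M T)" for T \<phi> y
  proof -
    have "burnside_act M S (mcon (burnside G) S S (\<lambda>s \<in> pts S. s) a) (mcon M S T \<phi> y) = \<zero>\<^bsub>mval M S\<^esub>"
      using P S gmaps_id[OF S] con_closed[OF S T \<phi> y] by blast
    then show ?thesis
      by (simp add: burnside_act_push[OF S T \<phi> a y] B_pull_id[OF S a] cov_zero[OF S T \<phi>])
  qed
  then show ?thesis by (auto simp: burnside_annihilator_def burnside_simps(1))
qed

lemma annihilator_subgroup:
  assumes S: "fin_gset G S"
  shows "subgroup (burnside_annihilator G M S) (add_monoid (B S))"
proof -
  interpret BS: abelian_group "B S" by (rule B_abelian_group)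
  have hom: "abelian_group_hom (B S) (mval M U) (\<lambda>a. burnside_act M U (mcon (burnside G) U S \<psi> a) z)"
    if "fin_gset G U" "\<psi> \<in> gmaps G U S" "z \<in> carrier (mval M U)" for U \<psi> z
  proof -
    interpret h: abelian_group_hom "B U" "mval M U" "\<lambda>a. burnside_act M U a z"
      by (rule burnside_act_hom_left[OF that(1,3)])
    have "(\<lambda>a. burnside_act M U (mcon (burnside G) U S \<psi> a) z) \<in> hom (add_monoid (B S)) (add_monoid (mval M U))"
    proof (rule homI)
      fix a assume a: "a \<in> carrier (add_monoid (B S))"
      then show "burnside_act M U (mcon (burnside G) U S \<psi> a) z \<in> carrier (add_monoid (mval M U))"
        using h.hom_closed B_pull_closed[OF that(1,2)] by simp
      fix b assume b: "b \<in> carrier (add_monoid (B S))"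
      have "mcon (burnside G) U S \<psi> (a \<oplus>\<^bsub>B S\<^esub> b) = mcon (burnside G) U S \<psi> a \<oplus>\<^bsub>B U\<^esub> mcon (burnside G) U S \<psi> b"
        using B_pull_hom[OF that(1,2)] a b by (simp add: hom_def)
      then show "burnside_act M U (mcon (burnside G) U S \<psi> (a \<otimes>\<^bsub>add_monoid (B S)\<^esub> b)) z =
        burnside_act M U (mcon (burnside G) U S \<psi> a) z \<otimes>\<^bsub>add_monoid (mval M U)\<^esub>
        burnside_act M U (mcon (burnside G) U S \<psi> b) z"
        using h.hom_add[OF B_pull_closed[OF that(1,2)] B_pull_closed[OF that(1,2)]] a b by simp
    qed
    then show ?thesis using BS.a_group abelian_group.a_group[OF val_abelian[OF that(1)]]
      by (intro abelian_group_homI group_hom.intro group_hom_axioms.intro B_abelian_group val_abelian that)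
  qed
  show ?thesis
  proof (rule BS.a_group[THEN group.subgroupI])
    show "burnside_annihilator G M S \<subseteq> carrier (add_monoid (B S))" using annihilator_iff[OF S] by auto
    have "burnside_act M U (mcon (burnside G) U S \<psi> \<zero>\<^bsub>B S\<^esub>) z = \<zero>\<^bsub>mval M U\<^esub>"
      if "fin_gset G U" "\<psi> \<in> gmaps G U S" "z \<in> carrier (mval M U)" for U \<psi> z
      using abelian_group_hom.hom_zero[OF hom[OF that]] .
    then show "burnside_annihilator G M S \<noteq> {}" using annihilator_iff[OF S] BS.zero_closed by blast
    fix a assume a: "a \<in> burnside_annihilator G M S"
    then have ac: "a \<in> carrier (B S)" using annihilator_iff[OF S] by blast
    have "burnside_act M U (mcon (burnside G) U S \<psi> (\<ominus>\<^bsub>B S\<^esub> a)) z = \<zero>\<^bsub>mval M U\<^esub>"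
      if "fin_gset G U" "\<psi> \<in> gmaps G U S" "z \<in> carrier (mval M U)" for U \<psi> z
    proof -
      interpret V: abelian_group "mval M U" by (rule val_abelian[OF that(1)])
      show ?thesis using abelian_group_hom.hom_a_inv[OF hom[OF that] ac] a that annihilator_iff[OF S] by simp
    qed
    then have "\<ominus>\<^bsub>B S\<^esub> a \<in> burnside_annihilator G M S" using annihilator_iff[OF S] BS.a_inv_closed[OF ac] by blast
    then show "inv\<^bsub>add_monoid (B S)\<^esub> a \<in> burnside_annihilator G M S" by (simp add: a_inv_def)
    fix b assume b: "b \<in> burnside_annihilator G M S"
    then have bc: "b \<in> carrier (B S)" using annihilator_iff[OF S] by blast
    have "burnside_act M U (mcon (burnside G) U S \<psi> (a \<oplus>\<^bsub>B S\<^esub> b)) z = \<zero>\<^bsub>mval M U\<^esub>"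
      if "fin_gset G U" "\<psi> \<in> gmaps G U S" "z \<in> carrier (mval M U)" for U \<psi> z
    proof -
      interpret V: abelian_group "mval M U" by (rule val_abelian[OF that(1)])
      show ?thesis using abelian_group_hom.hom_add[OF hom[OF that] ac bc] a b that annihilator_iff[OF S] by simp
    qed
    then have "a \<oplus>\<^bsub>B S\<^esub> b \<in> burnside_annihilator G M S" using annihilator_iff[OF S] BS.a_closed[OF ac bc] by blast
    then show "a \<otimes>\<^bsub>add_monoid (B S)\<^esub> b \<in> burnside_annihilator G M S" by simp
  qed
qed

text \<open>By base change, a pullback of \<open>\<phi>\<^sub>*(a)\<close> is a pushforward of a pullback of \<open>a\<close>. This makes the
  covariant maps of the quotient well defined.\<close>

lemma push_annihilator:
  assumes S: "fin_gset G S" and T: "fin_gset G T" and \<phi>: "\<phi> \<in> gmaps G S T"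
    and a: "a \<in> burnside_annihilator G M S"
  shows "mcov (burnside G) S T \<phi> a \<in> burnside_annihilator G M T"
proof -
  have ac: "a \<in> carrier (B S)" using a annihilator_iff[OF S] by blast
  have "burnside_act M U (mcon (burnside G) U T \<psi> (mcov (burnside G) S T \<phi> a)) z = \<zero>\<^bsub>mval M U\<^esub>"
    if U: "fin_gset G U" and \<psi>: "\<psi> \<in> gmaps G U T" and z: "z \<in> carrier (mval M U)" for U \<psi> z
  proof -
    obtain W :: "('g, 'u) gset" and \<Psi> \<Phi> where W: "fin_gset G W" and sq: "pullback_square G W U S T \<Psi> \<Phi> \<psi> \<phi>"
      using ex_pullback[OF U S \<psi> \<phi>] by blast
    have \<Psi>: "\<Psi> \<in> gmaps G W U" and \<Phi>: "\<Phi> \<in> gmaps G W S" using pullback_squareD(1,2)[OF sq] .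
    have "burnside_act M W (mcon (burnside G) W S \<Phi> a) (mcon M W U \<Psi> z) = \<zero>\<^bsub>mval M W\<^esub>"
      using a W \<Phi> con_closed[OF W U \<Psi> z] annihilator_iff[OF S] by blast
    then show ?thesis
      by (simp add: B_pull_push[OF W U sq ac] burnside_act_push[OF W U \<Psi> B_pull_closed[OF W \<Phi> ac] z]
          cov_zero[OF W U \<Psi>])
  qed
  then show ?thesis using annihilator_iff[OF T] B_push_closed[OF \<phi> ac] by blast
qed

end

section \<open>Normal subgroups of $p$-power index\<close>

text \<open>A normal subgroup of \<open>p\<close>-power index, in terms of the operations of \<open>G\<close> and of orders: it can be
  restricted to subgroups and conjugated without changing the ambient group.\<close>

definition p_normal :: "('g, 'b) monoid_scheme \<Rightarrow> nat \<Rightarrow> 'g set \<Rightarrow> 'g set \<Rightarrow> bool" where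
  "p_normal G p N H \<longleftrightarrow> subgroup H G \<and> subgroup N G \<and> N \<subseteq> H \<and>
     (\<forall>h \<in> H. \<forall>n \<in> N. h \<otimes>\<^bsub>G\<^esub> n \<otimes>\<^bsub>G\<^esub> inv\<^bsub>G\<^esub> h \<in> N) \<and> (\<exists>k. card H = p ^ k * card N)"

lemma (in group) mult_inv_cancel:
  assumes "x \<in> carrier G" "y \<in> carrier G"
  shows "x \<otimes> (inv x \<otimes> y) = y" "inv x \<otimes> (x \<otimes> y) = y"
  using assms by (simp_all add: m_assoc[symmetric])

lemma (in group) conjugate_image:
  "conjugate G g H = (\<lambda>h. g \<otimes> h \<otimes> inv g) ` H"
  by (auto simp: conjugate_def l_coset_def r_coset_def)

context fin_group
begin

lemma fin_subgroup: "subgroup H G \<Longrightarrow> finite H"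
  using fin_carrier subgroup.subset finite_subset by blast

lemma card_subgroup_pos: "subgroup H G \<Longrightarrow> 0 < card H"
  using fin_subgroup subgroup.one_closed by (metis card_gt_0_iff empty_iff)

lemma card_subgroup_dvd:
  assumes "subgroup A G" "subgroup B G" "A \<subseteq> B"
  shows "card A dvd card B"
proof -
  interpret B: group "G\<lparr>carrier := B\<rparr>" by (rule subgroup_imp_group[OF assms(2)])
  have "subgroup A (G\<lparr>carrier := B\<rparr>)" by (rule subgroup_incl[OF assms])
  from B.lagrange[OF this] have "card (rcosets\<^bsub>G\<lparr>carrier := B\<rparr>\<^esub> A) * card A = card B"
    by (simp add: order_def)
  then show ?thesis by (metis dvd_triv_right)
qed

lemma p_normal_iff:
  assumes H: "subgroup H G"
  shows "N \<lhd> G\<lparr>carrier := H\<rparr> \<and> (\<exists>k. order (G\<lparr>carrier := H\<rparr> Mod N) = p ^ k) \<longleftrightarrow> p_normal G p N H"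
proof -
  interpret H: group "G\<lparr>carrier := H\<rparr>" by (rule subgroup_imp_group[OF H])
  have sub: "subgroup N (G\<lparr>carrier := H\<rparr>) \<longleftrightarrow> subgroup N G \<and> N \<subseteq> H"
    using incl_subgroup[OF H] subgroup_incl[OF _ H] subgroup.subset by fastforce
  have normal: "N \<lhd> G\<lparr>carrier := H\<rparr> \<longleftrightarrow> subgroup N G \<and> N \<subseteq> H \<and> (\<forall>h \<in> H. \<forall>n \<in> N. h \<otimes> n \<otimes> inv h \<in> N)"
    unfolding H.normal_inv_iff sub using m_inv_consistent[OF H] by auto
  have "order (G\<lparr>carrier := H\<rparr> Mod N) = p ^ k \<longleftrightarrow> card H = p ^ k * card N" if "subgroup N G" "N \<subseteq> H" for k
  proof -
    have "order (G\<lparr>carrier := H\<rparr> Mod N) * card N = card H"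
      using H.lagrange[of N] sub that by (simp add: order_def FactGroup_def)
    then show ?thesis using card_subgroup_pos[OF that(1)] by (metis mult_cancel2 less_numeral_extra(3))
  qed
  then show ?thesis using normal H unfolding p_normal_def by blast
qed

lemma set_mult_subgroup:
  assumes K: "subgroup K G" and N: "subgroup N G"
    and norm: "\<And>k n. \<lbrakk>k \<in> K; n \<in> N\<rbrakk> \<Longrightarrow> k \<otimes> n \<otimes> inv k \<in> N"
  shows "subgroup (K <#> N) G"
proof -
  note c = subgroup.mem_carrier[OF K] subgroup.mem_carrier[OF N]
  show ?thesis
  proof (rule subgroupI)
    show "K <#> N \<subseteq> carrier G" by (auto simp: set_mult_def c)
    show "K <#> N \<noteq> {}" using subgroup.one_closed[OF K] subgroup.one_closed[OF N] by (auto simp: set_mult_def)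
    fix a assume "a \<in> K <#> N"
    then obtain k n where a: "a = k \<otimes> n" "k \<in> K" "n \<in> N" by (auto simp: set_mult_def)
    have k': "inv k \<in> K" using subgroup.m_inv_closed[OF K] a by blast
    have "inv a = inv k \<otimes> (k \<otimes> inv n \<otimes> inv k)"
      using a c by (simp add: inv_mult_group m_assoc mult_inv_cancel)
    moreover have "k \<otimes> inv n \<otimes> inv k \<in> N" using norm a subgroup.m_inv_closed[OF N] by blast
    ultimately show "inv a \<in> K <#> N" using k' by (auto simp: set_mult_def)
    fix b assume "b \<in> K <#> N"
    then obtain l m where b: "b = l \<otimes> m" "l \<in> K" "m \<in> N" by (auto simp: set_mult_def)
    have l': "inv l \<in> K" using subgroup.m_inv_closed[OF K] b by blast
    have "inv l \<otimes> n \<otimes> inv (inv l) \<in> N" using norm[OF l' a(3)] .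
    then have "inv l \<otimes> n \<otimes> l \<in> N" using b c by simp
    then have "inv l \<otimes> n \<otimes> l \<otimes> m \<in> N" using b(3) subgroup.m_closed[OF N] by blast
    moreover have "k \<otimes> l \<in> K" using a b subgroup.m_closed[OF K] by blast
    moreover have "a \<otimes> b = (k \<otimes> l) \<otimes> (inv l \<otimes> n \<otimes> l \<otimes> m)"
      using a b c by (simp add: m_assoc mult_inv_cancel)
    ultimately show "a \<otimes> b \<in> K <#> N" by (auto simp: set_mult_def)
  qed
qed

text \<open>The fibre of the product map over \<open>h n\<close> consists of the pairs \<open>(h d, inv d n)\<close> with \<open>d\<close> in the
  intersection.\<close>

lemma card_set_mult:
  assumes H: "subgroup H G" and N: "subgroup N G"
  shows "card (H <#> N) * card (H \<inter> N) = card H * card N"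
proof -
  note c = subgroup.mem_carrier[OF H] subgroup.mem_carrier[OF N]
  have fin: "finite H" "finite N" using fin_subgroup H N by auto
  let ?m = "\<lambda>z. fst z \<otimes> snd z"
  have img: "?m ` (H \<times> N) = H <#> N" by (force simp: set_mult_def)
  have fibre: "card {z \<in> H \<times> N. ?m z = y} = card (H \<inter> N)" if "y \<in> H <#> N" for y
  proof -
    obtain h n where y: "y = h \<otimes> n" "h \<in> H" "n \<in> N"
      using \<open>y \<in> H <#> N\<close> by (auto simp: set_mult_def)
    have "bij_betw (\<lambda>d. (h \<otimes> d, inv d \<otimes> n)) (H \<inter> N) {z \<in> H \<times> N. ?m z = y}"
    proof (rule bij_betw_byWitness[of _ "\<lambda>z. inv h \<otimes> fst z"])
      show "\<forall>d \<in> H \<inter> N. inv h \<otimes> fst (h \<otimes> d, inv d \<otimes> n) = d"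
        using y c by (simp add: mult_inv_cancel)
      show "(\<lambda>d. (h \<otimes> d, inv d \<otimes> n)) ` (H \<inter> N) \<subseteq> {z \<in> H \<times> N. ?m z = y}"
      proof clarsimp
        fix d assume d: "d \<in> H" "d \<in> N"
        have "h \<otimes> d \<otimes> (inv d \<otimes> n) = y" using d y c by (simp add: m_assoc mult_inv_cancel)
        then show "h \<otimes> d \<in> H \<and> inv d \<otimes> n \<in> N \<and> h \<otimes> d \<otimes> (inv d \<otimes> n) = y"
          using d y c subgroup.m_closed[OF H] subgroup.m_closed[OF N] subgroup.m_inv_closed[OF N] by simp
      qed
      have key: "inv h \<otimes> h' \<in> H \<inter> N \<and> h \<otimes> (inv h \<otimes> h') = h' \<and> inv (inv h \<otimes> h') \<otimes> n = n'"
        if h': "h' \<in> H" "n' \<in> N" "h' \<otimes> n' = y" for h' n'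
      proof -
        have 1: "inv h \<otimes> h' \<in> H" using h' y subgroup.m_closed[OF H] subgroup.m_inv_closed[OF H] by blast
        have 2: "h \<otimes> (inv h \<otimes> h') = h'" using h' y c by (simp add: mult_inv_cancel)
        have "h \<otimes> n = h' \<otimes> n'" using h' y by simp
        then have "n = inv h \<otimes> (h' \<otimes> n')" using inv_solve_left[of n h "h' \<otimes> n'"] h' y c by auto
        then have n: "n = inv h \<otimes> h' \<otimes> n'" using h' y c by (simp add: m_assoc)
        note e = c(1)[OF 1] c(2)[OF h'(2)]
        have "n \<otimes> inv n' = inv h \<otimes> h'" unfolding n by (simp only: m_assoc[OF e inv_closed[OF e(2)]] r_inv[OF e(2)] r_one[OF e(1)])
        then have 3: "inv h \<otimes> h' \<in> N"
          using subgroup.m_closed[OF N y(3) subgroup.m_inv_closed[OF N h'(2)]] by simp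
        have "inv (inv h \<otimes> h') \<otimes> n = n'" unfolding n by (rule mult_inv_cancel(2)[OF e])
        then show ?thesis using 1 2 3 by simp
      qed
      show "\<forall>z \<in> {z \<in> H \<times> N. ?m z = y}. (h \<otimes> (inv h \<otimes> fst z), inv (inv h \<otimes> fst z) \<otimes> n) = z"
        using key by auto
      show "(\<lambda>z. inv h \<otimes> fst z) ` {z \<in> H \<times> N. ?m z = y} \<subseteq> H \<inter> N" using key by auto
    qed
    then show ?thesis by (simp add: bij_betw_same_card)
  qed
  have "card (H \<times> N) = (\<Sum>y \<in> ?m ` (H \<times> N). card {z \<in> H \<times> N. ?m z = y})"
    using sum.image_gen[of "H \<times> N" "\<lambda>_. 1::nat" ?m] fin by simp
  also have "\<dots> = (\<Sum>y \<in> H <#> N. card (H \<inter> N))" unfolding img by (rule sum.cong[OF refl fibre])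
  finally show ?thesis by (simp add: card_cartesian_product)
qed

end

definition fixed_points :: "('g, 'a) gset \<Rightarrow> 'g set \<Rightarrow> 'a set" where
  "fixed_points X K = {x \<in> pts X. \<forall>k \<in> K. act X k x = x}"

definition coset_gset :: "('g, 'b) monoid_scheme \<Rightarrow> 'g set \<Rightarrow> ('g, 'g set) gset" where
  "coset_gset G L = \<lparr>pts = lcosets\<^bsub>G\<^esub> L, act = (\<lambda>g. \<lambda>C \<in> lcosets\<^bsub>G\<^esub> L. g <#\<^bsub>G\<^esub> C)\<rparr>"

context fin_group
begin

lemma p_normalD:
  assumes "p_normal G p N H"
  shows "subgroup H G" "subgroup N G" "N \<subseteq> H" "\<lbrakk>h \<in> H; n \<in> N\<rbrakk> \<Longrightarrow> h \<otimes> n \<otimes> inv h \<in> N"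
    "\<exists>k. card H = p ^ k * card N"
  using assms by (auto simp: p_normal_def)

lemma p_normal_refl: "subgroup H G \<Longrightarrow> p_normal G p H H"
  unfolding p_normal_def
  by (auto intro!: exI[of _ 0] subgroup.m_closed subgroup.m_inv_closed)

text \<open>The second isomorphism theorem on the level of orders: the index of \<open>N \<inter> K\<close> in \<open>K\<close> is that of \<open>N\<close>
  in \<open>K N\<close>, which divides that of \<open>N\<close> in \<open>H\<close>.\<close>

lemma p_normal_restrict:
  assumes p: "prime p" and N: "p_normal G p N H" and K: "subgroup K G" "K \<subseteq> H"
  shows "p_normal G p (N \<inter> K) K"
proof -
  note H = p_normalD(1)[OF N] and Ns = p_normalD(2,3)[OF N]
  let ?P = "K <#> N"
  have P: "subgroup ?P G"
    by (rule set_mult_subgroup[OF K(1) Ns(1)]) (use p_normalD(4)[OF N] K(2) in blast)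
  have "N \<subseteq> ?P"
  proof
    fix n assume "n \<in> N"
    then have "n = \<one> \<otimes> n" using subgroup.mem_carrier[OF Ns(1)] by simp
    then show "n \<in> ?P" using subgroup.one_closed[OF K(1)] \<open>n \<in> N\<close> unfolding set_mult_def by blast
  qed
  then obtain j where j: "card ?P = card N * j" using card_subgroup_dvd[OF Ns(1) P] by (auto elim: dvdE)
  have "?P \<subseteq> H" using K(2) Ns(2) subgroup.m_closed[OF H] by (auto simp: set_mult_def)
  then obtain i where i: "card H = card ?P * i" using card_subgroup_dvd[OF P H] by (auto elim: dvdE)
  obtain k where k: "card H = p ^ k * card N" using p_normalD(5)[OF N] by blast
  have "j * i = p ^ k" using i j k card_subgroup_pos[OF Ns(1)] by (simp add: mult.assoc mult.commute)
  then have "j dvd p ^ k" by (metis dvd_triv_left)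
  then obtain m where m: "j = p ^ m" using divides_primepow_nat[OF p] by blast
  have "card N * j * card (K \<inter> N) = card K * card N" using card_set_mult[OF K(1) Ns(1)] j by simp
  then have "card K = p ^ m * card (N \<inter> K)"
    using card_subgroup_pos[OF Ns(1)] m by (simp add: Int_commute mult.commute mult.left_commute)
  moreover have "subgroup (N \<inter> K) G" by (rule subgroups_Inter_pair[OF Ns(1) K(1)])
  moreover have "h \<otimes> n \<otimes> inv h \<in> N \<inter> K" if "h \<in> K" "n \<in> N \<inter> K" for h n
  proof
    show "h \<otimes> n \<otimes> inv h \<in> N" using p_normalD(4)[OF N] K(2) that by blast
    have "h \<otimes> n \<in> K" using that by (intro subgroup.m_closed[OF K(1)]) auto
    then show "h \<otimes> n \<otimes> inv h \<in> K"
      by (rule subgroup.m_closed[OF K(1) _ subgroup.m_inv_closed[OF K(1) that(1)]])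
  qed
  ultimately show ?thesis unfolding p_normal_def using K(1) by blast
qed

lemma p_normal_Int:
  assumes p: "prime p" and N: "p_normal G p N H" "p_normal G p N' H"
  shows "p_normal G p (N \<inter> N') H"
proof -
  have r: "p_normal G p (N \<inter> N') N'"
    by (rule p_normal_restrict[OF p N(1) p_normalD(2,3)[OF N(2)]])
  obtain k l where "card H = p ^ k * card N'" "card N' = p ^ l * card (N \<inter> N')"
    using p_normalD(5)[OF N(2)] p_normalD(5)[OF r] by blast
  then have "card H = p ^ (k + l) * card (N \<inter> N')" by (simp add: power_add)
  then show ?thesis unfolding p_normal_def
    using p_normalD(1-4)[OF N(1)] p_normalD(2-4)[OF N(2)] p_normalD(2)[OF r] by blast
qed

lemma p_residual_eq: "subgroup H G \<Longrightarrow> p_residual G p H = \<Inter> {N. p_normal G p N H}"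
  unfolding p_residual_def p_normal_iff ..

text \<open>The intersection that defines \<open>O\<^sup>p(H)\<close> is finite, and normal subgroups of \<open>p\<close>-power index are closed
  under finite intersections.\<close>

lemma p_normal_p_residual:
  assumes p: "prime p" and H: "subgroup H G"
  shows "p_normal G p (p_residual G p H) H"
proof -
  have "p_normal G p (\<Inter> \<N>) H" if "finite \<N>" "\<N> \<noteq> {}" "\<forall>N \<in> \<N>. p_normal G p N H" for \<N>
    using that by (induct rule: finite_ne_induct) (auto intro: p_normal_Int[OF p])
  moreover have "finite {N. p_normal G p N H}"
    by (rule finite_subset[of _ "Pow H"]) (use fin_subgroup[OF H] p_normalD(3) in auto)
  ultimately show ?thesis unfolding p_residual_eq[OF H] using p_normal_refl[OF H] by blast
qed

lemma p_residual_subset: "p_normal G p N H \<Longrightarrow> p_residual G p H \<subseteq> N"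
  using p_residual_eq[OF p_normalD(1)] by blast

lemma p_residual_mono:
  assumes p: "prime p" and "subgroup H G" "subgroup K G" "K \<subseteq> H"
  shows "p_residual G p K \<subseteq> p_residual G p H"
  using p_residual_subset[OF p_normal_restrict[OF p p_normal_p_residual[OF p assms(2)] assms(3,4)]] by blast

lemma conjugate_comp:
  assumes "a \<in> carrier G" "b \<in> carrier G" "H \<subseteq> carrier G"
  shows "conjugate G a (conjugate G b H) = conjugate G (a \<otimes> b) H"
  unfolding conjugate_image image_image
  using assms by (intro image_cong) (auto simp: inv_mult_group m_assoc subsetD)

lemma conjugate_one: "H \<subseteq> carrier G \<Longrightarrow> conjugate G \<one> H = H"
  unfolding conjugate_image by (force simp: subsetD)

lemma conjugate_inv:
  assumes "a \<in> carrier G" "H \<subseteq> carrier G"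
  shows "conjugate G (inv a) (conjugate G a H) = H" "conjugate G a (conjugate G (inv a) H) = H"
  using assms by (simp_all add: conjugate_comp conjugate_one)

lemma conjugate_inj: "a \<in> carrier G \<Longrightarrow> H \<subseteq> carrier G \<Longrightarrow> inj_on (\<lambda>h. a \<otimes> h \<otimes> inv a) H"
  by (rule inj_onI) (simp add: subsetD)

lemma conjugate_subgroup:
  assumes a: "a \<in> carrier G" and H: "subgroup H G"
  shows "subgroup (conjugate G a H) G"
proof -
  note c = subgroup.mem_carrier[OF H]
  have m: "(a \<otimes> x \<otimes> inv a) \<otimes> (a \<otimes> y \<otimes> inv a) = a \<otimes> (x \<otimes> y) \<otimes> inv a" if "x \<in> H" "y \<in> H" for x y
    using a c that by (simp add: m_assoc mult_inv_cancel)
  have i: "inv (a \<otimes> x \<otimes> inv a) = a \<otimes> inv x \<otimes> inv a" if "x \<in> H" for x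
    using a c that by (simp add: inv_mult_group m_assoc)
  show ?thesis unfolding conjugate_image
  proof (rule subgroupI)
    show "(\<lambda>h. a \<otimes> h \<otimes> inv a) ` H \<subseteq> carrier G" using a c by auto
    show "(\<lambda>h. a \<otimes> h \<otimes> inv a) ` H \<noteq> {}" using subgroup.one_closed[OF H] by blast
    fix u assume "u \<in> (\<lambda>h. a \<otimes> h \<otimes> inv a) ` H"
    then obtain x where x: "x \<in> H" "u = a \<otimes> x \<otimes> inv a" by blast
    show "inv u \<in> (\<lambda>h. a \<otimes> h \<otimes> inv a) ` H"
      unfolding x(2) i[OF x(1)] using subgroup.m_inv_closed[OF H x(1)] by blast
    fix v assume "v \<in> (\<lambda>h. a \<otimes> h \<otimes> inv a) ` H"
    then obtain y where y: "y \<in> H" "v = a \<otimes> y \<otimes> inv a" by blast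
    show "u \<otimes> v \<in> (\<lambda>h. a \<otimes> h \<otimes> inv a) ` H"
      unfolding x(2) y(2) m[OF x(1) y(1)] using subgroup.m_closed[OF H x(1) y(1)] by blast
  qed
qed

lemma card_conjugate: "a \<in> carrier G \<Longrightarrow> H \<subseteq> carrier G \<Longrightarrow> card (conjugate G a H) = card H"
  unfolding conjugate_image by (rule card_image[OF conjugate_inj])

lemma p_normal_conjugate:
  assumes a: "a \<in> carrier G" and N: "p_normal G p N H"
  shows "p_normal G p (conjugate G a N) (conjugate G a H)"
proof -
  note H = p_normalD(1)[OF N] and Ns = p_normalD(2)[OF N]
  have "conjugate G a N \<subseteq> conjugate G a H" unfolding conjugate_image using p_normalD(3)[OF N] by blast
  moreover have "x \<otimes> y \<otimes> inv x \<in> conjugate G a N" if xy: "x \<in> conjugate G a H" "y \<in> conjugate G a N" for x y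
  proof -
    obtain h n where hn: "h \<in> H" "n \<in> N" "x = a \<otimes> h \<otimes> inv a" "y = a \<otimes> n \<otimes> inv a"
      using xy by (auto simp: conjugate_image)
    have "x \<otimes> y \<otimes> inv x = a \<otimes> (h \<otimes> n \<otimes> inv h) \<otimes> inv a"
      unfolding hn(3,4) using a subgroup.mem_carrier[OF H hn(1)] subgroup.mem_carrier[OF Ns hn(2)]
      by (simp add: inv_mult_group m_assoc mult_inv_cancel)
    then show ?thesis using p_normalD(4)[OF N hn(1,2)] by (auto simp: conjugate_image)
  qed
  ultimately show ?thesis
    unfolding p_normal_def using conjugate_subgroup[OF a H] conjugate_subgroup[OF a Ns] p_normalD(5)[OF N]
      card_conjugate[OF a subgroup.subset[OF H]] card_conjugate[OF a subgroup.subset[OF Ns]] by simp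
qed

lemma hyper_family_family:
  assumes p: "prime p" and F: "subgroup_family G \<F>"
  shows "subgroup_family G (hyper_family G p \<F>)"
proof -
  have res: "subgroup (p_residual G p H) G" if "subgroup H G" for H
    using p_normalD(2)[OF p_normal_p_residual[OF p that]] .
  have down: "K \<in> \<F>" if "H \<in> \<F>" "subgroup K G" "K \<subseteq> H" for H K
    using F that unfolding subgroup_family_def by blast
  have conj: "conjugate G g H \<in> \<F>" if "H \<in> \<F>" "g \<in> carrier G" for H g
    using F that unfolding subgroup_family_def by blast
  show ?thesis unfolding subgroup_family_def
  proof (intro conjI ballI allI impI)
    fix H assume H: "H \<in> hyper_family G p \<F>"
    then show Hs: "subgroup H G" by (simp add: hyper_family_def)
    have HF: "p_residual G p H \<in> \<F>" using H by (simp add: hyper_family_def)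
    fix g assume g: "g \<in> carrier G"
    have "p_residual G p (conjugate G g H) \<subseteq> conjugate G g (p_residual G p H)"
      by (rule p_residual_subset[OF p_normal_conjugate[OF g p_normal_p_residual[OF p Hs]]])
    then have "p_residual G p (conjugate G g H) \<in> \<F>"
      using down[OF conj[OF HF g]] res[OF conjugate_subgroup[OF g Hs]] by blast
    then show "conjugate G g H \<in> hyper_family G p \<F>"
      using conjugate_subgroup[OF g Hs] by (simp add: hyper_family_def)
  next
    fix H K assume H: "H \<in> hyper_family G p \<F>" and K: "subgroup K G \<and> K \<subseteq> H"
    then have "p_residual G p K \<subseteq> p_residual G p H"
      using p_residual_mono[OF p] by (simp add: hyper_family_def)
    then show "K \<in> hyper_family G p \<F>"
      using down H K res by (auto simp: hyper_family_def)
  qed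
qed

text \<open>The family of all subgroups is among those that are intersected, so that the
  intersection consists of subgroups.\<close>

lemma isotropy_family_family:
  assumes "fin_gset G X"
  shows "subgroup_family G (isotropy_family G X)"
proof -
  let ?C = "{\<F>. subgroup_family G \<F> \<and> (\<forall>x \<in> pts X. stabilizer G (act X) x \<in> \<F>)}"
  have top: "{H. subgroup H G} \<in> ?C"
    using stabilizer_is_subgroup[OF assms] conjugate_subgroup by (auto simp: subgroup_family_def)
  show ?thesis unfolding isotropy_family_def
    unfolding subgroup_family_def[of G "\<Inter> ?C"]
  proof (intro conjI ballI allI impI)
    fix H assume H: "H \<in> \<Inter> ?C"
    show "subgroup H G" using H top by blast
    fix g assume g: "g \<in> carrier G"
    show "conjugate G g H \<in> \<Inter> ?C"
    proof
      fix F assume F: "F \<in> ?C"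
      then have "H \<in> F" "subgroup_family G F" using H by blast+
      then show "conjugate G g H \<in> F" using g unfolding subgroup_family_def by blast
    qed
  next
    fix H K assume H: "H \<in> \<Inter> ?C" and K: "subgroup K G \<and> K \<subseteq> H"
    show "K \<in> \<Inter> ?C"
    proof
      fix F assume F: "F \<in> ?C"
      then have "H \<in> F" "subgroup_family G F" using H by blast+
      then show "K \<in> F" using K unfolding subgroup_family_def by blast
    qed
  qed
qed

lemma fixed_points_mono: "N \<subseteq> K \<Longrightarrow> fixed_points X K \<subseteq> fixed_points X N"
  by (auto simp: fixed_points_def)

text \<open>The \<open>p\<close>-group \<open>K/N\<close> acts on the points fixed by \<open>N\<close>. An orbit has \<open>p\<close>-power length, and those of
  length \<open>1\<close> are the points fixed by \<open>K\<close>.\<close>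

lemma fixed_points_cong_p:
  assumes p: "prime p" and N: "p_normal G p N K" and X: "fin_gset G X"
    and dvd: "p dvd card (fixed_points X K)"
  shows "p dvd card (fixed_points X N)"
proof -
  note K = p_normalD(1)[OF N] and Ns = p_normalD(2,3)[OF N]
  note Kc = subgroup.mem_carrier[OF K]
  let ?K = "G\<lparr>carrier := K\<rparr>"
  interpret K: group ?K by (rule subgroup_imp_group[OF K])
  have XK: "fin_gset ?K X"
    by (rule K.fin_gsetI)
      (auto simp: gset_finite[OF X] act_ext[OF X Kc] act_closed[OF X Kc] act_one[OF X] act_mult[OF X Kc Kc])
  then interpret A: group_action ?K "pts X" "act X" by (simp add: fin_gset_def)
  let ?D = "fixed_points X N - fixed_points X K" and ?O = "orbit ?K (act X)"
  have inv: "act X k x \<in> ?D" if x: "x \<in> ?D" and k: "k \<in> K" for x k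
  proof -
    have xX: "x \<in> pts X" and xN: "\<And>n. n \<in> N \<Longrightarrow> act X n x = x" using x by (auto simp: fixed_points_def)
    have "act X n (act X k x) = act X k x" if n: "n \<in> N" for n
    proof -
      have n': "inv k \<otimes> n \<otimes> k \<in> N"
        using p_normalD(4)[OF N subgroup.m_inv_closed[OF K k] n] Kc[OF k] by simp
      have nc: "n \<in> carrier G" using subgroup.mem_carrier[OF Ns(1) n] .
      have "act X n (act X k x) = act X (k \<otimes> (inv k \<otimes> n \<otimes> k)) x"
        using act_mult[OF X nc Kc[OF k] xX] Kc[OF k] nc by (simp add: m_assoc mult_inv_cancel)
      also have "\<dots> = act X k x"
        using act_mult[OF X Kc[OF k] subgroup.mem_carrier[OF Ns(1) n'] xX] xN[OF n'] by simp
      finally show ?thesis .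
    qed
    moreover have "act X k x \<notin> fixed_points X K"
    proof
      assume "act X k x \<in> fixed_points X K"
      then have fix': "act X l (act X k x) = act X k x" if "l \<in> K" for l using that by (simp add: fixed_points_def)
      have kx: "act X k x = x"
        using fix'[OF subgroup.m_inv_closed[OF K k]] act_inv[OF X Kc[OF k] xX] by simp
      then have "x \<in> fixed_points X K" using fix' xX by (simp add: fixed_points_def)
      then show False using x by blast
    qed
    ultimately show ?thesis using act_closed[OF X Kc[OF k] xX] by (simp add: fixed_points_def)
  qed
  have finD: "finite ?D" using gset_finite[OF X] by (simp add: fixed_points_def)
  have DX: "x \<in> pts X" if "x \<in> ?D" for x using that by (simp add: fixed_points_def)
  have UD: "\<Union> (?O ` ?D) = ?D"
  proof (intro equalityI subsetI)
    fix y assume "y \<in> \<Union> (?O ` ?D)"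
    then show "y \<in> ?D" using inv by (auto simp: orbit_def simp del: Diff_iff)
  next
    fix y assume "y \<in> ?D"
    then show "y \<in> \<Union> (?O ` ?D)" using A.orbit_refl[OF DX] by blast
  qed
  have "p dvd card (\<Union> (?O ` ?D))"
  proof (rule dvd_partition)
    show "finite (\<Union> (?O ` ?D))" unfolding UD by (rule finD)
    show "\<forall>c1 \<in> ?O ` ?D. \<forall>c2 \<in> ?O ` ?D. c1 \<noteq> c2 \<longrightarrow> c1 \<inter> c2 = {}"
    proof (intro ballI impI)
      fix c1 c2 assume c: "c1 \<in> ?O ` ?D" "c2 \<in> ?O ` ?D" and "c1 \<noteq> c2"
      then have "c1 \<in> orbits ?K (pts X) (act X)" "c2 \<in> orbits ?K (pts X) (act X)"
        using DX by (auto simp: orbits_def)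
      then show "c1 \<inter> c2 = {}" using A.disjoint_union[of c1 c2] \<open>c1 \<noteq> c2\<close> by blast
    qed
    show "\<forall>c \<in> ?O ` ?D. p dvd card c"
    proof
      fix c assume "c \<in> ?O ` ?D"
      then obtain x where x: "x \<in> ?D" "c = ?O x" by blast
      let ?S = "stabilizer ?K (act X) x"
      have S: "subgroup ?S G" by (rule incl_subgroup[OF K A.stabilizer_subgroup[OF DX[OF x(1)]]])
      have "N \<subseteq> ?S" using x Ns(2) by (auto simp: stabilizer_def fixed_points_def)
      then obtain j where j: "card ?S = card N * j" using card_subgroup_dvd[OF Ns(1) S] by (auto elim: dvdE)
      obtain k where k: "card K = p ^ k * card N" using p_normalD(5)[OF N] by blast
      have "card (?O x) * card ?S = card K"
        using A.orbit_stabilizer_theorem[OF DX[OF x(1)]] by (simp add: order_def)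
      then have "card (?O x) * j = p ^ k" using j k card_subgroup_pos[OF Ns(1)] by simp
      then have "card (?O x) dvd p ^ k" by (metis dvd_triv_left)
      then obtain m where m: "card (?O x) = p ^ m" using divides_primepow_nat[OF p] by blast
      have "m \<noteq> 0"
      proof
        assume "m = 0"
        then obtain y where y: "?O x = {y}" using m card_1_singletonE by auto
        have "act X k x = x" if "k \<in> K" for k
        proof -
          have "act X k x \<in> ?O x" "x \<in> ?O x" using that A.orbit_refl[OF DX[OF x(1)]] by (auto simp: orbit_def)
          then show ?thesis using y by simp
        qed
        then show False using x DX[OF x(1)] by (auto simp: fixed_points_def)
      qed
      then show "p dvd card c" using m x by (simp add: dvd_power)
    qed
  qed
  then have "p dvd card ?D" unfolding UD .
  moreover have "card (fixed_points X N) = card ?D + card (fixed_points X K)"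
    using fixed_points_mono[OF Ns(2), of X] gset_finite[OF X]
    by (metis (no_types, lifting) card_Diff_subset card_mono finite_subset fixed_points_def le_add_diff_inverse2 mem_Collect_eq subsetI)
  ultimately show ?thesis using dvd by simp
qed

section \<open>Orbits with a number of fixed points prime to $p$\<close>

lemma lcos_eq_iff:
  assumes L: "subgroup L G" and a: "a \<in> carrier G" "b \<in> carrier G"
  shows "a <# L = b <# L \<longleftrightarrow> inv b \<otimes> a \<in> L"
proof
  assume "a <# L = b <# L"
  then have "a \<in> b <# L" using lcos_self[OF a(1) L] by simp
  then show "inv b \<otimes> a \<in> L" by (rule subgroup.lcos_module_imp[OF L is_group a(2)])
next
  assume "inv b \<otimes> a \<in> L"
  moreover have "a = b \<otimes> (inv b \<otimes> a)" using a by (simp add: mult_inv_cancel)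
  ultimately have "a \<in> b <# L" unfolding l_coset_def by blast
  then show "a <# L = b <# L" using l_repr_independence[OF _ a(2) L] by simp
qed

lemma coset_gset_pts: "pts (coset_gset G L) = (\<lambda>a. a <# L) ` carrier G"
  by (auto simp: coset_gset_def LCOSETS_def)

lemma coset_gset_act:
  assumes "subgroup L G" "g \<in> carrier G" "a \<in> carrier G"
  shows "act (coset_gset G L) g (a <# L) = (g \<otimes> a) <# L"
  using assms lcos_m_assoc[OF subgroup.subset[OF assms(1)] assms(2,3)]
  by (auto simp: coset_gset_def LCOSETS_def)

lemma coset_gset_gset:
  assumes L: "subgroup L G"
  shows "fin_gset G (coset_gset G L)"
proof (rule fin_gsetI)
  show "finite (pts (coset_gset G L))" unfolding coset_gset_pts using fin_carrier by simp
  show "act (coset_gset G L) g \<in> extensional (pts (coset_gset G L))" for g by (simp add: coset_gset_def)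
qed (auto simp: coset_gset_pts coset_gset_act[OF L] m_assoc)

lemma fixed_points_coset:
  assumes L: "subgroup L G" and K: "K \<subseteq> carrier G"
  shows "fixed_points (coset_gset G L) K = (\<lambda>a. a <# L) ` {a \<in> carrier G. \<forall>k \<in> K. inv a \<otimes> k \<otimes> a \<in> L}"
proof -
  have "(\<forall>k \<in> K. act (coset_gset G L) k (a <# L) = a <# L) \<longleftrightarrow> (\<forall>k \<in> K. inv a \<otimes> k \<otimes> a \<in> L)"
    if a: "a \<in> carrier G" for a
    using a K by (intro ball_cong refl) (simp add: coset_gset_act[OF L] lcos_eq_iff[OF L] m_assoc subsetD)
  then show ?thesis unfolding fixed_points_def coset_gset_pts by auto
qed

lemma card_lcosets:
  assumes L: "subgroup L G" and N: "subgroup N G" "L \<subseteq> N"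
  shows "card ((\<lambda>a. a <# L) ` N) * card L = card N"
proof -
  interpret N: group "G\<lparr>carrier := N\<rparr>" by (rule subgroup_imp_group[OF N(1)])
  have "lcosets\<^bsub>G\<lparr>carrier := N\<rparr>\<^esub> L = (\<lambda>a. a <# L) ` N" by (auto simp: LCOSETS_def l_coset_def)
  then show ?thesis
    using N.l_lagrange[OF _ subgroup_incl[OF L N]] fin_subgroup[OF N(1)] by (simp add: order_def)
qed

text \<open>The subgroup \<open>L\<close> is the product of \<open>K\<close> and a Sylow \<open>p\<close>-subgroup of its normalizer \<open>N\<close>, so that
  \<open>L/K\<close> is a \<open>p\<close>-group and the index of \<open>L\<close> in \<open>N\<close> is prime to \<open>p\<close>. A conjugate of \<open>K\<close> inside \<open>L\<close> has no
  nontrivial \<open>p\<close>-quotient, and therefore lies in \<open>K\<close>. Hence the cosets fixed by \<open>K\<close> are those of \<open>L\<close> in \<open>N\<close>.\<close>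

lemma ex_fixed_coset_p_perfect:
  assumes p: "prime p" and K: "subgroup K G" and perfect: "\<And>N. p_normal G p N K \<Longrightarrow> N = K"
  shows "\<exists>L. p_normal G p K L \<and> \<not> p dvd card (fixed_points (coset_gset G L) K)"
proof -
  note Kc = subgroup.subset[OF K] and Kfin = fin_subgroup[OF K]
  define N where "N = {a \<in> carrier G. conjugate G a K = K}"
  have N_iff: "a \<in> N \<longleftrightarrow> a \<in> carrier G \<and> conjugate G a K = K" for a by (simp add: N_def)
  have N: "subgroup N G"
  proof (rule subgroupI)
    show "N \<noteq> {}" using conjugate_one[OF Kc] N_iff by blast
    fix a assume a: "a \<in> N"
    then show "inv a \<in> N" using conjugate_inv(1)[of a K] Kc by (simp add: N_iff)
    fix b assume "b \<in> N"
    then show "a \<otimes> b \<in> N" using a conjugate_comp[of a b K] Kc by (simp add: N_iff)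
  qed (simp add: N_def)
  have norm: "a \<otimes> k \<otimes> inv a \<in> K" if "a \<in> N" "k \<in> K" for a k
    using that unfolding N_iff conjugate_image by blast
  have KN: "K \<subseteq> N"
  proof
    fix k assume k: "k \<in> K"
    have "conjugate G k K \<subseteq> K"
      using k subgroup.m_closed[OF K] subgroup.m_inv_closed[OF K] by (auto simp: conjugate_image)
    then have "conjugate G k K = K"
      using card_conjugate[OF _ Kc, of k] k Kc Kfin by (metis card_subset_eq subsetD)
    then show "k \<in> N" using k Kc N_iff by blast
  qed
  interpret NG: group "G\<lparr>carrier := N\<rparr>" by (rule subgroup_imp_group[OF N])
  define m where "m = card N div p ^ multiplicity p (card N)"
  let ?a = "multiplicity p (card N)"
  have Npos: "card N \<noteq> 0" using card_subgroup_pos[OF N] by simp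
  have cardN: "card N = p ^ ?a * m" using multiplicity_dvd[of p "card N"] by (simp add: m_def)
  have m: "\<not> p dvd m"
    unfolding m_def using multiplicity_decompose[OF Npos, of p] p not_prime_unit by blast
  obtain S where S: "subgroup S (G\<lparr>carrier := N\<rparr>)" and cardS: "card S = p ^ ?a"
    using sylow_thm[OF p NG.is_group, of ?a m] cardN fin_subgroup[OF N] by (auto simp: order_def)
  have SG: "subgroup S G" using incl_subgroup[OF N S] .
  have SN: "S \<subseteq> N" using subgroup.subset[OF S] by simp
  let ?L = "S <#> K"
  have L: "subgroup ?L G" by (rule set_mult_subgroup[OF SG K]) (use norm SN in blast)
  have KL: "K \<subseteq> ?L"
  proof
    fix k assume "k \<in> K"
    moreover from this have "k = \<one> \<otimes> k" using subgroup.mem_carrier[OF K] by simp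
    ultimately show "k \<in> ?L" using subgroup.one_closed[OF SG] unfolding set_mult_def by blast
  qed
  have SL: "S \<subseteq> ?L"
  proof
    fix s assume "s \<in> S"
    moreover from this have "s = s \<otimes> \<one>" using subgroup.mem_carrier[OF SG] by simp
    ultimately show "s \<in> ?L" using subgroup.one_closed[OF K] unfolding set_mult_def by blast
  qed
  have LN: "?L \<subseteq> N" 
  proof
    fix x assume "x \<in> ?L"
    then obtain s k where "x = s \<otimes> k" "s \<in> S" "k \<in> K" unfolding set_mult_def by blast
    then show "x \<in> N" using SN KN subgroup.m_closed[OF N] by blast
  qed
  have pn: "p_normal G p K ?L"
  proof -
    have "subgroup (S \<inter> K) G" by (rule subgroups_Inter_pair[OF SG K])
    then have "card (S \<inter> K) dvd p ^ ?a" using card_subgroup_dvd[of "S \<inter> K" S] SG cardS by simp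
    then obtain j where j: "p ^ ?a = card (S \<inter> K) * j" by (auto elim: dvdE)
    then have "j dvd p ^ ?a" by (metis dvd_triv_right)
    then obtain i where i: "j = p ^ i" using divides_primepow_nat[OF p] by blast
    have "card ?L * card (S \<inter> K) = card (S \<inter> K) * j * card K" using card_set_mult[OF SG K] cardS j by simp
    then have "card ?L = p ^ i * card K"
      using card_subgroup_pos[OF \<open>subgroup (S \<inter> K) G\<close>] i by (simp add: mult.commute mult.left_commute)
    then show ?thesis unfolding p_normal_def using L K KL norm LN by blast
  qed
  have fixed: "{a \<in> carrier G. \<forall>k \<in> K. inv a \<otimes> k \<otimes> a \<in> ?L} = N"
  proof (intro equalityI subsetI)
    fix a assume a: "a \<in> N"
    then have ac: "a \<in> carrier G" and ai: "inv a \<in> N" using subgroup.m_inv_closed[OF N a] by (simp_all add: N_iff)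
    have "inv a \<otimes> k \<otimes> a \<in> ?L" if "k \<in> K" for k
      using norm[OF ai that] KL ac by (simp add: subsetD)
    then show "a \<in> {a \<in> carrier G. \<forall>k \<in> K. inv a \<otimes> k \<otimes> a \<in> ?L}" using ac by simp
  next
    fix a assume a: "a \<in> {a \<in> carrier G. \<forall>k \<in> K. inv a \<otimes> k \<otimes> a \<in> ?L}"
    let ?K' = "conjugate G (inv a) K"
    have ac: "a \<in> carrier G" using a by simp
    have K': "subgroup ?K' G" "?K' \<subseteq> ?L"
      using conjugate_subgroup[OF _ K, of "inv a"] a by (auto simp: conjugate_image)
    have "p_normal G p (K \<inter> ?K') ?K'" by (rule p_normal_restrict[OF p pn K'])
    then have "p_normal G p (conjugate G a (K \<inter> ?K')) (conjugate G a ?K')"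
      by (rule p_normal_conjugate[OF ac])
    then have "conjugate G a (K \<inter> ?K') = K"
      using perfect conjugate_inv(2)[OF ac Kc] by simp
    then have "card (K \<inter> ?K') = card K"
      using card_conjugate[OF ac, of "K \<inter> ?K'"] Kc by (metis Int_lower1 subset_trans)
    then have "K \<inter> ?K' = K" using Kfin by (intro card_subset_eq) auto
    moreover have "card ?K' = card K" using card_conjugate[OF _ Kc, of "inv a"] ac by simp
    ultimately have "?K' = K" using fin_subgroup[OF K'(1)] by (metis Int_lower2 card_subset_eq)
    then show "a \<in> N" using conjugate_inv(2)[OF ac Kc] ac by (simp add: N_iff)
  qed
  have "\<not> p dvd card (fixed_points (coset_gset G ?L) K)"
  proof -
    let ?i = "card (fixed_points (coset_gset G ?L) K)"
    have "?i * card ?L = card N"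
      unfolding fixed_points_coset[OF L Kc] fixed by (rule card_lcosets[OF L N LN])
    moreover obtain j where "card ?L = p ^ ?a * j" using card_subgroup_dvd[OF SG L SL] cardS by (auto elim: dvdE)
    ultimately have "p ^ ?a * (?i * j) = p ^ ?a * m" using cardN by (simp add: mult.commute mult.left_commute)
    then have "?i * j = m" using p by (simp add: prime_gt_0_nat)
    then show ?thesis using m by auto
  qed
  then show ?thesis using pn by blast
qed

text \<open>Descend to a \<open>p\<close>-perfect subgroup \<open>J\<close> of \<open>K\<close>. The subgroup \<open>J\<close> is recorded because it bounds \<open>O\<^sup>p(L)\<close>.\<close>

lemma ex_fixed_coset:
  assumes p: "prime p" and K: "subgroup K G"
  shows "\<exists>L J. p_normal G p J L \<and> J \<subseteq> K \<and> \<not> p dvd card (fixed_points (coset_gset G L) K)"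
  using K
proof (induct "card K" arbitrary: K rule: less_induct)
  case less
  show ?case
  proof (cases "\<exists>N. p_normal G p N K \<and> N \<noteq> K")
    case True
    then obtain N where N: "p_normal G p N K" "N \<noteq> K" by blast
    then have "card N < card K"
      using p_normalD(3)[OF N(1)] fin_subgroup[OF less.prems] by (intro psubset_card_mono) auto
    then obtain L J where L: "p_normal G p J L" "J \<subseteq> N" "\<not> p dvd card (fixed_points (coset_gset G L) N)"
      using less.hyps p_normalD(2)[OF N(1)] by blast
    then have "\<not> p dvd card (fixed_points (coset_gset G L) K)"
      using fixed_points_cong_p[OF p N(1) coset_gset_gset[OF p_normalD(1)[OF L(1)]]] by blast
    then show ?thesis using L p_normalD(3)[OF N(1)] by blast
  next
    case False
    then show ?thesis using ex_fixed_coset_p_perfect[OF p less.prems] by blast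
  qed
qed

text \<open>Descend from \<open>O\<^sup>p(K)\<close>: then \<open>O\<^sup>p(L)\<close> is contained in \<open>O\<^sup>p(K)\<close>, which is a member of \<open>\<F>\<close>.\<close>

lemma ex_fixed_coset_hyper:
  assumes p: "prime p" and F: "subgroup_family G \<F>" and K: "K \<in> hyper_family G p \<F>"
  shows "\<exists>L \<in> hyper_family G p \<F>. \<not> p dvd card (fixed_points (coset_gset G L) K)"
proof -
  have Ks: "subgroup K G" and KF: "p_residual G p K \<in> \<F>" using K by (auto simp: hyper_family_def)
  note O = p_normal_p_residual[OF p Ks]
  obtain L J where L: "p_normal G p J L" "J \<subseteq> p_residual G p K"
    "\<not> p dvd card (fixed_points (coset_gset G L) (p_residual G p K))"
    using ex_fixed_coset[OF p p_normalD(2)[OF O]] by blast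
  note Ls = p_normalD(1)[OF L(1)]
  have "\<not> p dvd card (fixed_points (coset_gset G L) K)"
    using fixed_points_cong_p[OF p O coset_gset_gset[OF Ls]] L(3) by blast
  moreover have "p_residual G p L \<subseteq> p_residual G p K" using p_residual_subset[OF L(1)] L(2) by blast
  then have "p_residual G p L \<in> \<F>"
    using F KF p_normalD(2)[OF p_normal_p_residual[OF p Ls]] unfolding subgroup_family_def by blast
  ultimately show ?thesis using Ls by (auto simp: hyper_family_def)
qed

section \<open>The generating $G$-set of a family\<close>

lemma subgroup_family_down: "\<lbrakk>subgroup_family G \<F>; H \<in> \<F>; subgroup K G; K \<subseteq> H\<rbrakk> \<Longrightarrow> K \<in> \<F>"
  unfolding subgroup_family_def by blast

lemma subgroup_family_subgroup: "\<lbrakk>subgroup_family G \<F>; H \<in> \<F>\<rbrakk> \<Longrightarrow> subgroup H G"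
  unfolding subgroup_family_def by blast

lemma subgroup_family_conjugate: "\<lbrakk>subgroup_family G \<F>; H \<in> \<F>; a \<in> carrier G\<rbrakk> \<Longrightarrow> conjugate G a H \<in> \<F>"
  unfolding subgroup_family_def by blast

lemma subgroup_family_finite: "subgroup_family G \<F> \<Longrightarrow> finite \<F>"
  by (rule finite_subset[of \<F> "Pow (carrier G)"]) (auto dest: subgroup_family_subgroup subgroup.subset simp: fin_carrier)

lemma maximal_conjugate_rep:
  assumes "H \<in> maximal_elements \<F>"
  obtains a where "a \<in> carrier G" "conjugate G a H \<in> maximal_class_reps G \<F>"
proof -
  let ?C = "(\<lambda>g. conjugate G g H) ` carrier G"
  have "(SOME K. K \<in> ?C) \<in> ?C" by (rule someI_ex) auto
  then obtain a where "a \<in> carrier G" "(SOME K. K \<in> ?C) = conjugate G a H" by blast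
  moreover have "(SOME K. K \<in> ?C) \<in> maximal_class_reps G \<F>"
    unfolding maximal_class_reps_def by (rule imageI[OF assms])
  ultimately show ?thesis using that by simp
qed

lemma class_reps_in_family:
  assumes F: "subgroup_family G \<F>" and H: "H \<in> maximal_class_reps G \<F>"
  shows "H \<in> \<F>"
proof -
  obtain K where K: "K \<in> maximal_elements \<F>" "H = (SOME H. H \<in> (\<lambda>g. conjugate G g K) ` carrier G)"
    using H by (auto simp: maximal_class_reps_def)
  have "H \<in> (\<lambda>g. conjugate G g K) ` carrier G" unfolding K(2) by (rule someI_ex) auto
  moreover have "K \<in> \<F>" using K(1) by (simp add: maximal_elements_def)
  ultimately show ?thesis using subgroup_family_conjugate[OF F] by blast
qed

lemma family_gset_pts:
  "z \<in> pts (family_gset G \<F>) \<longleftrightarrow> (\<exists>H a. H \<in> maximal_class_reps G \<F> \<and> a \<in> carrier G \<and> z = (H, a <# H))"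
  by (auto simp: family_gset_def family_points_def LCOSETS_def)

lemma family_gset_act:
  assumes F: "subgroup_family G \<F>" and H: "H \<in> maximal_class_reps G \<F>" and a: "a \<in> carrier G" and g: "g \<in> carrier G"
  shows "act (family_gset G \<F>) g (H, a <# H) = (H, (g \<otimes> a) <# H)"
proof -
  have "g <# (a <# H) = (g \<otimes> a) <# H"
    using lcos_m_assoc[OF subgroup.subset[OF subgroup_family_subgroup[OF F class_reps_in_family[OF F H]]] g a] .
  moreover have "(H, a <# H) \<in> family_points G \<F>"
    using H a by (auto simp: family_points_def LCOSETS_def)
  ultimately show ?thesis by (simp add: family_gset_def)
qed

lemma family_gset_gset:
  assumes F: "subgroup_family G \<F>"
  shows "fin_gset G (family_gset G \<F>)"
proof (rule fin_gsetI)
  have "pts (family_gset G \<F>) \<subseteq> \<F> \<times> Pow (carrier G)"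
  proof
    fix z assume "z \<in> pts (family_gset G \<F>)"
    then obtain H a where z: "H \<in> maximal_class_reps G \<F>" "a \<in> carrier G" "z = (H, a <# H)"
      unfolding family_gset_pts by blast
    note HF = class_reps_in_family[OF F z(1)]
    show "z \<in> \<F> \<times> Pow (carrier G)"
      using HF l_coset_subset_G[OF subgroup.subset[OF subgroup_family_subgroup[OF F HF]] z(2)] z(3) by simp
  qed
  then show "finite (pts (family_gset G \<F>))"
    using subgroup_family_finite[OF F] fin_carrier by (meson finite_Pow_iff finite_SigmaI finite_subset)
  show "act (family_gset G \<F>) g \<in> extensional (pts (family_gset G \<F>))" for g
    by (simp add: family_gset_def)
  fix z assume "z \<in> pts (family_gset G \<F>)"
  then obtain H a where H: "H \<in> maximal_class_reps G \<F>" and a: "a \<in> carrier G" and z: "z = (H, a <# H)"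
    unfolding family_gset_pts by blast
  note act = family_gset_act[OF F H]
  show "act (family_gset G \<F>) \<one> z = z" unfolding z using act[OF a one_closed] a by simp
  fix g assume g: "g \<in> carrier G"
  show "act (family_gset G \<F>) g z \<in> pts (family_gset G \<F>)"
    unfolding z act[OF a g] family_gset_pts using H a g by blast
  fix h assume h: "h \<in> carrier G"
  show "act (family_gset G \<F>) (g \<otimes> h) z = act (family_gset G \<F>) g (act (family_gset G \<F>) h z)"
    unfolding z using act[OF a] act[of "h \<otimes> a"] a g h by (simp add: m_assoc)
qed

text \<open>A subgroup that fixes a point \<open>a H\<close> lies in the conjugate of \<open>H\<close> by \<open>a\<close>.\<close>

lemma family_gset_isotropy:
  assumes F: "subgroup_family G \<F>" and z: "z \<in> pts (family_gset G \<F>)" and K: "subgroup K G"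
    and fixed: "\<And>k. k \<in> K \<Longrightarrow> act (family_gset G \<F>) k z = z"
  shows "K \<in> \<F>"
proof -
  obtain H a where H: "H \<in> maximal_class_reps G \<F>" and a: "a \<in> carrier G" and z: "z = (H, a <# H)"
    using z unfolding family_gset_pts by blast
  note HF = class_reps_in_family[OF F H]
  note Hs = subgroup_family_subgroup[OF F HF]
  have "K \<subseteq> conjugate G a H"
  proof
    fix k assume k: "k \<in> K"
    have kc: "k \<in> carrier G" using subgroup.mem_carrier[OF K k] .
    have "(k \<otimes> a) <# H = a <# H" using fixed[OF k] family_gset_act[OF F H a kc] z by simp
    then have "inv a \<otimes> (k \<otimes> a) \<in> H" using lcos_eq_iff[OF Hs _ a] kc a by simp
    moreover have "k = a \<otimes> (inv a \<otimes> (k \<otimes> a)) \<otimes> inv a" using a kc by (simp add: m_assoc mult_inv_cancel)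
    ultimately show "k \<in> conjugate G a H" unfolding conjugate_image by blast
  qed
  then show ?thesis using subgroup_family_down[OF F subgroup_family_conjugate[OF F HF a] K] by simp
qed

text \<open>A member of the family lies in a maximal one, and the representative chosen for the class of the latter
  is a conjugate of it by some \<open>a\<close>; the point is the coset of \<open>inv a\<close>.\<close>

lemma family_gset_fixed_point:
  assumes F: "subgroup_family G \<F>" and K: "K \<in> \<F>"
  shows "\<exists>z \<in> pts (family_gset G \<F>). \<forall>k \<in> K. act (family_gset G \<F>) k z = z"
proof -
  obtain H where H: "H \<in> \<F>" "K \<subseteq> H" "\<forall>H' \<in> \<F>. H \<subseteq> H' \<longrightarrow> H = H'"
    using finite_has_maximal2[OF subgroup_family_finite[OF F] K] by auto
  then have "H \<in> maximal_elements \<F>" by (auto simp: maximal_elements_def)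
  then obtain a where a: "a \<in> carrier G" "conjugate G a H \<in> maximal_class_reps G \<F>" by (rule maximal_conjugate_rep)
  let ?H' = "conjugate G a H"
  note Hs = subgroup_family_subgroup[OF F H(1)] and H's = subgroup_family_subgroup[OF F class_reps_in_family[OF F a(2)]]
  have "act (family_gset G \<F>) k (?H', inv a <# ?H') = (?H', inv a <# ?H')" if k: "k \<in> K" for k
  proof -
    have kH: "k \<in> H" using k H(2) by blast
    then have kc: "k \<in> carrier G" using subgroup.mem_carrier[OF Hs] by blast
    have "inv (inv a) \<otimes> (k \<otimes> inv a) = a \<otimes> k \<otimes> inv a" using a(1) kc by (simp add: m_assoc)
    then have "inv (inv a) \<otimes> (k \<otimes> inv a) \<in> ?H'" using kH unfolding conjugate_image by blast
    then have "(k \<otimes> inv a) <# ?H' = inv a <# ?H'" using lcos_eq_iff[OF H's] a(1) kc by simp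
    then show ?thesis using family_gset_act[OF F a(2) inv_closed[OF a(1)] kc] by simp
  qed
  moreover have "(?H', inv a <# ?H') \<in> pts (family_gset G \<F>)"
    unfolding family_gset_pts using a inv_closed by blast
  ultimately show ?thesis by blast
qed

end

section \<open>Virtual $G$-sets with prescribed numbers of fixed points\<close>

text \<open>The number of fixed points of any representative of the class.\<close>

definition class_mark :: "('g, 'u) over set \<Rightarrow> 'g set \<Rightarrow> nat" where
  "class_mark C K = card (fixed_points (fst (SOME z. z \<in> C)) K)"

text \<open>The functions \<open>m\<close> that count fixed points in a finite \<open>G\<close>-set admitting a map to \<open>Y\<close>. They are closed
  under sums, and under products with the fixed point numbers of arbitrary finite \<open>G\<close>-sets.\<close>

definition realizes :: "('g, 'b) monoid_scheme \<Rightarrow> ('g, 'u) gset \<Rightarrow> ('g set \<Rightarrow> nat) \<Rightarrow> bool" where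
  "realizes G Y m \<longleftrightarrow> (\<exists>C \<in> carrier (over_semiring G Y). \<forall>K. subgroup K G \<longrightarrow> class_mark C K = m K)"

context gset_universe
begin

lemma fixed_points_iso:
  assumes "over_iso G X f Y g" and K: "K \<subseteq> carrier G" and X: "fin_gset G X"
  shows "card (fixed_points X K) = card (fixed_points Y K)"
proof -
  obtain h where h: "equivariant G X Y h" "bij_betw h (pts X) (pts Y)"
    using assms(1) by (auto simp: over_iso_def)
  have fix_iff: "act Y k (h x) = h x \<longleftrightarrow> act X k x = x" if "x \<in> pts X" "k \<in> K" for x k
    using equivariantD(2)[OF h(1) subsetD[OF K that(2)] that(1)] act_closed[OF X subsetD[OF K that(2)] that(1)]
      inj_on_eq_iff[OF bij_betw_imp_inj_on[OF h(2)] _ that(1)] by metis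
  have "h ` fixed_points X K = fixed_points Y K"
  proof (intro equalityI subsetI)
    fix y assume "y \<in> h ` fixed_points X K"
    then show "y \<in> fixed_points Y K" using fix_iff bij_betwE[OF h(2)] by (auto simp: fixed_points_def)
  next
    fix y assume y: "y \<in> fixed_points Y K"
    then obtain x where "x \<in> pts X" "y = h x" using h(2) by (auto simp: fixed_points_def bij_betw_def)
    then show "y \<in> h ` fixed_points X K" using fix_iff y by (auto simp: fixed_points_def)
  qed
  moreover have "inj_on h (fixed_points X K)"
    by (rule inj_on_subset[OF bij_betw_imp_inj_on[OF h(2)]]) (auto simp: fixed_points_def)
  ultimately show ?thesis by (metis card_image)
qed

lemma class_mark_class:
  fixes S :: "('g, 'u) gset"
  assumes X: "fin_gset G X" "equivariant G X S f" and K: "subgroup K G"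
  shows "class_mark (over_class G S X f) K = card (fixed_points X K)"
proof -
  let ?z = "SOME z. z \<in> over_class G S X f"
  obtain q where "q \<in> over_class G S X f" using over_class_nonempty[OF X] .
  then have "?z \<in> over_class G S X f" by (rule someI)
  then have "over_iso G X f (fst ?z) (snd ?z)" using over_class_mem[OF X(1), of "fst ?z" "snd ?z"] by simp
  from fixed_points_iso[OF this subgroup.subset[OF K] X(1)] show ?thesis by (simp add: class_mark_def)
qed

lemma fixed_points_disj_union:
  assumes "fin_gset G X" "fin_gset G Y"
  shows "card (fixed_points (disj_union X Y) K) = card (fixed_points X K) + card (fixed_points Y K)"
proof -
  have "fixed_points (disj_union X Y) K = fixed_points X K <+> fixed_points Y K"
    by (auto simp: fixed_points_def disj_union_def)
  moreover have "finite (fixed_points X K)" "finite (fixed_points Y K)"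
    using gset_finite[OF assms(1)] gset_finite[OF assms(2)] by (auto simp: fixed_points_def)
  ultimately show ?thesis by (simp add: card_Plus)
qed

lemma class_mark_add:
  fixes S :: "('g, 'u) gset"
  assumes C: "C \<in> carrier (over_semiring G S)" and D: "D \<in> carrier (over_semiring G S)" and K: "subgroup K G"
  shows "class_mark (C \<oplus>\<^bsub>over_semiring G S\<^esub> D) K = class_mark C K + class_mark D K"
proof -
  obtain X :: "('g, 'u) gset" and f where X: "fin_gset G X" "equivariant G X S f" and
    C: "C = over_class G S X f" using C by (metis over_carrierE gmapsD(4))
  obtain Y :: "('g, 'u) gset" and g where Y: "fin_gset G Y" "equivariant G Y S g" and
    D: "D = over_class G S Y g" using D by (metis over_carrierE gmapsD(4))
  note XY = disj_union_gset[OF X(1) Y(1)] equivariant_case_sum[OF X(2) Y(2)]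
  show ?thesis unfolding C D over_add[OF X Y]
    by (simp add: class_mark_class X Y XY K fixed_points_disj_union)
qed

lemma class_mark_zero:
  fixes S :: "('g, 'u) gset"
  assumes K: "subgroup K G"
  shows "class_mark \<zero>\<^bsub>over_semiring G S\<^esub> K = 0"
proof -
  interpret R: abelian_monoid "over_semiring G S" by (rule abelian_monoid_over_semiring)
  show ?thesis using class_mark_add[OF R.zero_closed R.zero_closed K] by simp
qed

lemma class_mark_multiple:
  fixes S :: "('g, 'u) gset"
  assumes C: "C \<in> carrier (over_semiring G S)" and K: "subgroup K G"
  shows "class_mark ([n] \<cdot>\<^bsub>over_semiring G S\<^esub> C) K = n * class_mark C K"
proof -
  interpret R: abelian_monoid "over_semiring G S" by (rule abelian_monoid_over_semiring)
  show ?thesis by (induct n) (simp_all add: class_mark_zero[OF K] class_mark_add C K)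
qed

lemma class_mark_push:
  fixes S T :: "('g, 'u) gset"
  assumes \<phi>: "\<phi> \<in> gmaps G S T" and C: "C \<in> carrier (over_semiring G S)" and K: "subgroup K G"
  shows "class_mark (over_push G T \<phi> C) K = class_mark C K"
proof -
  obtain X :: "('g, 'u) gset" and f where X: "fin_gset G X" "equivariant G X S f" and
    C: "C = over_class G S X f" using C by (metis over_carrierE gmapsD(4))
  show ?thesis unfolding C over_push_class[OF X]
    by (simp add: class_mark_class X K equivariant_comp[OF X(2) gmapsD(4)[OF \<phi>]])
qed

lemma realizes_gset:
  fixes Y :: "('g, 'u) gset"
  assumes "fin_gset G X" "equivariant G X Y f"
  shows "realizes G Y (\<lambda>K. card (fixed_points X K))"
  unfolding realizes_def using class_mark_class[OF assms] over_class_carrier[OF assms] by blast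

lemma realizes_add:
  fixes Y :: "('g, 'u) gset"
  assumes "realizes G Y m" "realizes G Y n"
  shows "realizes G Y (\<lambda>K. m K + n K)"
proof -
  obtain C D where "C \<in> carrier (over_semiring G Y)" "D \<in> carrier (over_semiring G Y)"
    "\<forall>K. subgroup K G \<longrightarrow> class_mark C K = m K" "\<forall>K. subgroup K G \<longrightarrow> class_mark D K = n K"
    using assms unfolding realizes_def by blast
  then show ?thesis unfolding realizes_def
    using class_mark_add abelian_monoid.a_closed[OF abelian_monoid_over_semiring[of Y]]
    by (intro bexI[of _ "C \<oplus>\<^bsub>over_semiring G Y\<^esub> D"]) auto
qed

lemma realizes_multiple:
  fixes Y :: "('g, 'u) gset"
  assumes "realizes G Y m"
  shows "realizes G Y (\<lambda>K. n * m K)"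
proof -
  interpret R: abelian_monoid "over_semiring G Y" by (rule abelian_monoid_over_semiring)
  obtain C where C: "C \<in> carrier (over_semiring G Y)" "\<forall>K. subgroup K G \<longrightarrow> class_mark C K = m K"
    using assms unfolding realizes_def by blast
  then show ?thesis unfolding realizes_def
    using class_mark_multiple[OF C(1)] R.add.nat_pow_closed[OF C(1)]
    by (intro bexI[of _ "[n] \<cdot>\<^bsub>over_semiring G Y\<^esub> C"]) auto
qed

lemma realizes_zero:
  fixes Y :: "('g, 'u) gset"
  shows "realizes G Y (\<lambda>K. 0)"
  unfolding realizes_def
  using class_mark_zero abelian_monoid.zero_closed[OF abelian_monoid_over_semiring[of Y]] by blast

lemma realizes_cong:
  "\<lbrakk>realizes G Y m; \<And>K. subgroup K G \<Longrightarrow> m K = n K\<rbrakk> \<Longrightarrow> realizes G Y n"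
  unfolding realizes_def by auto

lemma realizes_mult:
  fixes Y :: "('g, 'u) gset"
  assumes "realizes G Y m" and Z: "fin_gset G Z"
  shows "realizes G Y (\<lambda>K. m K * card (fixed_points Z K))"
proof -
  obtain C where C: "C \<in> carrier (over_semiring G Y)" "\<And>K. subgroup K G \<Longrightarrow> class_mark C K = m K"
    using assms unfolding realizes_def by blast
  obtain X :: "('g, 'u) gset" and f where X: "fin_gset G X" "equivariant G X Y f" and
    CX: "C = over_class G Y X f" using C(1) by (metis over_carrierE gmapsD(4))
  let ?P = "fibre_prod (\<lambda>_. ()) (\<lambda>_. ()) X Z"
  have P: "fin_gset G ?P" "equivariant G ?P Y (\<lambda>z. f (fst z))"
  proof -
    show "fin_gset G ?P"
      by (rule fibre_prod_gset[OF X(1) Z, where S = "one_point :: ('g, unit) gset"])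
        (simp_all add: equivariant_def one_point_def)
    show "equivariant G ?P Y (\<lambda>z. f (fst z))" by (rule equivariant_comp[OF fibre_prod_proj(1) X(2)])
  qed
  have "fixed_points ?P K = fixed_points X K \<times> fixed_points Z K" for K
    by (auto simp: fixed_points_def fibre_prod_def fibre_points_def)
  then have "card (fixed_points ?P K) = m K * card (fixed_points Z K)" if "subgroup K G" for K
    using C(2)[OF that] class_mark_class[OF X that] CX by (simp add: card_cartesian_product)
  then show ?thesis by (rule realizes_cong[OF realizes_gset[OF P]])
qed

text \<open>The map to \<open>Y\<close> sends \<open>a L\<close> to \<open>a y\<close>.\<close>

lemma realizes_coset:
  fixes Y :: "('g, 'u) gset"
  assumes Y: "fin_gset G Y" and L: "subgroup L G" and y: "y \<in> pts Y" "\<And>l. l \<in> L \<Longrightarrow> act Y l y = y"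
  shows "realizes G Y (\<lambda>K. card (fixed_points (coset_gset G L) K))"
proof -
  define f where "f C = act Y (SOME a. a \<in> carrier G \<and> C = a <#\<^bsub>G\<^esub> L) y" for C
  have f: "f (a <#\<^bsub>G\<^esub> L) = act Y a y" if a: "a \<in> carrier G" for a
  proof -
    let ?b = "SOME b. b \<in> carrier G \<and> a <#\<^bsub>G\<^esub> L = b <#\<^bsub>G\<^esub> L"
    have b: "?b \<in> carrier G \<and> a <#\<^bsub>G\<^esub> L = ?b <#\<^bsub>G\<^esub> L" by (rule someI[of _ a]) (simp add: a)
    then have "inv ?b \<otimes> a \<in> L" using lcos_eq_iff[OF L a, of ?b] by blast
    then have "act Y a y = act Y ?b y"
      using act_eq_iff[OF Y y(1) a, of ?b] b y(2) subgroup.mem_carrier[OF L] by (simp add: stabilizer_def)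
    then show ?thesis by (simp add: f_def)
  qed
  have "equivariant G (coset_gset G L) Y f"
    by (rule equivariantI) (auto simp: coset_gset_pts coset_gset_act[OF L] f act_closed[OF Y] act_mult[OF Y] y(1))
  then show ?thesis by (rule realizes_gset[OF coset_gset_gset[OF L]])
qed

text \<open>The differences \<open>n\<^sub>K - [G/L\<^sub>K]\<close> are multiplied out over the members \<open>K\<close> of \<open>\<K>\<close>, where
  \<open>n\<^sub>K = |(G/L\<^sub>K)\<^sup>K|\<close> is prime to \<open>p\<close>. The factor of \<open>K\<close> has no virtual point fixed by \<open>K\<close>, and so neither has
  the product, written as \<open>k + v - v'\<close>.\<close>

lemma ex_virtual_unit:
  fixes Y :: "('g, 'u) gset"
  assumes p: "prime p" and Y: "fin_gset G Y" and F: "subgroup_family G \<F>"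
    and fix_Y: "\<And>K. K \<in> hyper_family G p \<F> \<Longrightarrow> \<exists>y \<in> pts Y. \<forall>k \<in> K. act Y k y = y"
    and "finite \<K>" "\<K> \<subseteq> hyper_family G p \<F>"
  shows "\<exists>k v v'. \<not> p dvd k \<and> realizes G Y v \<and> realizes G Y v' \<and> (\<forall>K \<in> \<K>. k + v K = v' K)"
  using assms(5,6)
proof (induct rule: finite_induct)
  case empty
  have "\<not> p dvd 1" using p not_prime_unit by blast
  then show ?case using realizes_zero by blast
next
  case (insert K0 \<K>)
  then obtain k v v' where k: "\<not> p dvd k" and v: "realizes G Y v" "realizes G Y v'"
    and eq: "\<And>K. K \<in> \<K> \<Longrightarrow> k + v K = v' K" by blast
  obtain L where L: "L \<in> hyper_family G p \<F>" and n: "\<not> p dvd card (fixed_points (coset_gset G L) K0)"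
    using ex_fixed_coset_hyper[OF p F] insert.prems by blast
  have Ls: "subgroup L G" using L by (simp add: hyper_family_def)
  obtain y where y: "y \<in> pts Y" "\<And>l. l \<in> L \<Longrightarrow> act Y l y = y" using fix_Y[OF L] by blast
  let ?l = "\<lambda>K. card (fixed_points (coset_gset G L) K)"
  let ?n = "?l K0"
  note l = realizes_coset[OF Y Ls y] and cL = coset_gset_gset[OF Ls]
  have "\<not> p dvd k * ?n" using k n p by (simp add: prime_dvd_mult_iff)
  \<comment> \<open>\<open>(k + v - v') (n - l) = k n + (n v + v' l) - (n v' + k l + v l)\<close>\<close>
  moreover have "realizes G Y (\<lambda>K. ?n * v K + v' K * ?l K)"
    by (intro realizes_add realizes_multiple realizes_mult v cL)
  moreover have "realizes G Y (\<lambda>K. ?n * v' K + k * ?l K + v K * ?l K)"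
    by (intro realizes_add realizes_multiple realizes_mult v cL l)
  moreover have "k * ?n + (?n * v K + v' K * ?l K) = ?n * v' K + k * ?l K + v K * ?l K"
    if "K \<in> insert K0 \<K>" for K
  proof (cases "K = K0")
    case False
    then have "v' K = k + v K" using eq that by simp
    then show ?thesis by (simp add: algebra_simps)
  qed (simp add: algebra_simps)
  ultimately show ?case by blast
qed

section \<open>Isotropy in a family\<close>

definition isotropy_in :: "'g set set \<Rightarrow> ('g, 'a) gset \<Rightarrow> bool" where
  "isotropy_in \<F> X \<longleftrightarrow> (\<forall>x \<in> pts X. \<forall>K. subgroup K G \<longrightarrow> (\<forall>k \<in> K. act X k x = x) \<longrightarrow> K \<in> \<F>)"

lemma isotropy_in_map:
  assumes "equivariant G X Y f" "isotropy_in \<F> Y"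
  shows "isotropy_in \<F> X"
  unfolding isotropy_in_def
proof (intro ballI allI impI)
  fix x K assume x: "x \<in> pts X" and K: "subgroup K G" and fixed: "\<forall>k \<in> K. act X k x = x"
  have "act Y k (f x) = f x" if "k \<in> K" for k
    using equivariantD(2)[OF assms(1) subgroup.mem_carrier[OF K that] x] fixed that by simp
  then show "K \<in> \<F>" using assms(2) K equivariantD(1)[OF assms(1) x] unfolding isotropy_in_def by blast
qed

text \<open>The chosen copy of the explicit \<open>G\<close>-set inherits its properties along an isomorphism.\<close>

lemma hyper_properties:
  fixes X :: "('g, 'u) gset"
  assumes p: "prime p" and X: "fin_gset G X"
  defines "\<F> \<equiv> hyper_family G p (isotropy_family G X)"
  shows "fin_gset G (hyper G p X)" "isotropy_in \<F> (hyper G p X)"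
    "K \<in> \<F> \<Longrightarrow> \<exists>y \<in> pts (hyper G p X). \<forall>k \<in> K. act (hyper G p X) k y = y"
proof -
  have F: "subgroup_family G \<F>"
    unfolding \<F>_def by (rule hyper_family_family[OF p isotropy_family_family[OF X]])
  let ?D = "family_gset G \<F>" and ?Y = "hyper G p X"
  note D = family_gset_gset[OF F]
  have "\<exists>Y :: ('g, 'u) gset. fin_gset G Y \<and> gisos G ?D Y \<noteq> {}"
  proof -
    obtain Y :: "('g, 'u) gset" and h where "fin_gset G Y" "equivariant G ?D Y h" "bij_betw h (pts ?D) (pts Y)"
      using ex_copy[OF D infinite_universe] by blast
    then have "restrict h (pts ?D) \<in> gisos G ?D Y" by (simp add: gisos_iff[OF D] equivariant_restrict[OF D])
    then show ?thesis using \<open>fin_gset G Y\<close> by blast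
  qed
  then have Y: "fin_gset G ?Y \<and> gisos G ?D ?Y \<noteq> {}"
    unfolding hyper_def \<F>_def[symmetric] by (rule someI_ex)
  then show "fin_gset G ?Y" ..
  obtain h where h: "equivariant G ?D ?Y h" "bij_betw h (pts ?D) (pts ?Y)"
    using Y gisos_iff[OF D] by blast
  have "isotropy_in \<F> ?D" unfolding isotropy_in_def using family_gset_isotropy[OF F] by blast
  then show "isotropy_in \<F> ?Y" by (rule isotropy_in_map[OF equivariant_inv_into[OF D h]])
  assume K: "K \<in> \<F>"
  then obtain z where z: "z \<in> pts ?D" "\<forall>k \<in> K. act ?D k z = z" using family_gset_fixed_point[OF F] by blast
  then have "act ?Y k (h z) = h z" if "k \<in> K" for k
    using equivariantD(2)[OF h(1) subgroup.mem_carrier[OF subgroup_family_subgroup[OF F K] that] z(1)] that by simp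
  then show "\<exists>y \<in> pts ?Y. \<forall>k \<in> K. act ?Y k y = y" using equivariantD(1)[OF h(1) z(1)] by blast
qed

text \<open>The fibre over \<open>w\<close> of the pullback of a \<open>G\<close>-set \<open>V\<close> to \<open>W\<close> is a copy of \<open>V\<close>. A subgroup either moves
  \<open>w\<close>, and has no fixed points in the fibre, or it lies in \<open>\<F>\<close> and has as many as in \<open>V\<close>.\<close>

lemma pull_eq_if_marks_eq:
  fixes W :: "('g, 'u) gset"
  assumes W: "fin_gset G W" "isotropy_in \<F> W"
    and C: "C \<in> carrier (over_semiring G one_point)" and D: "D \<in> carrier (over_semiring G one_point)"
    and marks: "\<And>K. \<lbrakk>subgroup K G; K \<in> \<F>\<rbrakk> \<Longrightarrow> class_mark C K = class_mark D K"
  shows "over_pull G W (to_point W) C = over_pull G W (to_point W) D"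
proof -
  obtain X :: "('g, 'u) gset" and f where X: "fin_gset G X" and f: "f \<in> gmaps G X one_point"
    and CX: "C = over_class G one_point X f" using C by (rule over_carrierE)
  obtain Z :: "('g, 'u) gset" and g where Z: "fin_gset G Z" and g: "g \<in> gmaps G Z one_point"
    and DZ: "D = over_class G one_point Z g" using D by (rule over_carrierE)
  note Wp = gmapsD(4)[OF to_point_gmaps[OF W(1)]]
  note WX = fibre_prod_gset[OF W(1) X Wp gmapsD(4)[OF f]] and WZ = fibre_prod_gset[OF W(1) Z Wp gmapsD(4)[OF g]]
  have count: "card (fixed_over (fibre_prod (to_point W) e W V) fst w K)
      = (if \<forall>k \<in> K. act W k w = w then card (fixed_points V K) else 0)"
    if V: "fin_gset G V" and e: "e \<in> gmaps G V one_point" and w: "w \<in> pts W" and K: "subgroup K G"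
    for V :: "('g, 'u) gset" and e w K
  proof -
    have pt: "to_point W w = e v" if "v \<in> pts V" for v
      using gmapsD(1)[OF e that] w by (simp add: to_point_def one_point_def)
    have "fixed_over (fibre_prod (to_point W) e W V) fst w K
        = (if \<forall>k \<in> K. act W k w = w then Pair w ` fixed_points V K else {})"
    proof -
      have "(w', v) \<in> fixed_over (fibre_prod (to_point W) e W V) fst w K \<longleftrightarrow>
          w' = w \<and> v \<in> fixed_points V K \<and> (\<forall>k \<in> K. act W k w = w)" for w' v
      proof (cases "w' = w \<and> v \<in> pts V")
        case True
        then have "(w', v) \<in> pts (fibre_prod (to_point W) e W V)" using pt w by (simp add: fibre_prod_pts)
        then show ?thesis using True fibre_prod_act[of w' v "to_point W" e W V]
          by (auto simp: fixed_over_def fixed_points_def)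
      qed (auto simp: fixed_over_def fixed_points_def fibre_prod_pts)
      then show ?thesis by auto
    qed
    then show ?thesis by (simp add: card_image inj_on_def)
  qed
  have "over_iso G (fibre_prod (to_point W) f W X) fst (fibre_prod (to_point W) g W Z) fst"
  proof (rule over_iso_if_fixed_points[OF WX WZ fibre_prod_proj(1) fibre_prod_proj(1)])
    fix w K assume w: "w \<in> pts W" and K: "subgroup K G"
    have "card (fixed_points X K) = card (fixed_points Z K)" if "\<forall>k \<in> K. act W k w = w"
      using marks[OF K] W(2) w K that class_mark_class[OF X gmapsD(4)[OF f] K]
        class_mark_class[OF Z gmapsD(4)[OF g] K] unfolding CX DZ isotropy_in_def by metis
    then show "card (fixed_over (fibre_prod (to_point W) f W X) fst w K)
        = card (fixed_over (fibre_prod (to_point W) g W Z) fst w K)"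
      using count[OF X f w K] count[OF Z g w K] by simp
  qed
  then show ?thesis
    unfolding CX DZ over_pull_class[OF X gmapsD(4)[OF f] W(1) Wp] over_pull_class[OF Z gmapsD(4)[OF g] W(1) Wp]
    by (rule over_class_eqI[OF WX WZ])
qed

end

section \<open>Dress generating sets\<close>

lemma (in groth) groth_multiple:
  assumes "a \<in> carrier R" "b \<in> carrier R"
  shows "[(n::nat)] \<cdot>\<^bsub>groth_ring R\<^esub> groth_diff R a b = groth_diff R ([n] \<cdot> a) ([n] \<cdot> b)"
proof -
  interpret A: abelian_group "groth_ring R" by (rule abelian_group_groth)
  show ?thesis
    by (induct n) (simp_all add: groth_zero groth_add assms add.nat_pow_closed)
qed

lemma (in abelian_group) multiple_minus:
  assumes "x \<in> carrier G" "y \<in> carrier G"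
  shows "[(k::nat)] \<cdot> ([(n::nat)] \<cdot> x \<ominus> y) = [(n * k)] \<cdot> x \<ominus> [k] \<cdot> y"
  using assms by (simp add: a_minus_def add.nat_pow_distrib add.nat_pow_pow add.nat_pow_inv)

lemma (in abelian_group) eq_if_minus_zero:
  assumes "x \<in> carrier G" "y \<in> carrier G" "x \<ominus> y = \<zero>"
  shows "x = y"
proof -
  have "(x \<ominus> y) \<oplus> y = x" using assms(1,2) by (simp add: a_minus_def a_assoc l_neg)
  then show ?thesis using assms by simp
qed

lemma (in group) rcos_eq_iff:
  assumes N: "subgroup N G" and x: "x \<in> carrier G" "y \<in> carrier G"
  shows "N #> x = N #> y \<longleftrightarrow> x \<otimes> inv y \<in> N"
proof -
  have "x \<in> N #> y \<longleftrightarrow> x \<otimes> inv y \<in> N" by (rule subgroup.rcos_module[OF N is_group x(2,1)])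
  moreover have "N #> y = N #> x" if "x \<in> N #> y" by (rule repr_independence[OF that x(2) N])
  moreover have "x \<in> N #> x" by (rule rcos_self[OF x(1) N])
  ultimately show ?thesis by auto
qed

lemma quotient_map_coset:
  fixes A :: "('a, 'k) monoid_scheme" and A' :: "('c, 'l) monoid_scheme"
  assumes A: "comm_group A" and A': "comm_group A'" and N: "subgroup N A" and N': "subgroup N' A'"
    and f: "f \<in> hom A A'" and fN: "f ` N \<subseteq> N'" and a: "a \<in> carrier A"
  shows "(\<Union>x \<in> N #>\<^bsub>A\<^esub> a. N' #>\<^bsub>A'\<^esub> f x) = N' #>\<^bsub>A'\<^esub> f a"
proof -
  interpret A: comm_group A by (rule A)
  interpret A': comm_group A' by (rule A')
  have fc: "f x \<in> carrier A'" if "x \<in> carrier A" for x using f that by (auto simp: hom_def)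
  have "N' #>\<^bsub>A'\<^esub> f x = N' #>\<^bsub>A'\<^esub> f a" if x: "x \<in> N #>\<^bsub>A\<^esub> a" for x
  proof -
    obtain n where n: "n \<in> N" "x = n \<otimes>\<^bsub>A\<^esub> a" using x by (auto simp: r_coset_def)
    then have nc: "n \<in> carrier A" using subgroup.mem_carrier[OF N] by blast
    have "f x = f n \<otimes>\<^bsub>A'\<^esub> f a" using f nc a n(2) by (auto simp: hom_def)
    then have "f x \<otimes>\<^bsub>A'\<^esub> inv\<^bsub>A'\<^esub> f a = f n" using fc[OF nc] fc[OF a] by (simp add: A'.m_assoc)
    then have "f x \<otimes>\<^bsub>A'\<^esub> inv\<^bsub>A'\<^esub> f a \<in> N'" using fN n(1) by auto
    then show ?thesis using A'.rcos_eq_iff[OF N'] fc a n(2) nc by simp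
  qed
  then show ?thesis using A.rcos_self[OF a N] by blast
qed

lemma quotient_map_hom:
  fixes A :: "('a, 'k) monoid_scheme" and A' :: "('c, 'l) monoid_scheme"
  assumes A: "comm_group A" and A': "comm_group A'" and N: "subgroup N A" and N': "subgroup N' A'"
    and f: "f \<in> hom A A'" and fN: "f ` N \<subseteq> N'"
  shows "(\<lambda>C. \<Union>x \<in> C. N' #>\<^bsub>A'\<^esub> f x) \<in> hom (A Mod N) (A' Mod N')"
proof -
  interpret A: comm_group A by (rule A)
  interpret A': comm_group A' by (rule A')
  interpret N: normal N A by (rule A.subgroup_imp_normal[OF N])
  interpret N': normal N' A' by (rule A'.subgroup_imp_normal[OF N'])
  note q = quotient_map_coset[OF assms]
  have fc: "f x \<in> carrier A'" if "x \<in> carrier A" for x using f that by (auto simp: hom_def)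
  show ?thesis
  proof (rule homI)
    fix C assume "C \<in> carrier (A Mod N)"
    then obtain a where a: "a \<in> carrier A" "C = N #>\<^bsub>A\<^esub> a" by (auto simp: FactGroup_def RCOSETS_def)
    show "(\<Union>x \<in> C. N' #>\<^bsub>A'\<^esub> f x) \<in> carrier (A' Mod N')"
      unfolding a(2) q[OF a(1)] using fc[OF a(1)] by (auto simp: FactGroup_def RCOSETS_def)
    fix D assume "D \<in> carrier (A Mod N)"
    then obtain b where b: "b \<in> carrier A" "D = N #>\<^bsub>A\<^esub> b" by (auto simp: FactGroup_def RCOSETS_def)
    have "f (a \<otimes>\<^bsub>A\<^esub> b) = f a \<otimes>\<^bsub>A'\<^esub> f b" using f a b by (auto simp: hom_def)
    then show "(\<Union>x \<in> C \<otimes>\<^bsub>A Mod N\<^esub> D. N' #>\<^bsub>A'\<^esub> f x)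
        = (\<Union>x \<in> C. N' #>\<^bsub>A'\<^esub> f x) \<otimes>\<^bsub>A' Mod N'\<^esub> (\<Union>x \<in> D. N' #>\<^bsub>A'\<^esub> f x)"
      unfolding a(2) b(2) mult_FactGroup N.rcos_sum[OF a(1) b(1)] q[OF a(1)] q[OF b(1)]
        q[OF A.m_closed[OF a(1) b(1)]] N'.rcos_sum[OF fc[OF a(1)] fc[OF b(1)]] by simp
  qed
qed

lemma quotient_surj_iff:
  fixes A :: "('a, 'k) monoid_scheme" and A' :: "('c, 'l) monoid_scheme"
  assumes A: "comm_group A" and A': "comm_group A'" and N: "subgroup N A" and N': "subgroup N' A'"
    and f: "f \<in> hom A A'" and fN: "f ` N \<subseteq> N'"
  shows "(\<forall>b \<in> carrier (A' Mod N'). \<exists>k::nat. P k \<and>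
        b [^]\<^bsub>A' Mod N'\<^esub> k \<in> (\<lambda>C. \<Union>x \<in> C. N' #>\<^bsub>A'\<^esub> f x) ` carrier (A Mod N))
     \<longleftrightarrow> (\<forall>b \<in> carrier A'. \<exists>k. P k \<and> (\<exists>a \<in> carrier A. b [^]\<^bsub>A'\<^esub> k \<otimes>\<^bsub>A'\<^esub> inv\<^bsub>A'\<^esub> f a \<in> N'))"
proof -
  interpret A: comm_group A by (rule A)
  interpret A': comm_group A' by (rule A')
  interpret N': normal N' A' by (rule A'.subgroup_imp_normal[OF N'])
  interpret Q: group "A' Mod N'" by (rule N'.factorgroup_is_group)
  interpret r: group_hom A' "A' Mod N'" "\<lambda>a. N' #>\<^bsub>A'\<^esub> a"
    using N'.r_coset_hom_Mod by unfold_locales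
  note q = quotient_map_coset[OF assms]
  have fc: "f x \<in> carrier A'" if "x \<in> carrier A" for x using f that by (auto simp: hom_def)
  have car: "carrier (A Mod N) = (\<lambda>a. N #>\<^bsub>A\<^esub> a) ` carrier A" "carrier (A' Mod N') = (\<lambda>a. N' #>\<^bsub>A'\<^esub> a) ` carrier A'"
    by (auto simp: FactGroup_def RCOSETS_def)
  have img: "(\<lambda>C. \<Union>x \<in> C. N' #>\<^bsub>A'\<^esub> f x) ` carrier (A Mod N) = (\<lambda>a. N' #>\<^bsub>A'\<^esub> f a) ` carrier A"
    unfolding car image_image by (rule image_cong[OF refl q])
  have "(N' #>\<^bsub>A'\<^esub> b) [^]\<^bsub>A' Mod N'\<^esub> k \<in> (\<lambda>a. N' #>\<^bsub>A'\<^esub> f a) ` carrier A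
      \<longleftrightarrow> (\<exists>a \<in> carrier A. b [^]\<^bsub>A'\<^esub> k \<otimes>\<^bsub>A'\<^esub> inv\<^bsub>A'\<^esub> f a \<in> N')" if b: "b \<in> carrier A'" for b and k :: nat
  proof -
    have pow: "(N' #>\<^bsub>A'\<^esub> b) [^]\<^bsub>A' Mod N'\<^esub> k = N' #>\<^bsub>A'\<^esub> (b [^]\<^bsub>A'\<^esub> k)"
      using r.hom_nat_pow[OF b, of k] by simp
    show ?thesis
      unfolding pow image_iff using A'.rcos_eq_iff[OF N' A'.nat_pow_closed[OF b] fc] by blast
  qed
  then show ?thesis unfolding img unfolding car by simp
qed

lemma dress_generating_set_iff:
  fixes X :: "('g, 'u) gset" and M :: "('g, 'u, 'm) mackey"
  assumes X: "fin_gset G X"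
    and group: "\<And>p. prime p \<Longrightarrow> comm_group (add_monoid (mval M (hyper G p X)))"
      "comm_group (add_monoid (mval M one_point))"
    and hom: "\<And>p. prime p \<Longrightarrow> mcov M (hyper G p X) one_point (to_point (hyper G p X))
      \<in> hom (add_monoid (mval M (hyper G p X))) (add_monoid (mval M one_point))"
  shows "dress_generating_set G M X \<longleftrightarrow> (\<forall>p. prime p \<longrightarrow> (\<forall>b \<in> carrier (add_monoid (mval M one_point)).
     \<exists>k::nat. \<not> p dvd k \<and> b [^]\<^bsub>add_monoid (mval M one_point)\<^esub> k \<in>
       mcov M (hyper G p X) one_point (to_point (hyper G p X)) ` carrier (add_monoid (mval M (hyper G p X)))))"
  unfolding dress_generating_set_def
  using X tensor_map_localized_surj_iff[OF group(1) group(2) hom] by simp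

context mackey_action
begin

lemma quotient_add_monoid:
  "add_monoid (mval (burnside_quotient G M) S) = add_monoid (B S) Mod burnside_annihilator G M S"
  by (simp add: burnside_quotient_def burnside_simps FactRing_def FactGroup_def A_RCOSETS_def set_add_def)

lemma quotient_cov:
  "mcov (burnside_quotient G M) S T \<phi> = (\<lambda>C. \<Union>x \<in> C. burnside_annihilator G M T #>\<^bsub>add_monoid (B T)\<^esub> mcov (burnside G) S T \<phi> x)"
  by (simp add: burnside_quotient_def burnside_simps quot_map_def a_r_coset_def fun_eq_iff)

lemma dress_generating_set_quotient_iff:
  assumes X: "fin_gset G X"
  shows "dress_generating_set G (burnside_quotient G M) X \<longleftrightarrow>
    (\<forall>p. prime p \<longrightarrow> (\<forall>b \<in> carrier (B one_point). \<exists>k::nat. \<not> p dvd k \<and> (\<exists>a \<in> carrier (B (hyper G p X)).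
      [k] \<cdot>\<^bsub>B one_point\<^esub> b \<ominus>\<^bsub>B one_point\<^esub> mcov (burnside G) (hyper G p X) one_point (to_point (hyper G p X)) a
        \<in> burnside_annihilator G M one_point)))"
proof -
  have cg: "comm_group (add_monoid (B S))" for S :: "('g, 'u) gset"
    by (rule abelian_group.a_comm_group[OF B_abelian_group])
  have Y: "fin_gset G (hyper G p X)" if "prime p" for p using hyper_properties(1)[OF that X] .
  note pt = to_point_gmaps[OF Y]
  have img: "mcov (burnside G) (hyper G p X) one_point (to_point (hyper G p X)) ` burnside_annihilator G M (hyper G p X)
      \<subseteq> burnside_annihilator G M one_point" if "prime p" for p
    using push_annihilator[OF Y[OF that] one_point_gset pt[OF that]] by blast
  have comm: "comm_group (add_monoid (B S) Mod burnside_annihilator G M S)" if "fin_gset G S" for S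
    by (rule comm_group.abelian_FactGroup[OF cg annihilator_subgroup[OF that]])
  have "dress_generating_set G (burnside_quotient G M) X \<longleftrightarrow>
    (\<forall>p. prime p \<longrightarrow> (\<forall>b \<in> carrier (add_monoid (mval (burnside_quotient G M) one_point)).
     \<exists>k::nat. \<not> p dvd k \<and> b [^]\<^bsub>add_monoid (mval (burnside_quotient G M) one_point)\<^esub> k \<in>
       mcov (burnside_quotient G M) (hyper G p X) one_point (to_point (hyper G p X))
         ` carrier (add_monoid (mval (burnside_quotient G M) (hyper G p X)))))"
  proof (rule dress_generating_set_iff[OF X])
    show "comm_group (add_monoid (mval (burnside_quotient G M) one_point))"
      unfolding quotient_add_monoid by (rule comm[OF one_point_gset])
    fix p :: nat assume p: "prime p"
    show "comm_group (add_monoid (mval (burnside_quotient G M) (hyper G p X)))"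
      unfolding quotient_add_monoid by (rule comm[OF Y[OF p]])
    show "mcov (burnside_quotient G M) (hyper G p X) one_point (to_point (hyper G p X))
      \<in> hom (add_monoid (mval (burnside_quotient G M) (hyper G p X))) (add_monoid (mval (burnside_quotient G M) one_point))"
      unfolding quotient_add_monoid quotient_cov
      by (rule quotient_map_hom[OF cg cg annihilator_subgroup[OF Y[OF p]] annihilator_subgroup[OF one_point_gset]
            B_push_hom[OF pt[OF p]] img[OF p]])
  qed
  also have "\<dots> \<longleftrightarrow> (\<forall>p. prime p \<longrightarrow> (\<forall>b \<in> carrier (add_monoid (B one_point)). \<exists>k::nat. \<not> p dvd k \<and>
      (\<exists>a \<in> carrier (add_monoid (B (hyper G p X))). b [^]\<^bsub>add_monoid (B one_point)\<^esub> k \<otimes>\<^bsub>add_monoid (B one_point)\<^esub>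
        inv\<^bsub>add_monoid (B one_point)\<^esub> mcov (burnside G) (hyper G p X) one_point (to_point (hyper G p X)) a
        \<in> burnside_annihilator G M one_point)))"
    unfolding quotient_add_monoid quotient_cov
    using quotient_surj_iff[OF cg cg annihilator_subgroup[OF Y] annihilator_subgroup[OF one_point_gset]
        B_push_hom[OF pt] img] by simp
  finally show ?thesis by (simp add: add_pow_def a_minus_def a_inv_def)
qed

end

locale green_action = mackey_action G u R + green_ring G R
  for G :: "('g, 'b) monoid_scheme" (structure) and u :: "'u itself" and R :: "('g, 'u, 'm) mackey"
begin

lemma dress_generating_set_green_iff:
  assumes X: "fin_gset G X"
  shows "dress_generating_set G R X \<longleftrightarrow> (\<forall>p. prime p \<longrightarrow> (\<forall>b \<in> carrier (mval R one_point). \<exists>k::nat. \<not> p dvd k \<and>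
      [k] \<cdot>\<^bsub>mval R one_point\<^esub> b \<in> mcov R (hyper G p X) one_point (to_point (hyper G p X)) ` carrier (mval R (hyper G p X))))"
proof -
  have Y: "fin_gset G (hyper G p X)" if "prime p" for p using hyper_properties(1)[OF that X] .
  have "dress_generating_set G R X \<longleftrightarrow> (\<forall>p. prime p \<longrightarrow> (\<forall>b \<in> carrier (add_monoid (mval R one_point)).
     \<exists>k::nat. \<not> p dvd k \<and> b [^]\<^bsub>add_monoid (mval R one_point)\<^esub> k \<in>
       mcov R (hyper G p X) one_point (to_point (hyper G p X)) ` carrier (add_monoid (mval R (hyper G p X)))))"
    by (rule dress_generating_set_iff[OF X])
      (blast intro: abelian_group.a_comm_group val_abelian cov_hom Y one_point_gset to_point_gmaps)+
  then show ?thesis by (simp add: add_pow_def)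
qed

text \<open>Let \<open>W\<close> be the pullback of \<open>U\<close> and \<open>Y\<close>. By base change, \<open>k\<cdot>1 \<in> R(U)\<close> is induced from the pullback
  \<open>r\<^sup>*(y)\<close> to \<open>W\<close>; by Frobenius reciprocity, \<open>k z = q\<^sub>*(r\<^sup>*(y) q\<^sup>*(z))\<close>.\<close>

lemma multiple_induced:
  assumes Y: "fin_gset G Y" and U: "fin_gset G U" and \<pi>: "\<pi> \<in> gmaps G Y T" and \<psi>: "\<psi> \<in> gmaps G U T" and T: "fin_gset G T"
    and y: "y \<in> carrier (mval R Y)" "[k] \<cdot>\<^bsub>mval R T\<^esub> \<one>\<^bsub>mval R T\<^esub> = mcov R Y T \<pi> y" and z: "z \<in> carrier (mval R U)"
  shows "\<exists>(W :: ('g, 'u) gset) q r w. fin_gset G W \<and> q \<in> gmaps G W U \<and> r \<in> gmaps G W Y \<and> w \<in> carrier (mval R W) \<and>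
    [(k::nat)] \<cdot>\<^bsub>mval R U\<^esub> z = mcov R W U q w"
proof -
  interpret RU: ring "mval R U" by (rule val_ring[OF U])
  interpret RT: ring "mval R T" by (rule val_ring[OF T])
  obtain W :: "('g, 'u) gset" and q r where W: "fin_gset G W" and sq: "pullback_square G W U Y T q r \<psi> \<pi>"
    using ex_pullback[OF U Y \<psi> \<pi>] by blast
  have q: "q \<in> gmaps G W U" and r: "r \<in> gmaps G W Y" using pullback_squareD(1,2)[OF sq] .
  have hom: "group_hom (add_monoid (mval R T)) (add_monoid (mval R U)) (mcon R U T \<psi>)"
    using con_hom[OF U T \<psi>] RT.a_group RU.a_group by (simp add: group_hom_def group_hom_axioms_def)
  have "[k] \<cdot>\<^bsub>mval R U\<^esub> \<one>\<^bsub>mval R U\<^esub> = mcon R U T \<psi> ([k] \<cdot>\<^bsub>mval R T\<^esub> \<one>\<^bsub>mval R T\<^esub>)"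
    using group_hom.hom_nat_pow[OF hom, of "\<one>\<^bsub>mval R T\<^esub>" k] con_one[OF U T \<psi>] by (simp add: add_pow_def)
  also have "\<dots> = mcov R W U q (mcon R W Y r y)" unfolding y(2) by (rule pullback[OF W U Y T sq y(1)])
  finally have "[k] \<cdot>\<^bsub>mval R U\<^esub> z = mcov R W U q (mcon R W Y r y) \<otimes>\<^bsub>mval R U\<^esub> z"
    using RU.add_pow_ldistr[OF RU.one_closed z, of k] z by simp
  also have "\<dots> = mcov R W U q (mcon R W Y r y \<otimes>\<^bsub>mval R W\<^esub> mcon R W U q z)"
    by (rule frobenius_right[OF W U q con_closed[OF W Y r y(1)] z])
  finally show ?thesis
    using W q r closed[OF W con_closed[OF W Y r y(1)] con_closed[OF W U q z]] by blast
qed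

text \<open>If \<open>e\<close> is the difference of \<open>C\<close> and \<open>D\<close>, then \<open>k e\<close> acts on \<open>z\<close> as \<open>e\<close> acts on \<open>k z = q\<^sub>*(w)\<close>, that is,
  as \<open>q\<^sub>*\<close> of \<open>q\<^sup>*(e)\<cdot>w\<close>. The isotropy of \<open>W\<close> is in \<open>\<F>\<close>, as \<open>W\<close> maps to \<open>Y\<close>; so \<open>C\<close> and \<open>D\<close> become equal
  over \<open>W\<close>.\<close>

lemma annihilator_if_marks_eq:
  assumes Y: "fin_gset G Y" "isotropy_in \<F> Y"
    and y: "y \<in> carrier (mval R Y)" "[k] \<cdot>\<^bsub>mval R one_point\<^esub> \<one>\<^bsub>mval R one_point\<^esub> = mcov R Y one_point (to_point Y) y"
    and C: "C \<in> carrier (over_semiring G one_point)" "D \<in> carrier (over_semiring G one_point)"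
    and marks: "\<And>K. \<lbrakk>subgroup K G; K \<in> \<F>\<rbrakk> \<Longrightarrow> class_mark C K = class_mark D K"
  shows "[(k::nat)] \<cdot>\<^bsub>B one_point\<^esub> groth_diff (over_semiring G one_point) C D \<in> burnside_annihilator G R one_point"
proof -
  interpret BP: abelian_group "B (one_point :: ('g, 'u) gset)" by (rule B_abelian_group)
  let ?e = "groth_diff (over_semiring G one_point) C D"
  have e: "?e \<in> carrier (B one_point)" by (rule groth.groth_carrierI[OF groth_over_semiring C])
  have "burnside_act R U (mcon (burnside G) U one_point \<psi> ([k] \<cdot>\<^bsub>B one_point\<^esub> ?e)) z = \<zero>\<^bsub>mval R U\<^esub>"
    if U: "fin_gset G U" and \<psi>: "\<psi> \<in> gmaps G U one_point" and z: "z \<in> carrier (mval R U)" for U \<psi> z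
  proof -
    let ?p = "mcon (burnside G) U one_point \<psi>"
    have pe: "?p ?e \<in> carrier (B U)" by (rule B_pull_closed[OF U \<psi> e])
    obtain W :: "('g, 'u) gset" and q r w where W: "fin_gset G W" and q: "q \<in> gmaps G W U" and r: "r \<in> gmaps G W Y"
      and w: "w \<in> carrier (mval R W)" and kz: "[k] \<cdot>\<^bsub>mval R U\<^esub> z = mcov R W U q w"
      using multiple_induced[OF Y(1) U to_point_gmaps[OF Y(1)] \<psi> one_point_gset y z] by blast
    interpret RW: abelian_group_hom "B W" "mval R W" "\<lambda>a. burnside_act R W a w" by (rule burnside_act_hom_left[OF W w])
    have hp: "group_hom (add_monoid (B one_point)) (add_monoid (B U)) ?p"
      using B_pull_hom[OF U \<psi>] B_abelian_group[of U, THEN abelian_group.a_group] BP.a_group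
      by (simp add: group_hom_def group_hom_axioms_def)
    have hl: "group_hom (add_monoid (B U)) (add_monoid (mval R U)) (\<lambda>a. burnside_act R U a z)"
      by (rule abelian_group_hom.a_group_hom[OF burnside_act_hom_left[OF U z]])
    have hr: "group_hom (add_monoid (mval R U)) (add_monoid (mval R U)) (burnside_act R U (?p ?e))"
      by (rule abelian_group_hom.a_group_hom[OF burnside_act_hom_right[OF U pe]])
    have "burnside_act R U (?p ([k] \<cdot>\<^bsub>B one_point\<^esub> ?e)) z = burnside_act R U ([k] \<cdot>\<^bsub>B U\<^esub> ?p ?e) z"
      using group_hom.hom_nat_pow[OF hp, of ?e k] e by (simp add: add_pow_def)
    also have "\<dots> = [k] \<cdot>\<^bsub>mval R U\<^esub> burnside_act R U (?p ?e) z"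
      using group_hom.hom_nat_pow[OF hl, of "?p ?e" k] pe by (simp add: add_pow_def)
    also have "\<dots> = burnside_act R U (?p ?e) (mcov R W U q w)"
      using group_hom.hom_nat_pow[OF hr, of z k] z kz by (simp add: add_pow_def)
    also have "\<dots> = mcov R W U q (burnside_act R W (mcon (burnside G) W U q (?p ?e)) w)"
      by (rule burnside_act_cov[OF W U q pe w])
    also have "mcon (burnside G) W U q (?p ?e) = \<zero>\<^bsub>B W\<^esub>"
    proof -
      have "isotropy_in \<F> W" by (rule isotropy_in_map[OF gmapsD(4)[OF r] Y(2)])
      from pull_eq_if_marks_eq[OF W this C marks]
      have eq: "over_pull G W (to_point W) C = over_pull G W (to_point W) D" .
      have "mcon (burnside G) W U q (?p ?e) = mcon (burnside G) W one_point (to_point W) ?e"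
        using B_pull_compose[OF W U q \<psi> e] gmaps_to_point[OF W gmaps_compose[OF W q \<psi>]] by simp
      also have "\<dots> = \<zero>\<^bsub>B W\<^esub>"
        unfolding B_pull_diff[OF W to_point_gmaps[OF W] C] eq
        by (rule groth.groth_diff_refl[OF groth_over_semiring over_pull_carrier[OF W to_point_gmaps[OF W] C(2)]])
      finally show ?thesis .
    qed
    finally show ?thesis using RW.hom_zero cov_zero[OF W U q] by simp
  qed
  moreover have "[k] \<cdot>\<^bsub>B one_point\<^esub> ?e \<in> carrier (B one_point)" using BP.add.nat_pow_closed[OF e] .
  ultimately show ?thesis using annihilator_iff[OF one_point_gset] by blast
qed

text \<open>The element of the annihilator is \<open>k - \<pi>\<^sub>*(a)\<close>. It kills \<open>1\<close>, so that \<open>k\<cdot>1 = \<pi>\<^sub>*(a)\<cdot>1\<close> is induced from \<open>Y\<close>,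
  and the induced elements form an ideal.\<close>

lemma multiple_induced_if_annihilator:
  assumes Y: "fin_gset G Y" and \<pi>: "\<pi> \<in> gmaps G Y T" and T: "fin_gset G T" and a: "a \<in> carrier (B Y)"
    and ann: "[(k::nat)] \<cdot>\<^bsub>B T\<^esub> groth_diff (over_semiring G T) (over_class G T T (\<lambda>s \<in> pts T. s)) \<zero>\<^bsub>over_semiring G T\<^esub>
        \<ominus>\<^bsub>B T\<^esub> mcov (burnside G) Y T \<pi> a \<in> burnside_annihilator G R T"
    and m: "m \<in> carrier (mval R T)"
  shows "[k] \<cdot>\<^bsub>mval R T\<^esub> m \<in> mcov R Y T \<pi> ` carrier (mval R Y)"
proof -
  interpret RT: ring "mval R T" by (rule val_ring[OF T])
  interpret BT: abelian_group "B T" by (rule B_abelian_group)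
  interpret OT: abelian_monoid "over_semiring G T" by (rule abelian_monoid_over_semiring)
  let ?one = "over_class G T T (\<lambda>s \<in> pts T. s)"
  let ?u = "groth_diff (over_semiring G T) ?one \<zero>\<^bsub>over_semiring G T\<^esub>"
  let ?e = "[k] \<cdot>\<^bsub>B T\<^esub> ?u \<ominus>\<^bsub>B T\<^esub> mcov (burnside G) Y T \<pi> a"
  note 1 = RT.one_closed
  interpret h: abelian_group_hom "B T" "mval R T" "\<lambda>a. burnside_act R T a \<one>\<^bsub>mval R T\<^esub>"
    by (rule burnside_act_hom_left[OF T 1])
  have one: "?one \<in> carrier (over_semiring G T)"
    by (rule over_class_carrier[OF T gmapsD(4)[OF gmaps_id[OF T]]])
  have u: "?u \<in> carrier (B T)" by (rule groth.groth_carrierI[OF groth_over_semiring one OT.zero_closed])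
  have pa: "mcov (burnside G) Y T \<pi> a \<in> carrier (B T)" by (rule B_push_closed[OF \<pi> a])
  have ku: "[k] \<cdot>\<^bsub>B T\<^esub> ?u \<in> carrier (B T)" using BT.add.nat_pow_closed[OF u] .
  have act_one: "over_act R T ?one \<one>\<^bsub>mval R T\<^esub> = \<one>\<^bsub>mval R T\<^esub>"
    using over_act_class[OF T T gmaps_id[OF T] 1] con_id[OF T 1] cov_id[OF T 1] by simp
  have act_zero: "over_act R T \<zero>\<^bsub>over_semiring G T\<^esub> \<one>\<^bsub>mval R T\<^esub> = \<zero>\<^bsub>mval R T\<^esub>"
    using over_act_add_left[OF T OT.zero_closed OT.zero_closed 1] over_act_closed[OF T OT.zero_closed 1] by simp
  have "burnside_act R T ?u \<one>\<^bsub>mval R T\<^esub> = \<one>\<^bsub>mval R T\<^esub>"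
    unfolding burnside_act_diff[OF T one OT.zero_closed 1] act_one act_zero by (simp add: a_minus_def)
  then have act_ku: "burnside_act R T ([k] \<cdot>\<^bsub>B T\<^esub> ?u) \<one>\<^bsub>mval R T\<^esub> = [k] \<cdot>\<^bsub>mval R T\<^esub> \<one>\<^bsub>mval R T\<^esub>"
    using group_hom.hom_nat_pow[OF h.a_group_hom, of ?u k] u by (simp add: add_pow_def)
  have ec: "?e \<in> carrier (B T)" using ku pa by simp
  have "burnside_act R T (mcon (burnside G) T T (\<lambda>s \<in> pts T. s) ?e) \<one>\<^bsub>mval R T\<^esub> = \<zero>\<^bsub>mval R T\<^esub>"
    using ann gmaps_id[OF T] T 1 annihilator_iff[OF T, of ?e] by blast
  then have "burnside_act R T ([k] \<cdot>\<^bsub>B T\<^esub> ?u) \<one>\<^bsub>mval R T\<^esub>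
      \<ominus>\<^bsub>mval R T\<^esub> burnside_act R T (mcov (burnside G) Y T \<pi> a) \<one>\<^bsub>mval R T\<^esub> = \<zero>\<^bsub>mval R T\<^esub>"
    unfolding B_pull_id[OF T ec] using ku pa by (simp add: a_minus_def)
  then have k1: "[k] \<cdot>\<^bsub>mval R T\<^esub> \<one>\<^bsub>mval R T\<^esub> = burnside_act R T (mcov (burnside G) Y T \<pi> a) \<one>\<^bsub>mval R T\<^esub>"
    using act_ku RT.eq_if_minus_zero[OF RT.add.nat_pow_closed[OF 1, of k] burnside_act_closed[OF T pa 1]]
    by simp
  define y where "y = burnside_act R Y a (mcon R Y T \<pi> \<one>\<^bsub>mval R T\<^esub>)"
  have y: "y \<in> carrier (mval R Y)" unfolding y_def by (rule burnside_act_closed[OF Y a con_closed[OF Y T \<pi> 1]])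
  have k1: "[k] \<cdot>\<^bsub>mval R T\<^esub> \<one>\<^bsub>mval R T\<^esub> = mcov R Y T \<pi> y"
    unfolding k1 y_def by (rule burnside_act_push[OF Y T \<pi> a 1])
  have "[k] \<cdot>\<^bsub>mval R T\<^esub> m = m \<otimes>\<^bsub>mval R T\<^esub> mcov R Y T \<pi> y"
    using RT.add_pow_rdistr[OF m 1, of k] m k1 by simp
  also have "\<dots> = mcov R Y T \<pi> (mcon R Y T \<pi> m \<otimes>\<^bsub>mval R Y\<^esub> y)" by (rule frobenius_left[OF Y T \<pi> m y])
  finally show ?thesis using closed[OF Y con_closed[OF Y T \<pi> m] y] by blast
qed

text \<open>Write \<open>b = C\<^sub>1 - C\<^sub>2\<close>. Then \<open>(n + v - v') b\<close> has no virtual point fixed by a member of the family, so that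
  its multiple by \<open>k\<close> annihilates \<open>R\<close>; and \<open>(v' - v) b\<close> is induced from \<open>Y\<close>.\<close>

lemma burnside_multiple_induced:
  fixes X :: "('g, 'u) gset"
  assumes p: "prime p" and X: "fin_gset G X"
  defines "Y \<equiv> hyper G p X"
  assumes k: "\<not> p dvd k"
    and y: "y \<in> carrier (mval R Y)" "[k] \<cdot>\<^bsub>mval R one_point\<^esub> \<one>\<^bsub>mval R one_point\<^esub> = mcov R Y one_point (to_point Y) y"
    and b: "b \<in> carrier (B one_point)"
  shows "\<exists>k::nat. \<not> p dvd k \<and> (\<exists>a \<in> carrier (B Y).
      [k] \<cdot>\<^bsub>B one_point\<^esub> b \<ominus>\<^bsub>B one_point\<^esub> mcov (burnside G) Y one_point (to_point Y) a \<in> burnside_annihilator G R one_point)"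
proof -
  let ?F = "hyper_family G p (isotropy_family G X)" and ?pt = "one_point :: ('g, 'u) gset"
  let ?O = "over_semiring G ?pt" and ?OY = "over_semiring G Y"
  note F = isotropy_family_family[OF X]
  note Y = hyper_properties[OF p X, folded Y_def]
  note \<pi> = to_point_gmaps[OF Y(1)]
  interpret OP: groth ?O by (rule groth_over_semiring)
  interpret OY: groth ?OY by (rule groth_over_semiring)
  interpret BP: abelian_group "B ?pt" by (rule B_abelian_group)
  interpret BY: abelian_group "B Y" by (rule B_abelian_group)
  obtain n v v' where n: "\<not> p dvd n" and v: "realizes G Y v" "realizes G Y v'"
    and unit: "\<And>K. K \<in> ?F \<Longrightarrow> n + v K = v' K"
    using ex_virtual_unit[OF p Y(1) F Y(3) subgroup_family_finite[OF hyper_family_family[OF p F]] subset_refl] by blast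
  obtain C1 C2 where C: "C1 \<in> carrier ?O" "C2 \<in> carrier ?O" and bC: "b = groth_diff ?O C1 C2"
    using b by (rule B_carrierE)
  \<comment> \<open>The two parts of \<open>(v' - v) (C\<^sub>1 - C\<^sub>2) = (v' C\<^sub>1 + v C\<^sub>2) - (v C\<^sub>1 + v' C\<^sub>2)\<close>.\<close>
  have "realizes G Y (\<lambda>K. v' K * class_mark C1 K + v K * class_mark C2 K) \<and>
      realizes G Y (\<lambda>K. v K * class_mark C1 K + v' K * class_mark C2 K)"
  proof -
    have r: "realizes G Y (\<lambda>K. m K * class_mark C K)" if m: "realizes G Y m" and C: "C \<in> carrier ?O" for m C
    proof -
      obtain Z :: "('g, 'u) gset" and f where Z: "fin_gset G Z" "equivariant G Z ?pt f" "C = over_class G ?pt Z f"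
        using C by (metis over_carrierE gmapsD(4))
      show ?thesis by (rule realizes_cong[OF realizes_mult[OF m Z(1)]]) (simp add: Z(3) class_mark_class[OF Z(1,2)])
    qed
    show ?thesis by (intro conjI realizes_add r v C)
  qed
  then obtain D1 D2 where D: "D1 \<in> carrier ?OY" "D2 \<in> carrier ?OY"
    and D1: "\<And>K. subgroup K G \<Longrightarrow> class_mark D1 K = v' K * class_mark C1 K + v K * class_mark C2 K"
    and D2: "\<And>K. subgroup K G \<Longrightarrow> class_mark D2 K = v K * class_mark C1 K + v' K * class_mark C2 K"
    unfolding realizes_def by blast
  let ?a = "groth_diff ?OY D1 D2"
  let ?E1 = "over_push G ?pt (to_point Y) D1" and ?E2 = "over_push G ?pt (to_point Y) D2"
  have E: "?E1 \<in> carrier ?O" "?E2 \<in> carrier ?O" using over_push_carrier[OF \<pi>] D by auto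
  have a: "?a \<in> carrier (B Y)" by (rule OY.groth_carrierI[OF D])
  have push: "mcov (burnside G) Y ?pt (to_point Y) ?a = groth_diff ?O ?E1 ?E2" by (rule B_push_diff[OF \<pi> D])
  have nC: "[n] \<cdot>\<^bsub>?O\<^esub> C1 \<in> carrier ?O" "[n] \<cdot>\<^bsub>?O\<^esub> C2 \<in> carrier ?O"
    using OP.add.nat_pow_closed C by auto
  have nb: "[n] \<cdot>\<^bsub>B ?pt\<^esub> b = groth_diff ?O ([n] \<cdot>\<^bsub>?O\<^esub> C1) ([n] \<cdot>\<^bsub>?O\<^esub> C2)"
    unfolding bC by (rule OP.groth_multiple[OF C])
  let ?P = "[n] \<cdot>\<^bsub>?O\<^esub> C1 \<oplus>\<^bsub>?O\<^esub> ?E2" and ?N = "[n] \<cdot>\<^bsub>?O\<^esub> C2 \<oplus>\<^bsub>?O\<^esub> ?E1"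
  have PN: "?P \<in> carrier ?O" "?N \<in> carrier ?O" using nC E by auto
  have diff: "[n] \<cdot>\<^bsub>B ?pt\<^esub> b \<ominus>\<^bsub>B ?pt\<^esub> mcov (burnside G) Y ?pt (to_point Y) ?a = groth_diff ?O ?P ?N"
    unfolding nb push a_minus_def OP.groth_uminus[OF E] by (rule OP.groth_add[OF nC E(2,1)])
  have marks: "class_mark ?P K = class_mark ?N K" if K: "subgroup K G" "K \<in> ?F" for K
  proof -
    have "v' K = n + v K" using unit[OF K(2)] by simp
    then show ?thesis
      using class_mark_add[OF nC(1) E(2) K(1)] class_mark_add[OF nC(2) E(1) K(1)]
        class_mark_multiple[OF C(1) K(1), of n] class_mark_multiple[OF C(2) K(1), of n]
        class_mark_push[OF \<pi> D(1) K(1)] class_mark_push[OF \<pi> D(2) K(1)] D1[OF K(1)] D2[OF K(1)]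
      by (simp add: algebra_simps)
  qed
  have ann: "[k] \<cdot>\<^bsub>B ?pt\<^esub> groth_diff ?O ?P ?N \<in> burnside_annihilator G R ?pt"
    by (rule annihilator_if_marks_eq[OF Y(1,2) y PN marks])
  have bc: "[n] \<cdot>\<^bsub>B ?pt\<^esub> b \<in> carrier (B ?pt)" using BP.add.nat_pow_closed[OF b] .
  have pa: "mcov (burnside G) Y ?pt (to_point Y) ?a \<in> carrier (B ?pt)" by (rule B_push_closed[OF \<pi> a])
  have ka: "[k] \<cdot>\<^bsub>B Y\<^esub> ?a \<in> carrier (B Y)" using BY.add.nat_pow_closed[OF a] .
  have hom: "group_hom (add_monoid (B Y)) (add_monoid (B ?pt)) (mcov (burnside G) Y ?pt (to_point Y))"
    using B_push_hom[OF \<pi>] BY.a_group BP.a_group by (simp add: group_hom_def group_hom_axioms_def)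
  have pk: "mcov (burnside G) Y ?pt (to_point Y) ([k] \<cdot>\<^bsub>B Y\<^esub> ?a) = [k] \<cdot>\<^bsub>B ?pt\<^esub> mcov (burnside G) Y ?pt (to_point Y) ?a"
    using group_hom.hom_nat_pow[OF hom, of ?a k] a by (simp add: add_pow_def)
  have "[k] \<cdot>\<^bsub>B ?pt\<^esub> ([n] \<cdot>\<^bsub>B ?pt\<^esub> b \<ominus>\<^bsub>B ?pt\<^esub> mcov (burnside G) Y ?pt (to_point Y) ?a)
      = [(n * k)] \<cdot>\<^bsub>B ?pt\<^esub> b \<ominus>\<^bsub>B ?pt\<^esub> mcov (burnside G) Y ?pt (to_point Y) ([k] \<cdot>\<^bsub>B Y\<^esub> ?a)"
    unfolding pk a_minus_def
    using BP.multiple_minus[OF b pa, of k n] by (simp add: a_minus_def)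
  then have "[(n * k)] \<cdot>\<^bsub>B ?pt\<^esub> b \<ominus>\<^bsub>B ?pt\<^esub> mcov (burnside G) Y ?pt (to_point Y) ([k] \<cdot>\<^bsub>B Y\<^esub> ?a)
      \<in> burnside_annihilator G R ?pt"
    using ann diff by simp
  moreover have "\<not> p dvd n * k" using n k p by (simp add: prime_dvd_mult_iff)
  ultimately show ?thesis using ka by blast
qed

end

theorem theoremA:
  fixes G :: "('g, 'b) monoid_scheme"
    and R :: "('g, 'u, 'm) mackey"
    and X :: "('g, 'u) gset"
  assumes "group G" and "finite (carrier G)"
    and "infinite (UNIV :: 'u set)"
    and "green_ring G R"
    and "fin_gset G X"
  shows "dress_generating_set G R X \<longleftrightarrow> dress_generating_set G (burnside_quotient G R) X"
proof -
  interpret green_action G "TYPE('u)" R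
    using assms(1-4) mackey_pairing.axioms(1)[OF green_ring.axioms(1)[OF assms(4)]]
    by (simp add: green_action_def mackey_action_def gset_universe_def gset_universe_axioms_def fin_group_def
        fin_group_axioms_def)
  let ?pt = "one_point :: ('g, 'u) gset"
  note X = assms(5) and pt = one_point_gset
  interpret RP: ring "mval R ?pt" by (rule val_ring[OF pt])
  show ?thesis
    unfolding dress_generating_set_green_iff[OF X] dress_generating_set_quotient_iff[OF X]
  proof (intro iffI allI impI ballI)
    fix p :: nat and b
    assume dress: "\<forall>p. prime p \<longrightarrow> (\<forall>b \<in> carrier (mval R ?pt). \<exists>k::nat. \<not> p dvd k \<and>
      [k] \<cdot>\<^bsub>mval R ?pt\<^esub> b \<in> mcov R (hyper G p X) ?pt (to_point (hyper G p X)) ` carrier (mval R (hyper G p X)))"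
      and p: "prime p" and b: "b \<in> carrier (B ?pt)"
    obtain k y where "\<not> p dvd k" "y \<in> carrier (mval R (hyper G p X))"
      "[(k::nat)] \<cdot>\<^bsub>mval R ?pt\<^esub> \<one>\<^bsub>mval R ?pt\<^esub> = mcov R (hyper G p X) ?pt (to_point (hyper G p X)) y"
      using dress p RP.one_closed by blast
    from burnside_multiple_induced[OF p X this b]
    show "\<exists>k::nat. \<not> p dvd k \<and> (\<exists>a \<in> carrier (B (hyper G p X)). [k] \<cdot>\<^bsub>B ?pt\<^esub> b
        \<ominus>\<^bsub>B ?pt\<^esub> mcov (burnside G) (hyper G p X) ?pt (to_point (hyper G p X)) a \<in> burnside_annihilator G R ?pt)" .
  next
    fix p :: nat and m
    assume dress: "\<forall>p. prime p \<longrightarrow> (\<forall>b \<in> carrier (B ?pt). \<exists>k::nat. \<not> p dvd k \<and> (\<exists>a \<in> carrier (B (hyper G p X)).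
        [k] \<cdot>\<^bsub>B ?pt\<^esub> b \<ominus>\<^bsub>B ?pt\<^esub> mcov (burnside G) (hyper G p X) ?pt (to_point (hyper G p X)) a
          \<in> burnside_annihilator G R ?pt))"
      and p: "prime p" and m: "m \<in> carrier (mval R ?pt)"
    \<comment> \<open>The unit of the Burnside ring of the point.\<close>
    let ?u = "groth_diff (over_semiring G ?pt) (over_class G ?pt ?pt (\<lambda>s \<in> pts ?pt. s)) \<zero>\<^bsub>over_semiring G ?pt\<^esub>"
    note Y = hyper_properties(1)[OF p X]
    have "?u \<in> carrier (B ?pt)"
      using groth.groth_carrierI[OF groth_over_semiring over_class_carrier[OF pt gmapsD(4)[OF gmaps_id[OF pt]]]
          abelian_monoid.zero_closed[OF abelian_monoid_over_semiring]] .
    then obtain k a where "\<not> p dvd k" "a \<in> carrier (B (hyper G p X))"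
      "[(k::nat)] \<cdot>\<^bsub>B ?pt\<^esub> ?u \<ominus>\<^bsub>B ?pt\<^esub> mcov (burnside G) (hyper G p X) ?pt (to_point (hyper G p X)) a
          \<in> burnside_annihilator G R ?pt"
      using dress p by blast
    then show "\<exists>k::nat. \<not> p dvd k \<and>
        [k] \<cdot>\<^bsub>mval R ?pt\<^esub> m \<in> mcov R (hyper G p X) ?pt (to_point (hyper G p X)) ` carrier (mval R (hyper G p X))"
      using multiple_induced_if_annihilator[OF Y to_point_gmaps[OF Y] pt _ _ m] by blast
  qed
qed

end
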